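(* Let $\alpha \ge 0$. For each $n \ge 1$, let $T_n$ be a uniformly random rooted plane tree with $n$ vertices. Suppose that $\lfloor \alpha n \rfloor$ cars wish to park on $T_n$, each car arriving at an independent uniformly random vertex of the tree, and let $A_{n,\alpha}$ be the event that all the cars can park. Then $$\lim_{n \to \infty} \mathbb{P}(A_{n,\alpha}) = \begin{cases} \dfrac{\sqrt{1-2\alpha-\alpha^2}}{(1-\alpha)^2 \exp(\alpha)} & \text{if } 0 \le \alpha \le \sqrt{2}-1, \\[2mm] 0 & \text{if } \alpha > \sqrt{2}-1. \end{cases}$$
   Context: Let $\mathbb{U} = \bigcup_{n\ge 0} \mathbb{N}^n$ with $\mathbb{N}=\{1,2,\ldots\}$ and $\mathbb{N}^0=\{\emptyset\}$, whose elements are words $\mathbf{u}=u_1\cdots u_n$; the parent of a non-empty word $\mathbf{u}$ is $p(\mathbf{u})=u_1\cdots u_{n-1}$. A rooted plane tree is a subset $\mathrm{t}\subset\mathbb{U}$ such that: (a) $\emptyset\in \mathrm{t}$ (the root); (b) if $\mathbf{u}\in \mathrm{t}$, $\mathbf{u}\ne\emptyset$, then $p(\mathbf{u})\in \mathrm{t}$; (c) for every $\mathbf{u}\in \mathrm{t}$ there is an integer $0 \le k(\mathbf{u})<\infty$ such that, for $i \in \mathbb{N}$, $\mathbf{u}i\in \mathrm{t}$ if and only if $1\le i\le k(\mathbf{u})$. Edges are directed from $\mathbf{u}$ to $p(\mathbf{u})$. The set $\mathcal{T}_n$ of rooted plane trees with $n$ vertices is finite, and $T_n$ is uniform on $\mathcal{T}_n$;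 given $T_n$, the arrival vertices of the cars are independent and uniform on the vertices of $T_n$. Parking rules: each vertex has a parking space for a single car. Cars arrive one by one. If the space at the vertex where a car arrives is unoccupied, it parks there; if not, the car drives along the directed edges towards the root and parks in the first empty space it encounters. If all spaces along the way up to and including the root are occupied, the car leaves the tree and cannot park. (Whether all cars can park does not depend on the order of arrival.) *)

theory Defs
  imports "HOL-Probability.Probability"
begin

text \<open>
  A vertex is a finite word over the positive integers, represented as a list of type
  \<^typ>\<open>nat list\<close>. The root is the empty word, and the parent of a non-empty word \<open>u\<close>
  is \<open>butlast u\<close>.
\<close>

definition plane_tree :: "nat list set \<Rightarrow> bool" where
  "plane_tree t \<longleftrightarrow>
     t \<subseteq> lists {1..} \<and>
     [] \<in> t \<and>
     (\<forall>u\<in>t. u \<noteq> [] \<longrightarrow> butlast u \<in> t) \<and>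
     (\<forall>u\<in>t. \<exists>k. \<forall>i\<ge>1. u @ [i] \<in> t \<longleftrightarrow> i \<le> k)"

definition plane_trees :: "nat \<Rightarrow> nat list set set" where
  "plane_trees n = {t. plane_tree t \<and> finite t \<and> card t = n}"

text \<open>
  The space taken by a car arriving at \<open>u\<close> when the spaces in \<open>occ\<close> are occupied;
  the value \<^const>\<open>None\<close> means that the car leaves the tree through the root. The tree itself
  is not an argument, since a tree contains all ancestors of each of its vertices.
\<close>

function park_spot :: "nat list set \<Rightarrow> nat list \<Rightarrow> nat list option" where
  "park_spot occ u =
     (if u \<notin> occ then Some u
      else if u = [] then None
      else park_spot occ (butlast u))"
  by pat_completeness auto
termination
  by (relation "Wellfounded.measure (\<lambda>(occ, u). length u)") auto

declare park_spot.simps [simp del]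

text \<open>
  Cars arrive in the order of the list, the spaces in \<open>occ\<close> being occupied beforehand.
\<close>

fun all_park_from :: "nat list set \<Rightarrow> nat list list \<Rightarrow> bool" where
  "all_park_from occ [] \<longleftrightarrow> True"
| "all_park_from occ (v # vs) \<longleftrightarrow>
     (case park_spot occ v of
        None \<Rightarrow> False
      | Some w \<Rightarrow> all_park_from (insert w occ) vs)"

definition all_cars_park :: "nat list list \<Rightarrow> bool" where
  "all_cars_park cars \<longleftrightarrow> all_park_from {} cars"

definition parking_pmf :: "nat \<Rightarrow> nat \<Rightarrow> (nat list set \<times> nat list list) pmf" where
  "parking_pmf n m =
     bind_pmf (pmf_of_set (plane_trees n)) (\<lambda>t.
       map_pmf (\<lambda>cars. (t, cars)) (replicate_pmf m (pmf_of_set t)))"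

text \<open>
  The function \<^const>\<open>pmf_of_set\<close> is meaningful only for finite non-empty sets; the following
  facts show that this holds for the sets used above whenever \<open>n \<ge> 1\<close>.
\<close>

lemma plane_trees_finite_nonempty:
  assumes "t \<in> plane_trees n"
  shows "finite t" "t \<noteq> {}"
  using assms by (auto simp: plane_trees_def plane_tree_def)

lemma plane_tree_take:
  assumes "plane_tree t" "u \<in> t"
  shows "take j u \<in> t"
  using assms(2)
proof (induction u rule: rev_induct)
  case Nil
  then show ?case by simp
next
  case (snoc x xs)
  have "butlast (xs @ [x]) \<in> t"
    using assms(1) snoc.prems unfolding plane_tree_def by blast
  then have "xs \<in> t" by simp
  then show ?case using snoc by (cases "j \<le> length xs") auto
qed

lemma plane_tree_word_bounds:
  assumes "plane_tree t" "finite t" "card t = n" "u \<in> t"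
  shows "set u \<subseteq> {..n} \<and> length u \<le> n"
proof
  show "set u \<subseteq> {..n}"
  proof
    fix x assume "x \<in> set u"
    then obtain j where j: "j < length u" "u ! j = x" by (auto simp: in_set_conv_nth)
    have mem: "take j u @ [x] \<in> t"
      using plane_tree_take[OF assms(1,4), of "Suc j"] j by (simp add: take_Suc_conv_app_nth)
    have "take j u \<in> t" using plane_tree_take[OF assms(1,4)] .
    then obtain k where k: "\<And>i. i \<ge> 1 \<Longrightarrow> take j u @ [i] \<in> t \<longleftrightarrow> i \<le> k"
      using assms(1) unfolding plane_tree_def by meson
    have "x \<ge> 1" using mem assms(1) unfolding plane_tree_def by auto
    then have "x \<le> k" using k mem by blast
    then have "(\<lambda>i. take j u @ [i]) ` {1..x} \<subseteq> t" using k by auto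
    then have "card ((\<lambda>i. take j u @ [i]) ` {1..x}) \<le> n"
      using card_mono assms(2,3) by blast
    then show "x \<in> {..n}" by (subst (asm) card_image) (auto simp: inj_on_def)
  qed
  have "inj_on (\<lambda>j. take j u) {1..length u}"
    by (rule inj_on_inverseI[where g = length]) auto
  moreover have "card ((\<lambda>j. take j u) ` {1..length u}) \<le> n"
    using card_mono[OF assms(2)] plane_tree_take[OF assms(1,4)] assms(3)
    by (metis (no_types, lifting) image_subsetI)
  ultimately show "length u \<le> n" by (simp add: card_image)
qed

lemma finite_plane_trees: "finite (plane_trees n)"
proof (rule finite_subset)
  show "plane_trees n \<subseteq> Pow {u. set u \<subseteq> {..n} \<and> length u \<le> n}"
    using plane_tree_word_bounds by (auto simp: plane_trees_def)
  show "finite (Pow {u::nat list. set u \<subseteq> {..n} \<and> length u \<le> n})"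
    using finite_lists_length_le[of "{..n}" n] by simp
qed

lemma plane_trees_nonempty:
  assumes "n \<ge> 1"
  shows "plane_trees n \<noteq> {}"
proof -
  define t :: "nat list set" where "t = (\<lambda>j. replicate j 1) ` {..<n}"
  have "inj_on (\<lambda>j. replicate j (1::nat)) {..<n}"
    by (rule inj_on_inverseI[where g = length]) auto
  then have card: "card t = n" by (simp add: t_def card_image)
  have child: "replicate j 1 @ [i] \<in> t \<longleftrightarrow> i = 1 \<and> Suc j < n" for i j
  proof
    assume "replicate j 1 @ [i] \<in> t"
    then obtain l where l: "l < n" "replicate j 1 @ [i] = replicate l 1"
      by (auto simp: t_def)
    then have "length (replicate j 1 @ [i]) = l" by (metis length_replicate)
    moreover have "i \<in> set (replicate l 1)" using l(2) by (metis in_set_conv_decomp)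
    ultimately show "i = 1 \<and> Suc j < n" using l by auto
  next
    assume "i = 1 \<and> Suc j < n"
    then show "replicate j 1 @ [i] \<in> t"
      unfolding t_def by (intro image_eqI[of _ _ "Suc j"]) (auto simp: replicate_append_same)
  qed
  have "plane_tree t"
    unfolding plane_tree_def
  proof (intro conjI ballI impI)
    show "t \<subseteq> lists {1..}" by (auto simp: t_def)
    show "[] \<in> t" using assms by (auto simp: t_def image_iff intro!: bexI[of _ 0])
    show "butlast u \<in> t" if "u \<in> t" "u \<noteq> []" for u
    proof -
      from that obtain j where j: "j < n" "u = replicate j 1" by (auto simp: t_def)
      have "butlast u = replicate (j - 1) 1" using j by (simp add: butlast_conv_take)
      then show ?thesis using j by (auto simp: t_def)
    qed
    show "\<exists>k. \<forall>i\<ge>1. u @ [i] \<in> t \<longleftrightarrow> i \<le> k" if "u \<in> t" for u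
    proof -
      from that obtain j where "u = replicate j 1" by (auto simp: t_def)
      then show ?thesis
        using child[of j] by (intro exI[of _ "if Suc j < n then 1 else 0"]) auto
    qed
  qed
  then show ?thesis using card by (auto simp: plane_trees_def t_def)
qed

end

theory Submission
  imports Defs "HOL-Combinatorics.Multiset_Permutations" "HOL-Complex_Analysis.Complex_Analysis"
    "HOL-Real_Asymp.Real_Asymp"
begin

text \<open>
  All cars can park iff at most one car visits the root. Weighting a tree with \<open>n\<close> vertices,
  on which \<open>c\<^sub>v\<close> cars arrive at \<open>v\<close>, by the product of the \<open>1 / c\<^sub>v!\<close>, and marking with \<open>x\<close>,
  \<open>y\<close>, \<open>s\<close> the vertices, the cars and the visits to the root, one obtains a quadratic equation
  with catalytic variable \<open>s\<close>. Its discriminant has a double root \<open>S\<close>, which gives the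
  parametrization \<open>x = S e\<^sup>-\<^sup>y\<^sup>S / Q\<^sup>2\<close> with \<open>Q = 1 + S + y S - y S\<^sup>2\<close> of the generating
  function \<open>1 - e\<^sup>-\<^sup>y\<^sup>S / (Q (1 - y S))\<close> of the configurations in which all cars park. Since
  \<open>Q = (1 + u) + S (1 - u)\<close> for \<open>u = y S\<close>, Lagrange inversion expresses their number through a
  single coefficient of \<open>e\<^sup>N\<^sup>u (1 - 2 u - u\<^sup>2) (1 + u)\<^sup>b (1 - u)\<^sup>c\<close>, up to a bounded factor.
  With \<open>\<alpha> n\<close> cars the saddle point lies at \<open>u = \<alpha>\<close>, where the second derivative of the phase
  is also a multiple of \<open>1 - 2 \<alpha> - \<alpha>\<^sup>2\<close>; this leaves the square root in the limit. For
  \<open>\<alpha> \<ge> \<surd>2 - 1\<close> monotonicity in the number of cars suffices, because the subcritical limit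
  tends to 0.
\<close>

section \<open>Trees with cars as binary forests\<close>

text \<open>The factor \<open>(1 - u) ^ c\<close> is the obstacle in the saddle point estimate: on
  the circle of radius \<alpha> its modulus is smallest at the saddle, so it works against decay.
  Every factor is therefore treated as a characteristic function of Bernoulli or Poisson type, with
  a negative success probability for \<open>1 - u\<close>. All bounds are exponentials of multiples
  of \<open>1 - cos \<theta>\<close>, hence they add up, and the total per vertex is positive for 0
  < \<alpha> < \<open>sqrt 2 - 1\<close>. The kernel method needs values, not formal series: its
  zero comes from the intermediate value theorem for fixed small real weights. Only the resulting
  identity, valid on an interval, is transferred to formal power series, where Lagrange inversion
  applies. Stirling's formula never occurs. The factorial and both binomial coefficients are
  estimated by the same integral lemma as the main coefficient, so that all exponential growth and
  all powers of \<open>sqrt n\<close> cancel in a quotient of four sequences.\<close>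

text \<open>
  The first-child next-sibling encoding: \<open>Tr a c r\<close> starts with a tree at whose root \<open>a\<close> cars arrive,
  \<open>c\<close> being the forest of its subtrees, and continues with \<open>r\<close>. A tree is a pair of the number of
  cars arriving at its root and the forest below.
\<close>

datatype forest = Emp | Tr nat forest forest

primrec forest_size :: "forest \<Rightarrow> nat" where
  "forest_size Emp = 0"
| "forest_size (Tr a c r) = Suc (forest_size c + forest_size r)"

primrec forest_cars :: "forest \<Rightarrow> nat" where
  "forest_cars Emp = 0"
| "forest_cars (Tr a c r) = a + forest_cars c + forest_cars r"

primrec forest_flux :: "forest \<Rightarrow> nat" where
  "forest_flux Emp = 0"
| "forest_flux (Tr a c r) = (a + forest_flux c - 1) + forest_flux r"

primrec forest_weight :: "forest \<Rightarrow> real" where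
  "forest_weight Emp = 1"
| "forest_weight (Tr a c r) = forest_weight c * forest_weight r / fact a"

definition parked_forests :: "nat \<Rightarrow> nat \<Rightarrow> (nat \<times> forest) set" where
  "parked_forests n m = {(a, f). Suc (forest_size f) = n \<and> a + forest_cars f = m \<and>
     a + forest_flux f \<le> 1}"

definition parked_weight :: "nat \<Rightarrow> nat \<Rightarrow> real" where
  "parked_weight n m = (\<Sum>(a, f)\<in>parked_forests n m. forest_weight f / fact a)"

section \<open>The parking process at the root and in the subtrees\<close>

text \<open>A lost car only raises the counter, so the process continues after a failure, unlike
  \<open>all_park_from\<close>. The number of lost cars, rather than their mere existence, is what
  obeys a recursion over the subtrees.\<close>

definition park_step :: "nat list set \<times> nat \<Rightarrow> nat list \<Rightarrow> nat list set \<times> nat" where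
  "park_step st v = (case park_spot (fst st) v of
      None \<Rightarrow> (fst st, Suc (snd st))
    | Some w \<Rightarrow> (insert w (fst st), snd st))"

definition park_state :: "nat list list \<Rightarrow> nat list set \<times> nat" where
  "park_state cars = foldl park_step ({}, 0) cars"

abbreviation occupied :: "nat list list \<Rightarrow> nat list set" where
  "occupied cars \<equiv> fst (park_state cars)"

abbreviation lost :: "nat list list \<Rightarrow> nat" where
  "lost cars \<equiv> snd (park_state cars)"

definition below :: "nat \<Rightarrow> nat list list \<Rightarrow> nat list list" where
  "below i cars = map tl (filter (\<lambda>u. u \<noteq> [] \<and> hd u = i) cars)"

definition visits :: "nat set \<Rightarrow> nat list list \<Rightarrow> nat" where
  "visits I cars = count_list cars [] + (\<Sum>i\<in>I. lost (below i cars))"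

lemma park_state_Nil [simp]: "park_state [] = ({}, 0)"
  by (simp add: park_state_def)

lemma park_state_snoc: "park_state (cars @ [v]) = park_step (park_state cars) v"
  by (simp add: park_state_def)

lemma foldl_park_step_mono: "snd st \<le> snd (foldl park_step st cars)"
proof (induction cars arbitrary: st)
  case (Cons v cars)
  have "snd st \<le> snd (park_step st v)"
    by (auto simp: park_step_def split: option.split)
  also have "\<dots> \<le> snd (foldl park_step (park_step st v) cars)" by (rule Cons.IH)
  finally show ?case by simp
qed simp

lemma all_park_from_iff: "all_park_from occ cars \<longleftrightarrow> snd (foldl park_step (occ, 0) cars) = 0"
proof (induction cars arbitrary: occ)
  case (Cons v cars)
  show ?case
  proof (cases "park_spot occ v")
    case None
    then have "park_step (occ, 0) v = (occ, Suc 0)" by (simp add: park_step_def)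
    then show ?thesis using None foldl_park_step_mono[of "(occ, Suc 0)" cars] by simp
  next
    case (Some w)
    then show ?thesis using Cons.IH by (simp add: park_step_def)
  qed
qed simp

lemma all_cars_park_iff: "all_cars_park cars \<longleftrightarrow> lost cars = 0"
  by (simp add: all_cars_park_def all_park_from_iff park_state_def)

text \<open>Inside the subtree of child \<open>i\<close> the search runs as if that subtree were the
  whole tree; a car lost there arrives at the root.\<close>

lemma park_spot_Cons:
  "park_spot occ (i # u) = (case park_spot {u. i # u \<in> occ} u of
      Some w \<Rightarrow> Some (i # w) | None \<Rightarrow> park_spot occ [])"
proof (induction u rule: rev_induct)
  case Nil
  show ?case
    by (subst (1 2) park_spot.simps) simp
next
  case (snoc j u)
  show ?case
    using snoc by (subst (1 2) park_spot.simps) (auto simp: butlast_append)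
qed

lemma below_snoc_Nil [simp]: "below i (cars @ [[]]) = below i cars"
  by (simp add: below_def)

lemma below_snoc_Cons:
  "below i (cars @ [j # u]) = (if i = j then below i cars @ [u] else below i cars)"
  by (simp add: below_def)

text \<open>The root keeps its first visitor and loses all later ones, whence the truncated
  \<open>visits I cars - 1\<close>. The claims need a joint induction over the arrivals, because the
  fate of a car is decided by the occupied places in its subtree and then by the root.\<close>

lemma park_state_root:
  assumes "finite I" "\<And>u. u \<in> set cars \<Longrightarrow> u \<noteq> [] \<Longrightarrow> hd u \<in> I"
  shows "{u. i # u \<in> occupied cars} = occupied (below i cars)"
    and "[] \<in> occupied cars \<longleftrightarrow> visits I cars > 0"
    and "lost cars = visits I cars - 1"
proof -
  have "(\<forall>i. {u. i # u \<in> occupied cars} = occupied (below i cars)) \<and>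
    ([] \<in> occupied cars \<longleftrightarrow> visits I cars > 0) \<and> lost cars = visits I cars - 1"
    using assms(2)
  proof (induction cars rule: rev_induct)
    case Nil
    then show ?case by (simp add: visits_def below_def)
  next
    case (snoc v cars)
    then have IH: "\<And>i. {u. i # u \<in> occupied cars} = occupied (below i cars)"
      "[] \<in> occupied cars \<longleftrightarrow> visits I cars > 0" "lost cars = visits I cars - 1"
      by auto
    have root: "park_spot occ [] = (if [] \<in> occ then None else Some [])" for occ
      by (subst park_spot.simps) simp
    show ?case
    proof (cases v)
      case Nil
      have "visits I (cars @ [v]) = Suc (visits I cars)"
        using Nil by (simp add: visits_def)
      then show ?thesis using IH Nil
        by (auto simp: park_state_snoc park_step_def root)
    next
      case (Cons j u)
      then have j: "j \<in> I" using snoc.prems by force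
      have sub: "{u. j # u \<in> occupied cars} = occupied (below j cars)" by (rule IH)
      show ?thesis
      proof (cases "park_spot (occupied (below j cars)) u")
        case (Some w)
        have st: "park_state (below j cars @ [u]) =
            (insert w (occupied (below j cars)), lost (below j cars))"
          using Some by (simp add: park_state_snoc park_step_def)
        have "visits I (cars @ [v]) = visits I cars"
          using Cons st unfolding visits_def by (auto simp: below_snoc_Cons intro!: sum.cong)
        moreover have "park_state (cars @ [v]) = (insert (j # w) (occupied cars), lost cars)"
          using Some Cons by (simp add: park_state_snoc park_step_def park_spot_Cons sub)
        ultimately show ?thesis using IH st Cons
          by (auto simp: below_snoc_Cons)
      next
        case None
        have st: "park_state (below j cars @ [u]) =
            (occupied (below j cars), Suc (lost (below j cars)))"
          using None by (simp add: park_state_snoc park_step_def)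
        have "(\<Sum>i\<in>I. lost (below i (cars @ [v]))) = 
              (\<Sum>i\<in>I. lost (below i cars) + (if i = j then 1 else 0))"
          using Cons st by (intro sum.cong) (auto simp: below_snoc_Cons)
        then have "visits I (cars @ [v]) = Suc (visits I cars)"
          using j assms(1) Cons unfolding visits_def by (simp add: sum.distrib)
        moreover have "park_state (cars @ [v]) = (if [] \<in> occupied cars
            then (occupied cars, Suc (lost cars)) else (insert [] (occupied cars), lost cars))"
          using None Cons by (simp add: park_state_snoc park_step_def park_spot_Cons sub root)
        ultimately show ?thesis using IH st Cons
          by (auto simp: below_snoc_Cons)
      qed
    qed
  qed
  then show "{u. i # u \<in> occupied cars} = occupied (below i cars)"
    and "[] \<in> occupied cars \<longleftrightarrow> visits I cars > 0"
    and "lost cars = visits I cars - 1" by auto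
qed

section \<open>Forests as sets of words with multisets of arrivals\<close>

text \<open>The index is the label of the first root. Its right siblings receive the following
  labels, and every subforest restarts at 1.\<close>

primrec forest_verts :: "nat \<Rightarrow> forest \<Rightarrow> nat list set" where
  "forest_verts i Emp = {}"
| "forest_verts i (Tr a c r) =
     insert [i] ((#) i ` forest_verts 1 c) \<union> forest_verts (Suc i) r"


primrec forest_mset :: "nat \<Rightarrow> forest \<Rightarrow> nat list multiset" where
  "forest_mset i Emp = {#}"
| "forest_mset i (Tr a c r) =
     replicate_mset a [i] + image_mset ((#) i) (forest_mset 1 c) + forest_mset (Suc i) r"

lemma forest_verts_hd: "u \<in> forest_verts i f \<Longrightarrow> u \<noteq> [] \<and> i \<le> hd u"
  by (induction f arbitrary: i u) force+

lemma finite_forest_verts [simp]: "finite (forest_verts i f)"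
  by (induction f arbitrary: i) auto

lemma set_forest_mset: "set_mset (forest_mset i f) \<subseteq> forest_verts i f"
proof (induction f arbitrary: i)
  case (Tr a c r)
  from Tr(1)[of 1] Tr(2)[of "Suc i"] show ?case by (auto split: if_splits)
qed simp

lemma forest_mset_hd: "u \<in># forest_mset i f \<Longrightarrow> u \<noteq> [] \<and> i \<le> hd u"
  using set_forest_mset forest_verts_hd by blast

lemma Cons_notin_later [simp]:
  "i # u \<notin> forest_verts (Suc i) r" "i # u \<notin># forest_mset (Suc i) r"
  using forest_verts_hd[of "i # u"] forest_mset_hd[of "i # u"] by force+

lemma below_eq_Nil: "j \<notin> hd ` set cars \<Longrightarrow> below j cars = []"
  by (auto simp: below_def filter_empty_conv)

text \<open>Undoes \<open>Tr\<close> on a list of arrivals: the first letter \<open>i\<close> marks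
  the first tree, since all later trees carry larger labels.\<close>

lemma forest_mset_below:
  assumes "mset cars = forest_mset i (Tr a c r)"
  shows "mset (below i cars) = replicate_mset a [] + forest_mset 1 c"
    and "mset (filter (\<lambda>u. hd u \<noteq> i) cars) = forest_mset (Suc i) r"
proof -
  have r: "hd u \<noteq> i" "u \<noteq> []" if "u \<in># forest_mset (Suc i) r" for u
    using forest_mset_hd[OF that] by auto
  have r1: "filter_mset (\<lambda>u. u \<noteq> [] \<and> hd u = i) (forest_mset (Suc i) r) = {#}"
    using r by (auto simp: filter_mset_eq_conv)
  have r2: "filter_mset (\<lambda>u. hd u \<noteq> i) (forest_mset (Suc i) r) = forest_mset (Suc i) r"
    using r by (auto simp: filter_mset_eq_conv)
  have c1: "filter_mset (\<lambda>u. u \<noteq> [] \<and> hd u = i) (image_mset ((#) i) A) = image_mset ((#) i) A"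
    and c2: "filter_mset (\<lambda>u. hd u \<noteq> i) (image_mset ((#) i) A) = {#}"
    and c3: "image_mset tl (image_mset ((#) i) A) = A"
    and c4: "filter_mset (\<lambda>u. u \<noteq> [] \<and> hd u = i) (replicate_mset a [i]) = replicate_mset a [i]" for A :: "nat list multiset"
    by (auto simp: filter_mset_eq_conv image_mset.compositionality o_def)
  show "mset (below i cars) = replicate_mset a [] + forest_mset 1 c"
    using assms by (simp add: below_def mset_filter r1 c1 c3 c4 del: image_mset.compositionality)
  show "mset (filter (\<lambda>u. hd u \<noteq> i) cars) = forest_mset (Suc i) r"
    using assms by (simp add: mset_filter r2 c2)
qed

text \<open>Identifies \<open>forest_flux\<close> with the number of cars leaving the forest,
  whatever their order. The index set may be any finite superset of the labels in use, because the
  recursion for \<open>r\<close> sums over \<open>I - {i}\<close>, which need not consist of labels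
  occurring in \<open>r\<close>.\<close>

lemma sum_lost_below:
  assumes "mset cars = forest_mset i f" "finite I" "hd ` set cars \<subseteq> I"
  shows "(\<Sum>j\<in>I. lost (below j cars)) = forest_flux f"
  using assms
proof (induction f arbitrary: i cars I)
  case Emp
  then show ?case by (simp add: below_def)
next
  case (Tr a c r)
  define sub where "sub = below i cars"
  \<comment> \<open>Arrivals at the root of the first tree do not affect the subtrees below it;
    without them the list has the form that the induction hypothesis for \<open>c\<close>
    requires.\<close>
  define sub' where "sub' = filter (\<lambda>u. u \<noteq> []) sub"
  define rest where "rest = filter (\<lambda>u. hd u \<noteq> i) cars"
  have sub: "mset sub = replicate_mset a [] + forest_mset 1 c"
    and rest: "mset rest = forest_mset (Suc i) r"
    using forest_mset_below[OF Tr.prems(1)] by (simp_all add: sub_def rest_def)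
  have "filter_mset (\<lambda>u. u \<noteq> []) (forest_mset 1 c) = forest_mset 1 c"
    using forest_mset_hd by (auto simp: filter_mset_eq_conv)
  then have sub': "mset sub' = forest_mset 1 c"
    by (simp add: sub'_def mset_filter sub)
  have "count (forest_mset 1 c) [] = 0"
    using forest_mset_hd by (auto simp: count_eq_zero_iff)
  then have cnt: "count_list sub [] = a"
    using sub by (simp add: count_mset[symmetric])
  have bs: "below j sub = below j sub'" for j
    by (simp add: below_def sub'_def conj_commute)
  have "visits (hd ` set sub') sub = a + forest_flux c"
    using Tr.IH(1)[OF sub' finite_imageI[OF finite_set] subset_refl]
    by (simp add: visits_def cnt bs)
  moreover have "lost sub = visits (hd ` set sub') sub - 1"
    by (rule park_state_root) (auto simp: sub'_def)
  ultimately have i: "lost (below i cars) = a + forest_flux c - 1"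
    by (simp add: sub_def)
  have "(\<Sum>j\<in>I - {i}. lost (below j cars)) = (\<Sum>j\<in>I - {i}. lost (below j rest))"
  proof (rule sum.cong)
    fix j assume "j \<in> I - {i}"
    then have "below j rest = below j cars"
      unfolding below_def rest_def by (auto intro!: arg_cong[where f = "map tl"] filter_cong)
    then show "lost (below j cars) = lost (below j rest)" by simp
  qed simp
  also have "\<dots> = forest_flux r"
    using Tr.prems by (intro Tr.IH(2)[OF rest]) (auto simp: rest_def)
  finally have r: "(\<Sum>j\<in>I - {i}. lost (below j cars)) = forest_flux r" .
  have "(\<Sum>j\<in>I. lost (below j cars)) = lost (below i cars) + (\<Sum>j\<in>I - {i}. lost (below j cars))"
  proof (cases "i \<in> I")
    case True
    then show ?thesis using Tr.prems by (simp add: sum.remove)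
  next
    case False
    then have "below i cars = []" using Tr.prems by (intro below_eq_Nil) auto
    then show ?thesis using False by simp
  qed
  then show ?case using i r by simp
qed

text \<open>The number of lost cars is the truncated predecessor of the number of visits to the
  root. Only the multiset of arrivals enters, so the order of arrival is irrelevant.\<close>

lemma all_cars_park_forest:
  assumes "mset cars = replicate_mset a [] + forest_mset 1 f"
  shows "all_cars_park cars \<longleftrightarrow> a + forest_flux f \<le> 1"
proof -
  define cars' where "cars' = filter (\<lambda>u. u \<noteq> []) cars"
  have "filter_mset (\<lambda>u. u \<noteq> []) (forest_mset 1 f) = forest_mset 1 f"
    using forest_mset_hd by (auto simp: filter_mset_eq_conv)
  then have cars': "mset cars' = forest_mset 1 f"
    by (simp add: cars'_def mset_filter assms)
  have "count (forest_mset 1 f) [] = 0"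
    using forest_mset_hd by (auto simp: count_eq_zero_iff)
  then have cnt: "count_list cars [] = a"
    using assms by (simp add: count_mset[symmetric])
  have bs: "below j cars = below j cars'" for j
    by (simp add: below_def cars'_def conj_commute)
  have "visits (hd ` set cars') cars = a + forest_flux f"
    using sum_lost_below[OF cars' finite_imageI[OF finite_set] subset_refl]
    by (simp add: visits_def cnt bs)
  moreover have "lost cars = visits (hd ` set cars') cars - 1"
    by (rule park_state_root) (auto simp: cars'_def)
  ultimately show ?thesis by (auto simp: all_cars_park_iff)
qed

section \<open>Orderings of a multiset of arrivals\<close>

text \<open>The denominator of the multinomial coefficient that counts the orderings of
  \<open>A\<close>.\<close>

definition multinomial_weight :: "'a multiset \<Rightarrow> real" where
  "multinomial_weight A = (\<Prod>x\<in>set_mset A. fact (count A x))"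

lemma multinomial_weight_union:
  assumes "set_mset A \<inter> set_mset B = {}"
  shows "multinomial_weight (A + B) = multinomial_weight A * multinomial_weight B"
proof -
  have "multinomial_weight (A + B) =
      (\<Prod>x\<in>set_mset A. fact (count (A + B) x)) * (\<Prod>x\<in>set_mset B. fact (count (A + B) x))"
    using assms unfolding multinomial_weight_def by (simp add: prod.union_disjoint)
  also have "\<dots> = multinomial_weight A * multinomial_weight B"
  proof -
    have "count B x = 0" if "x \<in># A" for x
      using assms that by (auto simp: count_eq_zero_iff)
    moreover have "count A x = 0" if "x \<in># B" for x
      using assms that by (auto simp: count_eq_zero_iff)
    ultimately show ?thesis unfolding multinomial_weight_def by simp
  qed
  finally show ?thesis .
qed

lemma multinomial_weight_image:
  assumes "inj g"
  shows "multinomial_weight (image_mset g A) = multinomial_weight A"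
proof -
  have "count (image_mset g A) (g x) = count A x" if "x \<in># A" for x
  proof -
    have "g -` {g x} \<inter> set_mset A = {x}" using assms that by (auto simp: inj_eq)
    then show ?thesis by (simp add: count_image_mset)
  qed
  then show ?thesis
    unfolding multinomial_weight_def
    by (simp add: prod.reindex[OF inj_on_subset[OF assms subset_UNIV]])
qed

lemma multinomial_weight_replicate:
  "multinomial_weight (replicate_mset a x) = fact a"
  by (simp add: multinomial_weight_def)

text \<open>Different vertices are different words, so the factorials of the arrival counts multiply
  along the forest. This is the reason for the division by \<open>fact a\<close> in
  \<open>forest_weight\<close>.\<close>

lemma multinomial_weight_forest:
  "multinomial_weight (forest_mset i f) = inverse (forest_weight f)"
proof (induction f arbitrary: i)
  case Emp
  then show ?case by (simp add: multinomial_weight_def)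
next
  case (Tr a c r)
  have 1: "set_mset (replicate_mset a [i]) \<inter> set_mset (image_mset ((#) i) (forest_mset 1 c)) = {}"
    using forest_mset_hd[of _ 1 c] by (auto simp: in_replicate_mset)
  have 2: "set_mset (replicate_mset a [i] + image_mset ((#) i) (forest_mset 1 c)) \<inter>
      set_mset (forest_mset (Suc i) r) = {}"
    by (auto simp: disjoint_iff split: if_splits)
  show ?case
    unfolding forest_mset.simps multinomial_weight_union[OF 2] multinomial_weight_union[OF 1]
    by (simp add: Tr.IH multinomial_weight_replicate multinomial_weight_image divide_simps)
qed

lemma forest_size_eq: "card (forest_verts i f) = forest_size f"
proof (induction f arbitrary: i)
  case (Tr a c r)
  have "insert [i] ((#) i ` forest_verts 1 c) \<inter> forest_verts (Suc i) r = {}"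
    using forest_verts_hd[of _ "Suc i" r] by fastforce
  moreover have "[i] \<notin> (#) i ` forest_verts 1 c" using forest_verts_hd[of _ 1 c] by auto
  ultimately show ?case using Tr
    by (simp add: card_Un_disjoint card_image del: insert_disjoint Un_insert_left)
qed simp

lemma forest_cars_eq: "size (forest_mset i f) = forest_cars f"
  by (induction f arbitrary: i) auto

text \<open>The vertices determine the shape and the multiset determines the counts. The components
  of \<open>Tr\<close> are recovered by sorting words according to their first letter.\<close>

lemma forest_inj:
  assumes "forest_verts i f = forest_verts i g" "forest_mset i f = forest_mset i g"
  shows "f = g"
  using assms
proof (induction f arbitrary: i g)
  case Emp
  then show ?case by (cases g) auto
next
  case (Tr a c r)
  then obtain a' c' r' where g: "g = Tr a' c' r'" by (cases g) auto
  have sub: "forest_verts 1 c = {u. u \<noteq> [] \<and> i # u \<in> forest_verts i (Tr a c r)}" for a c r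
    using forest_verts_hd[of _ "Suc i" r] forest_verts_hd[of _ 1 c] by auto
  have rest: "forest_verts (Suc i) r = {u. hd u \<noteq> i \<and> u \<in> forest_verts i (Tr a c r)}" for a c r
  proof -
    have "hd u \<noteq> i" if "u \<in> forest_verts (Suc i) r" for u
      using forest_verts_hd[OF that] by auto
    then show ?thesis by auto
  qed
  \<comment> \<open>\<open>forest_mset_below\<close> speaks of lists, so some ordering of the
    arrivals is chosen.\<close>
  obtain cars where cars: "mset cars = forest_mset i (Tr a c r)" using ex_mset by blast
  then have cars': "mset cars = forest_mset i (Tr a' c' r')" using Tr.prems g by simp
  have m: "replicate_mset a [] + forest_mset 1 c = replicate_mset a' [] + forest_mset 1 c'"
    "forest_mset (Suc i) r = forest_mset (Suc i) r'"
    using forest_mset_below[OF cars] forest_mset_below[OF cars'] by metis+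
  have z: "count (forest_mset 1 c) [] = 0" for c
    using forest_mset_hd by (auto simp: count_eq_zero_iff)
  from m(1) have "count (replicate_mset a [] + forest_mset 1 c) [] =
      count (replicate_mset a' [] + forest_mset 1 c') []" by simp
  then have a: "a = a'" using z[of c] z[of c'] by simp
  then have "forest_mset 1 c = forest_mset 1 c'" using m(1) by simp
  moreover have "forest_verts 1 c = forest_verts 1 c'"
    by (subst sub[of c a r], subst sub[of c' a' r'], simp only: Tr.prems(1) g)
  moreover have "forest_verts (Suc i) r = forest_verts (Suc i) r'"
    by (subst rest[of r a c], subst rest[of r' a' c'], simp only: Tr.prems(1) g)
  ultimately show ?case using Tr.IH m(2) a g by blast
qed

section \<open>Every plane tree with cars comes from a forest\<close>

text \<open>The intrinsic counterpart of \<open>forest_verts i\<close>: closure under parents and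
  left siblings. Children start at label 1 but roots at \<open>i\<close>, which is the form that
  survives the removal of the first tree.\<close>

definition forest_set :: "nat \<Rightarrow> nat list set \<Rightarrow> bool" where
  "forest_set i T \<longleftrightarrow> finite T \<and>
     (\<forall>u\<in>T. u \<noteq> [] \<and> i \<le> hd u \<and> set (tl u) \<subseteq> {1..}) \<and>
     (\<forall>u j. u \<noteq> [] \<longrightarrow> u @ [j] \<in> T \<longrightarrow> u \<in> T) \<and>
     (\<forall>u j. u @ [Suc j] \<in> T \<longrightarrow> (if u = [] then i else 1) \<le> j \<longrightarrow> u @ [j] \<in> T)"

lemma forest_setD:
  assumes "forest_set i T"
  shows "finite T" "u \<in> T \<Longrightarrow> u \<noteq> []" "u \<in> T \<Longrightarrow> i \<le> hd u" "u \<in> T \<Longrightarrow> set (tl u) \<subseteq> {1..}"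
    "u @ [j] \<in> T \<Longrightarrow> u \<noteq> [] \<Longrightarrow> u \<in> T"
    "u @ [Suc j] \<in> T \<Longrightarrow> u \<noteq> [] \<Longrightarrow> 1 \<le> j \<Longrightarrow> u @ [j] \<in> T"
    "[Suc j] \<in> T \<Longrightarrow> i \<le> j \<Longrightarrow> [j] \<in> T"
proof -
  show "[j] \<in> T" if "[Suc j] \<in> T" "i \<le> j"
    using assms that unfolding forest_set_def by (metis append_Nil)
qed (use assms in \<open>auto simp: forest_set_def\<close>)

lemma forest_set_verts: "i \<ge> 1 \<Longrightarrow> forest_set i (forest_verts i f)"
proof (induction f arbitrary: i)
  case Emp
  then show ?case by (simp add: forest_set_def)
next
  case (Tr a c r)
  have c: "forest_set 1 (forest_verts 1 c)" using Tr by simp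
  have r: "forest_set (Suc i) (forest_verts (Suc i) r)" using Tr by simp
  have mem: "h # u \<in> forest_verts i (Tr a c r) \<longleftrightarrow>
      (if h = i then u = [] \<or> u \<in> forest_verts 1 c else h # u \<in> forest_verts (Suc i) r)" for h u
    by auto
  have Nil: "[] \<notin> forest_verts j f" for j f using forest_verts_hd by blast
  show ?case
    unfolding forest_set_def
  proof (intro conjI ballI allI impI)
    fix u assume u: "u \<in> forest_verts i (Tr a c r)"
    show "u \<noteq> []" using forest_verts_hd u by blast
    show "i \<le> hd u" using forest_verts_hd u by blast
    obtain h v where hv: "u = h # v" using \<open>u \<noteq> []\<close> by (cases u) auto
    have "set v \<subseteq> {1..}" if "v \<in> forest_verts 1 c"
      using forest_setD(2-4)[OF c that] by (cases v) auto
    then show "set (tl u) \<subseteq> {1..}"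
      using forest_setD(4)[OF r, of u] u hv mem[of h v] by (auto split: if_splits)
  next
    fix u j assume u: "u \<noteq> []" "u @ [j] \<in> forest_verts i (Tr a c r)"
    then obtain h v where hv: "u = h # v" by (cases u) auto
    have "h # (v @ [j]) \<in> forest_verts i (Tr a c r)" using u hv by simp
    then show "u \<in> forest_verts i (Tr a c r)"
      unfolding hv mem using forest_setD(5)[OF c, of v j] forest_setD(5)[OF r, of "h # v" j]
      by (auto split: if_splits)
  next
    fix u j assume u: "u @ [Suc j] \<in> forest_verts i (Tr a c r)" "(if u = [] then i else 1) \<le> j"
    show "u @ [j] \<in> forest_verts i (Tr a c r)"
    proof (cases u)
      case Nil
      then have "[Suc j] \<in> forest_verts i (Tr a c r)" "i \<le> j" using u by auto
      then show ?thesis unfolding Nil append_Nil mem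
        using forest_setD(7)[OF r, of j] by auto
    next
      case (Cons h v)
      have "h # (v @ [Suc j]) \<in> forest_verts i (Tr a c r)" "1 \<le> j" using u Cons by auto
      then show ?thesis
        unfolding Cons append_Cons mem
        using forest_setD(6)[OF c, of v j] forest_setD(7)[OF c, of j] forest_setD(6)[OF r, of "h # v" j]
        by (cases "v = []") (auto split: if_splits)
    qed
  qed simp
qed

text \<open>Removing the first root leaves two smaller forests, \<open>C\<close> below it and
  \<open>R\<close> to its right, so induction on the number of vertices applies.\<close>

lemma forest_surj:
  assumes "forest_set i T" "set_mset M \<subseteq> T"
  shows "\<exists>f. forest_verts i f = T \<and> forest_mset i f = M"
  using assms
proof (induction "card T" arbitrary: i T M rule: less_induct)
  case less
  note T = forest_setD[OF less.prems(1)]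
  show ?case
  proof (cases "T = {}")
    case True
    then show ?thesis using less.prems by (intro exI[of _ Emp]) auto
  next
    case False
    \<comment> \<open>Every first letter is itself a root, and left siblings lead down to
      \<open>[i]\<close>. Thus a non-empty forest contains its first possible root.\<close>
    have hd: "[hd u] \<in> T" if "u \<in> T" for u
      using that
    proof (induction u rule: rev_induct)
      case (snoc j u)
      then show ?case using T(5)[of u j] by (cases "u = []") auto
    qed (use T(2) in auto)
    have down: "[j] \<in> T \<Longrightarrow> i \<le> j \<Longrightarrow> [i] \<in> T" for j
    proof (induction j)
      case (Suc j)
      then show ?case using T(7)[of j] by (cases "i = Suc j") auto
    qed simp
    obtain u where "u \<in> T" using False by blast
    then have i: "[i] \<in> T" using hd down T(3) by blast
    define C where "C = {u. u \<noteq> [] \<and> i # u \<in> T}"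
    define R where "R = {u \<in> T. hd u \<noteq> i}"
    define MC where "MC = image_mset tl (filter_mset (\<lambda>u. hd u = i \<and> u \<noteq> [i]) M)"
    define MR where "MR = filter_mset (\<lambda>u. hd u \<noteq> i) M"
    have sub: "(#) i ` C \<subseteq> T - {[i]}" by (auto simp: C_def)
    have finC: "finite C"
      using finite_subset[OF sub] T(1) by (auto dest: finite_imageD)
    have "card C = card ((#) i ` C)" by (simp add: card_image)
    also have "\<dots> \<le> card (T - {[i]})" using sub T(1) by (intro card_mono) auto
    also have "\<dots> < card T" using i T(1) by (intro card_Diff1_less)
    finally have cC: "card C < card T" .
    have "R \<subset> T" using i unfolding R_def by force
    then have cR: "card R < card T" using T(1) by (rule psubset_card_mono[rotated])
    have "forest_set 1 C"
      unfolding forest_set_def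
    proof (intro conjI ballI allI impI finC)
      fix u assume u: "u \<in> C"
      show "u \<noteq> []" using u by (simp add: C_def)
      then show "1 \<le> hd u" "set (tl u) \<subseteq> {1..}"
        using T(4)[of "i # u"] u by (auto simp: C_def neq_Nil_conv)
    next
      fix u j assume "u \<noteq> []" "u @ [j] \<in> C"
      then show "u \<in> C" using T(5)[of "i # u" j] by (simp add: C_def)
    next
      fix u j assume "u @ [Suc j] \<in> C" "(if u = [] then 1 else 1) \<le> j"
      then show "u @ [j] \<in> C" using T(6)[of "i # u" j] by (simp add: C_def)
    qed
    moreover have "set_mset MC \<subseteq> C"
    proof
      fix v assume "v \<in># MC"
      then obtain u where u: "u \<in># M" "hd u = i" "u \<noteq> [i]" "v = tl u" by (auto simp: MC_def)
      have "u \<in> T" using u less.prems by auto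
      then show "v \<in> C" using u T(2)[of u] by (cases u) (auto simp: C_def)
    qed
    ultimately obtain c where c: "forest_verts 1 c = C" "forest_mset 1 c = MC"
      using less.hyps[OF cC] by blast
    have "forest_set (Suc i) R"
      unfolding forest_set_def
    proof (intro conjI ballI allI impI)
      show "finite R" using T(1) by (simp add: R_def)
      fix u assume u: "u \<in> R"
      show "u \<noteq> []" "set (tl u) \<subseteq> {1..}" using u T(2,4)[of u] by (auto simp: R_def)
      show "Suc i \<le> hd u" using u T(3)[of u] by (auto simp: R_def)
    next
      fix u j assume "u \<noteq> []" "u @ [j] \<in> R"
      then show "u \<in> R" using T(5)[of u j] by (simp add: R_def)
    next
      fix u j assume "u @ [Suc j] \<in> R" "(if u = [] then Suc i else 1) \<le> j"
      then show "u @ [j] \<in> R"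
        using T(6)[of u j] T(7)[of j] by (cases "u = []") (auto simp: R_def)
    qed
    moreover have "set_mset MR \<subseteq> R" using less.prems by (auto simp: MR_def R_def)
    ultimately obtain r where r: "forest_verts (Suc i) r = R" "forest_mset (Suc i) r = MR"
      using less.hyps[OF cR] by blast
    have "forest_verts i (Tr (count M [i]) c r) = T"
    proof (rule set_eqI)
      fix u
      show "u \<in> forest_verts i (Tr (count M [i]) c r) \<longleftrightarrow> u \<in> T"
      proof (cases u)
        case Nil
        have "[] \<notin> T" "[] \<notin> R" using T(2) by (auto simp: R_def)
        then show ?thesis using Nil r by auto
      next
        case (Cons h v)
        then show ?thesis using i by (auto simp: r c[unfolded One_nat_def] C_def R_def)
      qed
    qed
    moreover have "forest_mset i (Tr (count M [i]) c r) = M"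
    proof -
      have "image_mset ((#) i) MC = image_mset id (filter_mset (\<lambda>u. hd u = i \<and> u \<noteq> [i]) M)"
        unfolding MC_def image_mset.compositionality
      proof (rule image_mset_cong)
        fix u assume "u \<in># filter_mset (\<lambda>u. hd u = i \<and> u \<noteq> [i]) M"
        then have "u \<in> T" "hd u = i" using less.prems by auto
        then show "((#) i \<circ> tl) u = id u" using T(2)[of u] by (cases u) auto
      qed
      then show ?thesis
        by (simp add: r c[unfolded One_nat_def] MR_def flip: filter_eq_replicate_mset)
           (auto simp: multiset_eq_iff)
    qed
    ultimately show ?thesis by blast
  qed
qed

text \<open>For a finite set, the existence of the child numbers \<open>k\<close> amounts to closure
  under left siblings: \<open>k\<close> is the largest child label.\<close>

lemma plane_tree_iff_forest_set:
  "plane_tree t \<and> finite t \<longleftrightarrow> [] \<in> t \<and> forest_set 1 (t - {[]})"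
proof
  assume t: "plane_tree t \<and> finite t"
  then have lists: "t \<subseteq> lists {1..}" and root: "[] \<in> t"
    and par: "\<And>u j. u @ [j] \<in> t \<Longrightarrow> u \<in> t"
    and ch: "\<And>u. u \<in> t \<Longrightarrow> \<exists>k. \<forall>i\<ge>1. u @ [i] \<in> t \<longleftrightarrow> i \<le> k"
    unfolding plane_tree_def by force+
  have "u @ [j] \<in> t" if "u @ [Suc j] \<in> t" "1 \<le> j" for u j
    using ch[OF par[OF that(1)]] that by (metis Suc_leD le_SucI)
  moreover have "1 \<le> hd u" "set (tl u) \<subseteq> {1..}" if "u \<in> t" "u \<noteq> []" for u
    using subsetD[OF lists that(1)] that(2) by (cases u; auto)+
  ultimately show "[] \<in> t \<and> forest_set 1 (t - {[]})"
    using t root par unfolding forest_set_def by auto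
next
  assume t: "[] \<in> t \<and> forest_set 1 (t - {[]})"
  note T = forest_setD[OF conjunct2[OF t]]
  have fin: "finite t" using T(1) by simp
  have "u \<in> lists {1..}" if "u \<in> t" for u
    using T(2-4)[of u] that by (cases u) auto
  moreover have "butlast u \<in> t" if "u \<in> t" "u \<noteq> []" for u
    using T(5)[of "butlast u" "last u"] t that by (cases "butlast u = []") auto
  moreover have "\<exists>k. \<forall>i\<ge>1. u @ [i] \<in> t \<longleftrightarrow> i \<le> k" for u
  proof -
    \<comment> \<open>Inserting 0 gives \<open>Max\<close> the right value at a leaf, where
      \<open>k = 0\<close>.\<close>
    define J where "J = insert 0 {j. u @ [j] \<in> t}"
    have "(\<lambda>j. u @ [j]) ` {j. u @ [j] \<in> t} \<subseteq> t" by auto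
    then have "finite {j. u @ [j] \<in> t}"
      by (rule finite_imageD[OF finite_subset[OF _ fin]]) (simp add: inj_on_def)
    then have J: "finite J" by (simp add: J_def)
    have down: "u @ [k] \<in> t \<Longrightarrow> 1 \<le> i \<Longrightarrow> i \<le> k \<Longrightarrow> u @ [i] \<in> t" for i k
    proof (induction k)
      case (Suc k)
      show ?case
      proof (cases "i = Suc k")
        case False
        then have k: "1 \<le> k" "i \<le> k" using Suc.prems by simp_all
        have "u @ [Suc k] \<in> t - {[]}" using Suc.prems by simp
        then have "u @ [k] \<in> t"
          using T(6)[of u k, OF _ _ k(1)] T(7)[of k, OF _ k(1)] by (cases "u = []") simp_all
        then show ?thesis using k Suc.IH Suc.prems(2) by blast
      qed (use Suc.prems in simp)
    qed simp
    have "Max J \<in> J" using J by (intro Max_in) (auto simp: J_def)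
    then have "u @ [i] \<in> t" if "1 \<le> i" "i \<le> Max J" for i
      using that down[of "Max J" i] by (auto simp: J_def)
    moreover have "i \<le> Max J" if "u @ [i] \<in> t" for i
      using J that by (intro Max_ge) (auto simp: J_def)
    ultimately show ?thesis by blast
  qed
  ultimately show "plane_tree t \<and> finite t"
    using t fin unfolding plane_tree_def by blast
qed

definition tree_verts :: "nat \<times> forest \<Rightarrow> nat list set" where
  "tree_verts = (\<lambda>(a, f). insert [] (forest_verts 1 f))"

definition tree_mset :: "nat \<times> forest \<Rightarrow> nat list multiset" where
  "tree_mset = (\<lambda>(a, f). replicate_mset a [] + forest_mset 1 f)"

lemma tree_inj:
  assumes "tree_verts p = tree_verts q" "tree_mset p = tree_mset q"
  shows "p = q"
proof -
  obtain a f b g where pq: "p = (a, f)" "q = (b, g)" by fastforce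
  have z: "count (forest_mset 1 c) [] = 0" "[] \<notin> forest_verts 1 c" for c
    using forest_mset_hd[of "[]" 1 c] forest_verts_hd[of "[]" 1 c] by (auto simp: count_eq_zero_iff)
  from assms(2) have "count (tree_mset p) [] = count (tree_mset q) []" by simp
  then have a: "a = b" using z[of f] z[of g] by (simp add: tree_mset_def pq)
  moreover have "forest_mset 1 f = forest_mset 1 g"
    using assms(2) a by (simp add: tree_mset_def pq)
  moreover have "forest_verts 1 f = forest_verts 1 g"
    using assms(1) z[of f] z[of g] unfolding tree_verts_def pq prod.case by (metis insert_ident)
  ultimately show ?thesis using forest_inj pq by blast
qed

text \<open>Together with \<open>tree_inj\<close>, this identifies pairs of a finite plane tree and
  a multiset of its vertices with elements of \<open>nat \<times> forest\<close>.\<close>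

lemma tree_surj:
  assumes "plane_tree t" "finite t" "set_mset M \<subseteq> t"
  shows "\<exists>p. tree_verts p = t \<and> tree_mset p = M"
proof -
  have t: "[] \<in> t" "forest_set 1 (t - {[]})" using assms plane_tree_iff_forest_set by auto
  have "set_mset (filter_mset (\<lambda>u. u \<noteq> []) M) \<subseteq> t - {[]}" using assms by auto
  from forest_surj[OF t(2) this] obtain f where
    f: "forest_verts 1 f = t - {[]}" "forest_mset 1 f = filter_mset (\<lambda>u. u \<noteq> []) M" by blast
  have "tree_mset (count M [], f) = M"
    by (auto simp: tree_mset_def f[unfolded One_nat_def] multiset_eq_iff)
  moreover have "tree_verts (count M [], f) = t"
    using t f by (auto simp: tree_verts_def)
  ultimately show ?thesis by blast
qed

lemma tree_props:
  assumes p: "p = (a, f)"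
  shows "tree_verts p \<in> plane_trees (Suc (forest_size f))"
    "set_mset (tree_mset p) \<subseteq> tree_verts p" "size (tree_mset p) = a + forest_cars f"
    "multinomial_weight (tree_mset p) = fact a / forest_weight f"
    "mset cars = tree_mset p \<Longrightarrow> all_cars_park cars \<longleftrightarrow> a + forest_flux f \<le> 1"
proof -
  have z: "[] \<notin> forest_verts 1 f" "[] \<notin># forest_mset 1 f"
    using forest_mset_hd[of "[]" 1 f] forest_verts_hd[of "[]" 1 f] by auto
  have "tree_verts p - {[]} = forest_verts 1 f" using z by (auto simp: tree_verts_def p)
  then have "plane_tree (tree_verts p) \<and> finite (tree_verts p)"
    unfolding plane_tree_iff_forest_set using forest_set_verts[of 1 f]
    by (simp add: tree_verts_def p)
  moreover have "card (tree_verts p) = Suc (forest_size f)"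
    using z by (simp add: tree_verts_def p forest_size_eq)
  ultimately show "tree_verts p \<in> plane_trees (Suc (forest_size f))"
    by (simp add: plane_trees_def)
  show "set_mset (tree_mset p) \<subseteq> tree_verts p"
    using set_forest_mset[of 1 f] by (auto simp: tree_verts_def tree_mset_def p split: if_splits)
  show "size (tree_mset p) = a + forest_cars f"
    by (simp add: tree_mset_def p forest_cars_eq)
  have "set_mset (replicate_mset a []) \<inter> set_mset (forest_mset 1 f) = {}" using z by auto
  then show "multinomial_weight (tree_mset p) = fact a / forest_weight f"
    unfolding tree_mset_def p prod.case
    by (subst multinomial_weight_union)
       (simp_all add: multinomial_weight_replicate multinomial_weight_forest divide_inverse)
  show "all_cars_park cars \<longleftrightarrow> a + forest_flux f \<le> 1" if "mset cars = tree_mset p"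
    using all_cars_park_forest that by (simp add: tree_mset_def p)
qed

section \<open>Counting the successful arrival lists\<close>

lemma card_mset_eq: "real (card {cars. mset cars = M}) = fact (size M) / multinomial_weight M"
proof -
  have "{cars. mset cars = M} = permutations_of_multiset M" by (auto simp: permutations_of_multiset_def)
  moreover have "real (card (permutations_of_multiset M)) * multinomial_weight M = fact (size M)"
    using arg_cong[OF card_permutations_of_multiset_aux[of M], of real]
    by (simp add: multinomial_weight_def)
  moreover have "multinomial_weight M \<noteq> 0" by (simp add: multinomial_weight_def)
  ultimately show ?thesis by (simp add: field_simps)
qed

definition parked_lists :: "nat list set \<Rightarrow> nat \<Rightarrow> nat list list set" where
  "parked_lists t m = {cars. set cars \<subseteq> t \<and> length cars = m \<and> all_cars_park cars}"

text \<open>Finiteness is inherited, through the injection into vertex sets and arrival multisets,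
  from the plane trees with \<open>n\<close> vertices and the lists of length \<open>m\<close> over
  their vertices.\<close>

lemma finite_parked_forests: "finite (parked_forests n m)"
proof -
  let ?V = "\<Union> (plane_trees n)"
  have V: "finite ?V" using finite_plane_trees plane_trees_finite_nonempty by blast
  have "(\<lambda>p. (tree_verts p, tree_mset p)) ` parked_forests n m \<subseteq>
      plane_trees n \<times> mset ` {cars. set cars \<subseteq> ?V \<and> length cars = m}"
  proof
    fix x assume "x \<in> (\<lambda>p. (tree_verts p, tree_mset p)) ` parked_forests n m"
    then obtain a f where x: "x = (tree_verts (a, f), tree_mset (a, f))" "(a, f) \<in> parked_forests n m"
      by auto
    then have v: "tree_verts (a, f) \<in> plane_trees n" using tree_props(1)[of _ a f] by (auto simp: parked_forests_def)
    obtain cars where "mset cars = tree_mset (a, f)" using ex_mset by blast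
    moreover from this have "set cars \<subseteq> ?V" "length cars = m"
      using tree_props(2,3)[of _ a f] x v by (auto simp: parked_forests_def simp flip: set_mset_mset size_mset)
    ultimately show "x \<in> plane_trees n \<times> mset ` {cars. set cars \<subseteq> ?V \<and> length cars = m}"
      using x v by (metis (mono_tags, lifting) SigmaI imageI mem_Collect_eq)
  qed
  moreover have "inj_on (\<lambda>p. (tree_verts p, tree_mset p)) (parked_forests n m)"
    by (auto intro!: inj_onI dest: tree_inj)
  moreover have "finite (plane_trees n \<times> mset ` {cars. set cars \<subseteq> ?V \<and> length cars = m})"
    using V by (intro finite_cartesian_product finite_imageI finite_plane_trees finite_lists_length_eq)
  ultimately show ?thesis by (metis (no_types, lifting) finite_imageD finite_subset)
qed

text \<open>Double counting. A tree with cars stands for all orderings of its arrivals, which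
  succeed or fail together, and their number is \<open>fact m\<close> times the weight of the
  tree.\<close>

lemma sum_card_parked_lists:
  "(\<Sum>t\<in>plane_trees n. real (card (parked_lists t m))) = fact m * parked_weight n m"
proof -
  define L where "L = (\<lambda>p. {tree_verts p} \<times> {cars. mset cars = tree_mset p})"
  have finL: "finite (L p)" for p
  proof -
    have "{cars. mset cars = tree_mset p} = permutations_of_multiset (tree_mset p)"
      by (auto simp: permutations_of_multiset_def)
    then show ?thesis by (simp add: L_def)
  qed
  have "(\<Sum>t\<in>plane_trees n. real (card (parked_lists t m))) = real (card (Sigma (plane_trees n) (\<lambda>t. parked_lists t m)))"
  proof -
    have "finite (parked_lists t m)" if "t \<in> plane_trees n" for t
      using finite_lists_length_eq[OF plane_trees_finite_nonempty(1)[OF that], of m]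
      by (rule finite_subset[rotated]) (auto simp: parked_lists_def)
    then show ?thesis using finite_plane_trees by (simp add: card_SigmaI)
  qed
  also have "Sigma (plane_trees n) (\<lambda>t. parked_lists t m) = (\<Union>p\<in>parked_forests n m. L p)"
  proof (intro equalityI subsetI)
    fix x assume "x \<in> Sigma (plane_trees n) (\<lambda>t. parked_lists t m)"
    then obtain t cars where x: "x = (t, cars)" "t \<in> plane_trees n" "set cars \<subseteq> t"
      "length cars = m" "all_cars_park cars" by (auto simp: parked_lists_def)
    then obtain a f where p: "tree_verts (a, f) = t" "tree_mset (a, f) = mset cars"
      using tree_surj[of t "mset cars"] by (auto simp: plane_trees_def)
    have "Suc (forest_size f) = n"
      using tree_props(1)[of _ a f] p x by (auto simp: plane_trees_def)
    moreover have "a + forest_cars f = m" using tree_props(3)[of _ a f] p x by simp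
    moreover have "a + forest_flux f \<le> 1" using tree_props(5)[of _ a f cars] p x by simp
    ultimately have "(a, f) \<in> parked_forests n m" by (simp add: parked_forests_def)
    then show "x \<in> (\<Union>p\<in>parked_forests n m. L p)"
      using x p by (intro UN_I) (auto simp: L_def)
  next
    fix x assume "x \<in> (\<Union>p\<in>parked_forests n m. L p)"
    then obtain a f cars where p: "(a, f) \<in> parked_forests n m" "x = (tree_verts (a, f), cars)"
      "mset cars = tree_mset (a, f)" by (auto simp: L_def)
    have "set cars \<subseteq> tree_verts (a, f)"
      using tree_props(2)[of _ a f] p(3) by (metis set_mset_mset)
    moreover have "length cars = m"
      using tree_props(3)[of "(a, f)" a f] p(1) arg_cong[OF p(3), of size] by (simp add: parked_forests_def)
    moreover have "all_cars_park cars" "tree_verts (a, f) \<in> plane_trees n"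
      using tree_props(1,5)[of _ a f] p by (auto simp: parked_forests_def)
    ultimately show "x \<in> Sigma (plane_trees n) (\<lambda>t. parked_lists t m)"
      using p by (auto simp: parked_lists_def)
  qed
  also have "real (card \<dots>) = (\<Sum>p\<in>parked_forests n m. real (card (L p)))"
  proof -
    have "\<forall>p\<in>parked_forests n m. \<forall>q\<in>parked_forests n m. p \<noteq> q \<longrightarrow> L p \<inter> L q = {}"
      by (auto simp: L_def dest: tree_inj)
    then show ?thesis using finL by (simp add: card_UN_disjoint finite_parked_forests)
  qed
  also have "\<dots> = (\<Sum>(a, f)\<in>parked_forests n m. fact m * (forest_weight f / fact a))"
  proof (intro sum.cong refl, clarify)
    fix a f assume "(a, f) \<in> parked_forests n m"
    then have "a + forest_cars f = m" by (simp add: parked_forests_def)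
    then show "real (card (L (a, f))) = fact m * (forest_weight f / fact a)"
      using tree_props(3,4)[of _ a f] by (simp add: L_def card_cartesian_product card_mset_eq)
  qed
  also have "\<dots> = fact m * parked_weight n m"
    by (simp add: parked_weight_def sum_distrib_left case_prod_beta)
  finally show ?thesis .
qed

section \<open>The parking probability as a ratio of weights\<close>

lemma replicate_pmf_of_set:
  fixes t :: "'a set"
  assumes "finite t" "t \<noteq> {}"
  shows "replicate_pmf m (pmf_of_set t) = pmf_of_set {xs. set xs \<subseteq> t \<and> length xs = m}"
proof (induction m)
  case 0
  have "{xs. set xs \<subseteq> t \<and> length xs = 0} = {[]}" by auto
  then show ?case by (simp add: pmf_of_set_singleton)
next
  case (Suc m)
  let ?L = "\<lambda>m. {xs. set xs \<subseteq> t \<and> length xs = m}"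
  have L: "finite (?L m)" "?L m \<noteq> {}"
    using assms finite_lists_length_eq[of t m]
    by (auto intro!: exI[of _ "replicate m (SOME x. x \<in> t)"] simp: some_in_eq)
  have "replicate_pmf (Suc m) (pmf_of_set t) =
      map_pmf (\<lambda>(x, xs). x # xs) (pair_pmf (pmf_of_set t) (pmf_of_set (?L m)))"
    by (simp add: Suc pair_pmf_def map_bind_pmf)
  also have "pair_pmf (pmf_of_set t) (pmf_of_set (?L m)) = pmf_of_set (t \<times> ?L m)"
  proof (rule pmf_eqI)
    fix x :: "'a \<times> 'a list"
    obtain a b where x: "x = (a, b)" by (cases x)
    have prod: "finite (t \<times> ?L m)" "t \<times> ?L m \<noteq> {}" using assms L by auto
    show "pmf (pair_pmf (pmf_of_set t) (pmf_of_set (?L m))) x = pmf (pmf_of_set (t \<times> ?L m)) x"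
      unfolding x pmf_pair pmf_of_set[OF assms(2,1)] pmf_of_set[OF L(2,1)] pmf_of_set[OF prod(2,1)]
      by (simp add: indicator_def card_cartesian_product)
  qed
  also have "map_pmf (\<lambda>(x, xs). x # xs) \<dots> = pmf_of_set ((\<lambda>(x, xs). x # xs) ` (t \<times> ?L m))"
    using assms L by (intro map_pmf_of_set_inj) (auto simp: inj_on_def)
  also have "(\<lambda>(x, xs). x # xs) ` (t \<times> ?L m) = ?L (Suc m)"
    by (auto simp: length_Suc_conv image_iff)
  finally show ?case .
qed

lemma measure_bind_pmf:
  "measure_pmf.prob (bind_pmf M N) X = measure_pmf.expectation M (\<lambda>x. measure_pmf.prob (N x) X)"
proof -
  have "ennreal (measure_pmf.prob (bind_pmf M N) X) =
      (\<integral>\<^sup>+x. ennreal (measure_pmf.prob (N x) X) \<partial>measure_pmf M)"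
    using emeasure_bind_pmf[of M N X] by (simp add: measure_pmf.emeasure_eq_measure)
  also have "\<dots> = ennreal (measure_pmf.expectation M (\<lambda>x. measure_pmf.prob (N x) X))"
    by (intro nn_integral_eq_integral measure_pmf.integrable_const_bound[where B = 1]) auto
  finally show ?thesis by (simp add: integral_nonneg_AE)
qed

lemma prob_all_park_tree:
  assumes "finite t" "t \<noteq> {}"
  shows "measure_pmf.prob (replicate_pmf m (pmf_of_set t)) {cars. all_cars_park cars} =
    real (card (parked_lists t m)) / real (card t) ^ m"
proof -
  let ?L = "{xs. set xs \<subseteq> t \<and> length xs = m}"
  have L: "finite ?L" "?L \<noteq> {}"
    using assms finite_lists_length_eq[of t m]
    by (auto intro!: exI[of _ "replicate m (SOME x. x \<in> t)"] simp: some_in_eq)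
  have "?L \<inter> {cars. all_cars_park cars} = parked_lists t m"
    by (auto simp: parked_lists_def)
  then show ?thesis
    using assms L by (simp add: replicate_pmf_of_set measure_pmf_of_set card_lists_length_eq)
qed

definition park_prob :: "nat \<Rightarrow> nat \<Rightarrow> real" where
  "park_prob n m = measure_pmf.prob (parking_pmf n m) {(t, cars). all_cars_park cars}"

lemma park_prob_eq_sum:
  assumes "n \<ge> 1"
  shows "park_prob n m =
    (\<Sum>t\<in>plane_trees n. real (card (parked_lists t m))) / (real (card (plane_trees n)) * real n ^ m)"
proof -
  have "park_prob n m = measure_pmf.expectation (pmf_of_set (plane_trees n))
      (\<lambda>t. measure_pmf.prob (map_pmf (\<lambda>cars. (t, cars)) (replicate_pmf m (pmf_of_set t)))
        {(t, cars). all_cars_park cars})"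
    unfolding park_prob_def parking_pmf_def
    by (rule measure_bind_pmf)
  also have "\<dots> = measure_pmf.expectation (pmf_of_set (plane_trees n))
      (\<lambda>t. measure_pmf.prob (replicate_pmf m (pmf_of_set t)) {cars. all_cars_park cars})"
    by (simp add: measure_map_pmf vimage_def)
  also have "\<dots> = (\<Sum>t\<in>plane_trees n. measure_pmf.prob (replicate_pmf m (pmf_of_set t))
      {cars. all_cars_park cars}) / real (card (plane_trees n))"
    using finite_plane_trees plane_trees_nonempty[OF assms] by (intro integral_pmf_of_set) auto
  also have "(\<Sum>t\<in>plane_trees n. measure_pmf.prob (replicate_pmf m (pmf_of_set t))
      {cars. all_cars_park cars}) = (\<Sum>t\<in>plane_trees n. real (card (parked_lists t m)) / real n ^ m)"
    by (intro sum.cong refl) (simp add: prob_all_park_tree plane_trees_finite_nonempty,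
        simp add: plane_trees_def)
  finally show ?thesis by (simp add: sum_divide_distrib[symmetric] mult.commute)
qed

text \<open>The number of plane trees is itself a weight: without cars the empty list is the only
  one, and it parks on every tree.\<close>

lemma park_prob_eq:
  assumes "n \<ge> 1"
  shows "park_prob n m = fact m * parked_weight n m / (parked_weight n 0 * real n ^ m)"
proof -
  have "parked_lists t 0 = {[]}" for t
    by (auto simp: parked_lists_def all_cars_park_def)
  then have "parked_weight n 0 = real (card (plane_trees n))"
    using sum_card_parked_lists[of 0 n] by simp
  then show ?thesis using park_prob_eq_sum[OF assms] sum_card_parked_lists[of m n] by simp
qed

section \<open>Monotonicity in the number of cars\<close>

lemma all_cars_park_butlast:
  assumes "all_cars_park (cars @ [v])"
  shows "all_cars_park cars"
proof -
  have "lost cars \<le> lost (cars @ [v])"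
    by (auto simp: park_state_snoc park_step_def split: option.split)
  then show ?thesis using assms by (simp add: all_cars_park_iff)
qed

text \<open>A successful list stays successful without its last car, and that car had at most
  \<open>card t\<close> arrival places.\<close>

lemma card_parked_lists_Suc:
  assumes "finite t"
  shows "card (parked_lists t (Suc m)) \<le> card t * card (parked_lists t m)"
proof -
  have fin: "finite (parked_lists t m)"
    by (rule finite_subset[OF _ finite_lists_length_eq[OF assms, of m]]) (auto simp: parked_lists_def)
  have "parked_lists t (Suc m) \<subseteq> (\<lambda>(v, cars). cars @ [v]) ` (t \<times> parked_lists t m)"
  proof
    fix cars assume cars: "cars \<in> parked_lists t (Suc m)"
    then have "cars \<noteq> []" by (auto simp: parked_lists_def)
    then obtain cs v where "cars = cs @ [v]" by (metis append_butlast_last_id)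
    then show "cars \<in> (\<lambda>(v, cars). cars @ [v]) ` (t \<times> parked_lists t m)"
      using cars all_cars_park_butlast by (auto simp: parked_lists_def image_iff)
  qed
  then have "card (parked_lists t (Suc m)) \<le> card (t \<times> parked_lists t m)"
    using assms fin by (intro surj_card_le) auto
  then show ?thesis by (simp add: card_cartesian_product)
qed

lemma park_prob_antimono:
  assumes "n \<ge> 1" "k \<le> m"
  shows "park_prob n m \<le> park_prob n k"
  using assms(2)
proof (induction m rule: dec_induct)
  case (step m)
  have "real (card (parked_lists t (Suc m))) \<le> real n * real (card (parked_lists t m))"
    if "t \<in> plane_trees n" for t
  proof -
    have "finite t" "card t = n" using that by (auto simp: plane_trees_def)
    then show ?thesis using card_parked_lists_Suc[of t m] by (metis of_nat_le_iff of_nat_mult)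
  qed
  then have "(\<Sum>t\<in>plane_trees n. real (card (parked_lists t (Suc m)))) \<le>
      real n * (\<Sum>t\<in>plane_trees n. real (card (parked_lists t m)))"
    unfolding sum_distrib_left by (rule sum_mono)
  then have "park_prob n (Suc m) \<le> real n * (\<Sum>t\<in>plane_trees n. real (card (parked_lists t m))) /
      (real (card (plane_trees n)) * real n ^ Suc m)"
    unfolding park_prob_eq_sum[OF assms(1)] by (intro divide_right_mono) auto
  also have "\<dots> = park_prob n m"
    using assms(1) by (simp add: park_prob_eq_sum)
  finally show ?case using step.IH by simp
qed simp

section \<open>The kernel method\<close>

primrec forest_term :: "real \<Rightarrow> real \<Rightarrow> forest \<Rightarrow> real" where
  "forest_term x y Emp = 1"
| "forest_term x y (Tr a c r) = x * y ^ a / fact a * forest_term x y c * forest_term x y r"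

lemma forest_term_eq:
  "forest_term x y f = forest_weight f * x ^ forest_size f * y ^ forest_cars f"
  by (induction f) (auto simp: power_add algebra_simps divide_inverse)

lemma forest_weight_pos: "forest_weight f > 0"
  by (induction f) auto

lemma forest_term_nonneg: "x \<ge> 0 \<Longrightarrow> y \<ge> 0 \<Longrightarrow> forest_term x y f \<ge> 0"
  by (induction f) auto

lemma has_sum_product_nonneg:
  fixes f :: "'a \<Rightarrow> real" and g :: "'b \<Rightarrow> real"
  assumes "(f has_sum F) A" "(g has_sum G) B" "\<And>x. x \<in> A \<Longrightarrow> f x \<ge> 0" "\<And>x. x \<in> B \<Longrightarrow> g x \<ge> 0"
  shows "((\<lambda>(a, b). f a * g b) has_sum (F * G)) (A \<times> B)"
proof (rule has_sum_SigmaI)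
  show inner: "((\<lambda>b. case (a, b) of (a, b) \<Rightarrow> f a * g b) has_sum (f a * G)) B" for a
    using has_sum_cmult_right[OF assms(2), of "f a"] by simp
  show outer: "((\<lambda>a. f a * G) has_sum (F * G)) A"
    using has_sum_cmult_left[OF assms(1), of G] by simp
  show "(\<lambda>(a, b). f a * g b) summable_on A \<times> B"
    by (rule summable_on_SigmaI[OF inner has_sum_imp_summable[OF outer]]) (use assms in auto)
qed

lemma has_sum_exp:
  fixes y :: real
  assumes "y \<ge> 0"
  shows "((\<lambda>a. y ^ a / fact a) has_sum exp y) UNIV"
proof (rule sums_nonneg_imp_has_sum)
  show "(\<lambda>a. y ^ a / fact a) sums exp y"
    using exp_converges[of y] by (simp add: field_simps)
qed (use assms in simp)

primrec forest_depth :: "forest \<Rightarrow> nat" where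
  "forest_depth Emp = 0"
| "forest_depth (Tr a c r) = Suc (max (forest_depth c) (forest_depth r))"

text \<open>Applied to the forests of bounded depth as \<open>B\<close> and \<open>C\<close>, and
  again to all forests.\<close>

lemma has_sum_forest:
  fixes g :: "forest \<Rightarrow> real"
  assumes "((\<lambda>((a, c), r). g (Tr a c r)) has_sum S) ((A \<times> B) \<times> C)"
  shows "(g has_sum (g Emp + S)) (insert Emp ((\<lambda>((a, c), r). Tr a c r) ` ((A \<times> B) \<times> C)))"
proof (rule has_sum_insert)
  have "inj_on (\<lambda>((a, c), r). Tr a c r) ((A \<times> B) \<times> C)" by (auto simp: inj_on_def)
  then show "(g has_sum S) ((\<lambda>((a, c), r). Tr a c r) ` ((A \<times> B) \<times> C))"
    using assms by (subst has_sum_reindex) (simp_all add: o_def case_prod_unfold)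
qed auto

text \<open>Raising the depth by one turns the sum \<open>S\<close> into
  \<open>1 + x * exp y * S\<^sup>2\<close>. Since 2 is the fixed point of
  \<open>1 + z\<^sup>2 / 4\<close>, the bound 2 is preserved.\<close>

lemma forest_term_sum_depth:
  assumes "x \<ge> 0" "y \<ge> 0" "x * exp y \<le> 1 / 4"
  shows "\<exists>S. 0 \<le> S \<and> S \<le> 2 \<and> (forest_term x y has_sum S) {f. forest_depth f \<le> h}"
proof (induction h)
  case 0
  have "f = Emp" if "forest_depth f = 0" for f using that by (cases f) auto
  then have "{f. forest_depth f \<le> 0} = {Emp}" by auto
  moreover have "(forest_term x y has_sum 1) {Emp}" by (rule has_sum_finiteI) auto
  ultimately show ?case by (intro exI[of _ 1]) simp
next
  case (Suc h)
  let ?D = "{f. forest_depth f \<le> h}"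
  obtain S where S: "0 \<le> S" "S \<le> 2" "(forest_term x y has_sum S) ?D" using Suc by blast
  have D: "{f. forest_depth f \<le> Suc h} = insert Emp ((\<lambda>((a, c), r). Tr a c r) ` ((UNIV \<times> ?D) \<times> ?D))"
  proof (rule set_eqI)
    fix f show "f \<in> {f. forest_depth f \<le> Suc h} \<longleftrightarrow>
        f \<in> insert Emp ((\<lambda>((a, c), r). Tr a c r) ` ((UNIV \<times> ?D) \<times> ?D))"
      by (cases f) (auto simp: image_iff)
  qed
  have "((\<lambda>a. x * (y ^ a / fact a)) has_sum (x * exp y)) UNIV"
    by (rule has_sum_cmult_right[OF has_sum_exp[OF assms(2)]])
  then have "((\<lambda>(a, c). x * (y ^ a / fact a) * forest_term x y c) has_sum (x * exp y * S)) (UNIV \<times> ?D)"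
    by (rule has_sum_product_nonneg[OF _ S(3)]) (use assms in \<open>auto simp: forest_term_nonneg\<close>)
  then have "((\<lambda>(p, r). (case p of (a, c) \<Rightarrow> x * (y ^ a / fact a) * forest_term x y c) * forest_term x y r)
      has_sum (x * exp y * S * S)) ((UNIV \<times> ?D) \<times> ?D)"
    by (rule has_sum_product_nonneg[OF _ S(3)]) (use assms in \<open>auto simp: forest_term_nonneg\<close>)
  then have "((\<lambda>((a, c), r). forest_term x y (Tr a c r)) has_sum (x * exp y * S * S)) ((UNIV \<times> ?D) \<times> ?D)"
    by (simp add: case_prod_unfold mult.assoc)
  from has_sum_forest[OF this]
  have "(forest_term x y has_sum (1 + x * exp y * S * S)) {f. forest_depth f \<le> Suc h}"
    unfolding D by simp
  moreover have "S * S \<le> 2 * 2" using S by (intro mult_mono) auto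
  then have "x * exp y * (S * S) \<le> 1 / 4 * 4" using S assms by (intro mult_mono) auto
  moreover have "0 \<le> x * exp y * (S * S)" using S assms by auto
  ultimately show ?case by (intro exI[of _ "1 + x * exp y * S * S"]) (auto simp: mult.assoc)
qed

lemma
  assumes "x \<ge> 0" "y \<ge> 0" "x * exp y \<le> 1 / 4"
  shows forest_term_summable: "forest_term x y summable_on UNIV"
    and forest_term_infsum_le: "infsum (forest_term x y) UNIV \<le> 2"
proof -
  have bound: "sum (forest_term x y) F \<le> 2" if F: "finite F" for F
  proof -
    \<comment> \<open>A finite set of forests has bounded depth, so the bound for each depth
      controls every finite partial sum.\<close>
    define h where "h = Max (forest_depth ` F)"
    have sub: "F \<subseteq> {f. forest_depth f \<le> h}" using F by (auto simp: h_def)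
    obtain S where S: "S \<le> 2" "(forest_term x y has_sum S) {f. forest_depth f \<le> h}"
      using forest_term_sum_depth[OF assms] by blast
    have "sum (forest_term x y) F \<le> S"
      by (rule has_sum_mono_neutral[OF has_sum_finite[OF F] S(2)])
         (use sub assms in \<open>auto simp: forest_term_nonneg\<close>)
    then show ?thesis using S by simp
  qed
  show *: "forest_term x y summable_on UNIV"
    using bound assms by (intro nonneg_bdd_above_summable_on bdd_aboveI[of _ 2]) (auto simp: forest_term_nonneg)
  show "infsum (forest_term x y) UNIV \<le> 2"
    using bound by (intro infsum_le_finite_sums *) auto
qed

section \<open>The catalytic equation and its kernel\<close>

definition forest_gf :: "real \<Rightarrow> real \<Rightarrow> real \<Rightarrow> real" where
  "forest_gf x y s = (\<Sum>\<^sub>\<infinity>f. forest_term x y f * s ^ forest_flux f)"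

text \<open>The exponent counts the cars that leave the tree: truncated subtraction covers an unvisited root.\<close>

definition tree_gf :: "real \<Rightarrow> real \<Rightarrow> real \<Rightarrow> real" where
  "tree_gf x y s = (\<Sum>\<^sub>\<infinity>(a, f). x * (y ^ a / fact a) * forest_term x y f * s ^ (a + forest_flux f - 1))"

context
  fixes x y :: real
  assumes x: "x > 0" and y: "y \<ge> 0" and small: "x * exp y < 1 / 4"
begin

lemma forest_term_ge_0: "forest_term x y f \<ge> 0"
  using forest_term_nonneg x y by simp

lemma forest_term_power_le: "0 \<le> s \<Longrightarrow> s \<le> 1 \<Longrightarrow> forest_term x y f * s ^ k \<le> forest_term x y f"
  using forest_term_ge_0[of f] by (simp add: mult_left_le power_le_one)

lemma forest_gf_has_sum:
  assumes "0 \<le> s" "s \<le> 1"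
  shows "((\<lambda>f. forest_term x y f * s ^ forest_flux f) has_sum forest_gf x y s) UNIV"
  unfolding forest_gf_def
proof (rule has_sum_infsum, rule summable_on_comparison_test)
  show "forest_term x y summable_on UNIV" using x y small by (intro forest_term_summable) auto
  show "forest_term x y f * s ^ forest_flux f \<le> forest_term x y f" for f
    by (rule forest_term_power_le[OF assms])
  show "0 \<le> forest_term x y f * s ^ forest_flux f" for f
    using forest_term_ge_0[of f] assms by simp
qed

lemma tree_term_has_sum:
  assumes "0 \<le> s" "s \<le> 1"
  shows "((\<lambda>(a, f). x * (y ^ a / fact a) * forest_term x y f * s ^ (a + forest_flux f)) has_sum
    (x * exp (y * s) * forest_gf x y s)) UNIV"
proof -
  have "((\<lambda>a. x * ((y * s) ^ a / fact a)) has_sum (x * exp (y * s))) UNIV"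
    using y assms by (intro has_sum_cmult_right has_sum_exp) auto
  then have "((\<lambda>(a, f). x * ((y * s) ^ a / fact a) * (forest_term x y f * s ^ forest_flux f)) has_sum
    (x * exp (y * s) * forest_gf x y s)) (UNIV \<times> UNIV)"
    by (rule has_sum_product_nonneg[OF _ forest_gf_has_sum[OF assms]])
       (use x y assms forest_term_ge_0 in auto)
  then show ?thesis by (simp add: power_add power_mult_distrib algebra_simps)
qed

lemma tree_gf_has_sum:
  assumes "0 \<le> s" "s \<le> 1"
  shows "((\<lambda>(a, f). x * (y ^ a / fact a) * forest_term x y f * s ^ (a + forest_flux f - 1)) has_sum
    tree_gf x y s) UNIV"
  unfolding tree_gf_def
proof (rule has_sum_infsum, rule summable_on_comparison_test)
  show "(\<lambda>(a, f). x * (y ^ a / fact a) * forest_term x y f) summable_on UNIV"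
    using has_sum_imp_summable[OF tree_term_has_sum[of 1]] by simp
  fix p :: "nat \<times> forest"
  obtain a f where p: "p = (a, f)" by (cases p)
  have nn: "x * (y ^ a / fact a) * forest_term x y f \<ge> 0" using x y forest_term_ge_0 by simp
  show "(case p of (a, f) \<Rightarrow> x * (y ^ a / fact a) * forest_term x y f * s ^ (a + forest_flux f - 1)) \<le>
      (case p of (a, f) \<Rightarrow> x * (y ^ a / fact a) * forest_term x y f)"
    unfolding p prod.case using nn assms by (intro mult_left_le power_le_one) auto
  show "0 \<le> (case p of (a, f) \<Rightarrow> x * (y ^ a / fact a) * forest_term x y f * s ^ (a + forest_flux f - 1))"
    unfolding p prod.case using nn assms by (intro mult_nonneg_nonneg[OF nn]) auto
qed

text \<open>A non-empty forest is a tree followed by a forest, and the numbers of cars leaving the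
  two parts add up.\<close>

lemma forest_gf_eq:
  assumes "0 \<le> s" "s \<le> 1"
  shows "forest_gf x y s = 1 + tree_gf x y s * forest_gf x y s"
proof -
  have "((\<lambda>(p, r). (case p of (a, f) \<Rightarrow> x * (y ^ a / fact a) * forest_term x y f * s ^ (a + forest_flux f - 1)) *
     (forest_term x y r * s ^ forest_flux r)) has_sum (tree_gf x y s * forest_gf x y s)) (UNIV \<times> UNIV)"
    by (rule has_sum_product_nonneg[OF tree_gf_has_sum[OF assms] forest_gf_has_sum[OF assms]])
       (use x y assms forest_term_ge_0 in auto)
  then have "((\<lambda>((a, c), r). forest_term x y (Tr a c r) * s ^ forest_flux (Tr a c r)) has_sum
      (tree_gf x y s * forest_gf x y s)) ((UNIV \<times> UNIV) \<times> UNIV)"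
    by (simp add: case_prod_unfold power_add mult_ac)
  from has_sum_forest[OF this]
  have "((\<lambda>f. forest_term x y f * s ^ forest_flux f) has_sum (1 + tree_gf x y s * forest_gf x y s))
    (insert Emp ((\<lambda>((a, c), r). Tr a c r) ` ((UNIV \<times> UNIV) \<times> UNIV)))" by simp
  also have "insert Emp ((\<lambda>((a, c), r). Tr a c r) ` ((UNIV \<times> UNIV) \<times> UNIV)) = UNIV"
  proof (rule sym, rule UNIV_eq_I)
    fix f show "f \<in> insert Emp ((\<lambda>((a, c), r). Tr a c r) ` ((UNIV \<times> UNIV) \<times> UNIV))"
      by (cases f) (auto simp: image_iff)
  qed
  finally show ?thesis using forest_gf_has_sum[OF assms] has_sum_unique by blast
qed

text \<open>Multiplication by \<open>s\<close> restores the car that stays at the root. An unvisited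
  root keeps no car and contributes \<open>s\<close> where 1 would be expected, whence the
  correction by \<open>1 - s\<close>. Its coefficient is the value at \<open>s = 0\<close>, isolated
  by \<open>0 ^ k\<close>; through it \<open>forest_gf x y 0\<close> becomes a second
  unknown.\<close>

lemma tree_gf_eq:
  assumes "0 \<le> s" "s \<le> 1"
  shows "s * tree_gf x y s = x * exp (y * s) * forest_gf x y s - (1 - s) * (x * forest_gf x y 0)"
proof -
  let ?w = "\<lambda>a f. x * (y ^ a / fact a) * forest_term x y f"
  have "((\<lambda>(a, f). ?w a f * s ^ (a + forest_flux f) - (1 - s) * (?w a f * 0 ^ (a + forest_flux f))) has_sum
    (x * exp (y * s) * forest_gf x y s - (1 - s) * (x * exp (y * 0) * forest_gf x y 0))) UNIV"
    using has_sum_add[OF tree_term_has_sum[OF assms]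
        has_sum_cmult_right[OF tree_term_has_sum[of 0], of "- (1 - s)"]]
    by (simp only: case_prod_unfold mult_minus_left diff_conv_add_uminus)
  also have "(\<lambda>(a, f). ?w a f * s ^ (a + forest_flux f) - (1 - s) * (?w a f * 0 ^ (a + forest_flux f))) =
      (\<lambda>(a, f). s * (?w a f * s ^ (a + forest_flux f - 1)))"
  proof (intro ext, clarify)
    fix a f
    show "?w a f * s ^ (a + forest_flux f) - (1 - s) * (?w a f * 0 ^ (a + forest_flux f)) =
        s * (?w a f * s ^ (a + forest_flux f - 1))"
    proof (cases "a + forest_flux f")
      case 0
      then show ?thesis by (simp add: algebra_simps)
    qed (simp add: algebra_simps del: add_is_0)
  qed
  finally have "((\<lambda>(a, f). s * (?w a f * s ^ (a + forest_flux f - 1))) has_sum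
      (x * exp (y * s) * forest_gf x y s - (1 - s) * (x * forest_gf x y 0))) UNIV" by simp
  moreover have "((\<lambda>(a, f). s * (?w a f * s ^ (a + forest_flux f - 1))) has_sum (s * tree_gf x y s)) UNIV"
    using has_sum_cmult_right[OF tree_gf_has_sum[OF assms], of s] by (simp add: case_prod_unfold)
  ultimately show ?thesis using has_sum_unique by blast
qed

lemma forest_gf_bounds:
  assumes "0 \<le> s" "s \<le> 1"
  shows "1 \<le> forest_gf x y s" "forest_gf x y s \<le> 2"
proof -
  have "tree_gf x y s \<ge> 0"
    by (rule has_sum_nonneg[OF tree_gf_has_sum[OF assms]]) (use x y assms forest_term_ge_0 in auto)
  moreover have "forest_gf x y s \<ge> 0"
    by (rule has_sum_nonneg[OF forest_gf_has_sum[OF assms]]) (use x y assms forest_term_ge_0 in auto)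
  ultimately show "1 \<le> forest_gf x y s" by (subst forest_gf_eq[OF assms]) simp
  have "forest_gf x y s \<le> infsum (forest_term x y) UNIV"
    by (rule has_sum_mono[OF forest_gf_has_sum[OF assms] has_sum_infsum[OF forest_term_summable]])
       (use x y small assms forest_term_power_le in auto)
  also have "\<dots> \<le> 2" using forest_term_infsum_le[of x y] x y small by simp
  finally show "forest_gf x y s \<le> 2" .
qed

lemma continuous_on_forest_gf: "continuous_on {0..1} (forest_gf x y)"
proof -
  have "uniform_limit {0..1} (\<lambda>X s. \<Sum>f\<in>X. forest_term x y f * s ^ forest_flux f) (forest_gf x y)
      (finite_subsets_at_top UNIV)"
    by (rule Weierstrass_m_test_general'[where M = "forest_term x y"])
       (use x y small forest_term_power_le forest_term_ge_0 forest_gf_has_sum forest_term_summable[of x y]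
        in \<open>auto simp: abs_mult\<close>)
  then show ?thesis
    by (rule uniform_limit_theorem[rotated]) (auto intro!: always_eventually continuous_intros)
qed

text \<open>The kernel method: the equation for \<^const>\<open>forest_gf\<close> is quadratic, its discriminant is a
  square and hence nonnegative on the unit interval, so an interior zero is a double zero.\<close>

lemma kernel_point:
  defines "w \<equiv> x * forest_gf x y 0"
  shows "\<exists>S. 0 < S \<and> S < 1 \<and> (S + w - S * w)\<^sup>2 = 4 * S * x * exp (y * S) \<and>
    2 * (S + w - S * w) * (1 - w) = 4 * x * exp (y * S) * (1 + y * S) \<and> 0 < w \<and> w < 1"
proof -
  \<comment> \<open>\<open>R\<close> is the derivative, at the actual root
    \<open>forest_gf x y s\<close>, of the quadratic polynomial that this root satisfies; its square
    is the discriminant \<open>D\<close>.\<close>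
  define R where "R = (\<lambda>s. 2 * x * exp (y * s) * forest_gf x y s - (s + w - s * w))"
  define D where "D = (\<lambda>s. (s + w - s * w)\<^sup>2 - 4 * s * x * exp (y * s))"
  have D: "D s = (R s)\<^sup>2" if "0 \<le> s" "s \<le> 1" for s
  proof -
    let ?H = "forest_gf x y s"
    have "s * ?H = s + s * tree_gf x y s * ?H"
      using arg_cong[OF forest_gf_eq[OF that], of "\<lambda>z. s * z"] by (simp add: algebra_simps)
    also have "\<dots> = s + (x * exp (y * s) * ?H - (1 - s) * w) * ?H"
      using tree_gf_eq[OF that] by (simp add: w_def)
    finally have "x * exp (y * s) * ?H\<^sup>2 = (s + w - s * w) * ?H - s"
      by (simp add: algebra_simps power2_eq_square)
    then have "4 * (x * exp (y * s)) * (x * exp (y * s) * ?H\<^sup>2) =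
        4 * (x * exp (y * s)) * ((s + w - s * w) * ?H - s)" by simp
    then show ?thesis unfolding R_def D_def by (simp add: algebra_simps power2_eq_square)
  qed
  have w: "0 < w" "w < 1"
  proof -
    show "0 < w" unfolding w_def using forest_gf_bounds[of 0] x by simp
    have "x * 1 \<le> x * exp y" using x y by (intro mult_left_mono) auto
    then have "x \<le> 1 / 4" using small by linarith
    then have "x * forest_gf x y 0 \<le> 1 / 4 * 2"
      using forest_gf_bounds[of 0] x by (intro mult_mono) auto
    then show "w < 1" by (simp add: w_def)
  qed
  have "continuous_on {0..1} R" unfolding R_def
    by (intro continuous_intros continuous_on_forest_gf)
  \<comment> \<open>The sign change: \<open>R 0\<close> is \<open>w\<close> itself, while at 1 the
    bound 2 on \<open>forest_gf\<close> together with \<open>x * exp y < 1 / 4\<close> makes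
    \<open>R\<close> negative.\<close>
  moreover have "R 0 > 0" using w by (simp add: R_def w_def)
  moreover have R1: "R 1 < 0"
  proof -
    have "x * exp y * forest_gf x y 1 \<le> x * exp y * 2"
      using forest_gf_bounds[of 1] x by (intro mult_left_mono) auto
    then show ?thesis using small by (simp add: R_def)
  qed
  ultimately obtain S where S: "0 \<le> S" "S \<le> 1" "R S = 0"
    using IVT2'[of R 1 0 0] by auto
  then have "S \<noteq> 0" "S \<noteq> 1" using \<open>R 0 > 0\<close> R1 by auto
  with S have S01: "0 < S" "S < 1" by auto
  have "D S = 0" using D S by simp
  have "(D has_real_derivative
      2 * (S + w - S * w) * (1 - w) - 4 * x * exp (y * S) * (1 + y * S)) (at S)"
    unfolding D_def by (auto intro!: derivative_eq_intros simp: algebra_simps)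
  moreover have "D S \<le> D s" if "\<bar>S - s\<bar> < min S (1 - S)" for s
    using D[of s] that \<open>D S = 0\<close> by auto
  ultimately have "2 * (S + w - S * w) * (1 - w) - 4 * x * exp (y * S) * (1 + y * S) = 0"
    using S01 by (intro DERIV_local_min[where d = "min S (1 - S)"]) auto
  then show ?thesis using S01 w \<open>D S = 0\<close> by (intro exI[of _ S]) (auto simp: D_def)
qed

text \<open>The double zero yields two equations for \<open>x\<close> and
  \<open>w = x * forest_gf x y 0\<close>, which become explicitly solvable with \<open>S\<close> and
  \<open>y\<close> as coordinates. The value of \<open>tree_gf\<close> at 0 then follows from
  \<open>forest_gf_eq\<close>.\<close>

lemma tree_gf_parametrization:
  assumes "y < 1"
  shows "\<exists>S. 0 < S \<and> S < 1 \<and> x = S * exp (- (y * S)) / (1 + S + y * S - y * S\<^sup>2)\<^sup>2 \<and>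
    tree_gf x y 0 = 1 - exp (- (y * S)) / ((1 + S + y * S - y * S\<^sup>2) * (1 - y * S))"
proof -
  define w where "w = x * forest_gf x y 0"
  obtain S where S: "0 < S" "S < 1" "(S + w - S * w)\<^sup>2 = 4 * S * x * exp (y * S)"
    "2 * (S + w - S * w) * (1 - w) = 4 * x * exp (y * S) * (1 + y * S)" and w: "0 < w" "w < 1"
    using kernel_point[folded w_def] by (elim exE conjE) (rule that)
  define Q where "Q = 1 + S + y * S - y * S\<^sup>2"
  define L where "L = S + w - S * w"
  have "L = S * (1 - w) + w" by (simp add: L_def algebra_simps)
  then have L: "L > 0" using S w by (simp add: add_nonneg_pos)
  have yS: "0 \<le> y * S" "y * S < 1" using y assms S mult_strict_mono[of y 1 S 1] by auto
  have "y * S\<^sup>2 = (y * S) * S" by (simp add: power2_eq_square)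
  also have "\<dots> \<le> y * S" using yS S by (simp add: mult_left_le)
  finally have Q: "Q > 0" using S unfolding Q_def by simp
  \<comment> \<open>Combining the equation with its derivative eliminates
    \<open>x * exp (y * S)\<close>; after division by \<open>L\<close> the result is linear in
    \<open>w\<close>.\<close>
  have "L * (L * (1 + y * S)) = L * (2 * S * (1 - w))"
  proof -
    have "L * (L * (1 + y * S)) = (4 * S * x * exp (y * S)) * (1 + y * S)"
      using S(3) by (simp add: L_def[symmetric] power2_eq_square algebra_simps)
    also have "\<dots> = S * (4 * x * exp (y * S) * (1 + y * S))" by (simp add: mult_ac)
    also have "\<dots> = S * (2 * L * (1 - w))" using S(4) by (simp add: L_def)
    finally show ?thesis by (simp add: algebra_simps)
  qed
  then have eq: "L * (1 + y * S) = 2 * S * (1 - w)" using L by simp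
  have "w * Q = S * (1 - y * S)"
    using eq unfolding L_def Q_def by (simp add: algebra_simps power2_eq_square)
  then have wQ: "w = S * (1 - y * S) / Q" using Q by (simp add: field_simps)
  have LQ: "L * Q = 2 * S"
  proof -
    have "(1 + y * S) * (L * Q) = 2 * S * (Q - w * Q)"
      using eq by (metis (no_types, lifting) mult.assoc mult.commute mult.right_neutral right_diff_distrib)
    also have "\<dots> = (1 + y * S) * (2 * S)"
      unfolding \<open>w * Q = S * (1 - y * S)\<close> by (simp add: Q_def algebra_simps power2_eq_square)
    finally show ?thesis using yS by simp
  qed
  have "4 * S * (S / Q\<^sup>2) = (L * Q)\<^sup>2 / Q\<^sup>2" unfolding LQ by (simp add: power2_eq_square)
  also have "\<dots> = L\<^sup>2" using Q by (simp add: power_mult_distrib)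
  also have "\<dots> = 4 * S * (x * exp (y * S))" using S(3) by (simp add: L_def)
  finally have "(4 * S) * (S / Q\<^sup>2) = (4 * S) * (x * exp (y * S))" .
  then have "S / Q\<^sup>2 = x * exp (y * S)" using S(1) by (subst (asm) mult_left_cancel) auto
  then have "S / Q\<^sup>2 * exp (- (y * S)) = x * (exp (y * S) * exp (- (y * S)))" by simp
  then have xe: "x = S * exp (- (y * S)) / Q\<^sup>2" by (simp only: exp_minus_inverse) simp
  have H0: "forest_gf x y 0 \<ge> 1" using forest_gf_bounds[of 0] by simp
  have "tree_gf x y 0 = 1 - 1 / forest_gf x y 0"
    using forest_gf_eq[of 0] H0 by (simp add: field_simps)
  also have "1 / forest_gf x y 0 = x / w" using x by (simp add: w_def)
  also have "\<dots> = exp (- (y * S)) / (Q * (1 - y * S))"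
  proof -
    have "(S * e / Q\<^sup>2) / (S * d / Q) = e / (Q * d)" for e d
      using S(1) Q by (simp add: power2_eq_square)
    then show ?thesis unfolding wQ by (subst xe) blast
  qed
  finally show ?thesis using S xe unfolding Q_def by blast
qed

end

section \<open>The series of the configurations in which all cars park\<close>

definition parked_series :: "real \<Rightarrow> nat \<Rightarrow> real" where
  "parked_series y n = (\<Sum>\<^sub>\<infinity>m. parked_weight n m * y ^ m)"

lemma parked_weight_nonneg: "parked_weight n m \<ge> 0"
  unfolding parked_weight_def using forest_weight_pos by (intro sum_nonneg) (auto intro: less_imp_le)

context
  fixes x y :: real
  assumes x: "x > 0" and y: "y \<ge> 0" and small: "x * exp y < 1 / 4"
begin

text \<open>At \<open>s = 0\<close> only the terms with \<open>a + forest_flux f - 1 = 0\<close>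
  survive. By truncation these are exactly the configurations with at most one visit to the root;
  they are then grouped by numbers of vertices and cars.\<close>

lemma parked_weight_has_sum:
  "((\<lambda>(n, m). parked_weight n m * y ^ m * x ^ n) has_sum tree_gf x y 0) (UNIV \<times> UNIV)"
proof -
  define h where "h = (\<lambda>(a, f). forest_weight f / fact a * x ^ Suc (forest_size f) * y ^ (a + forest_cars f))"
  define P where "P = {(a, f). a + forest_flux f \<le> 1}"
  have "((\<lambda>(a, f). x * (y ^ a / fact a) * forest_term x y f * 0 ^ (a + forest_flux f - 1)) has_sum
      tree_gf x y 0) UNIV"
    using tree_gf_has_sum[OF x y small, of 0] by simp
  also have "?this \<longleftrightarrow> (h has_sum tree_gf x y 0) P"
    by (rule has_sum_cong_neutral)
       (auto simp: P_def h_def forest_term_eq power_add)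
  finally have "(h has_sum tree_gf x y 0) P" .
  also have "?this \<longleftrightarrow> ((\<lambda>(_, p). h p) has_sum tree_gf x y 0)
      (Sigma (UNIV \<times> UNIV) (\<lambda>(n, m). parked_forests n m))"
    by (rule has_sum_reindex_bij_witness[where i = snd and
          j = "\<lambda>(a, f). ((Suc (forest_size f), a + forest_cars f), (a, f))"])
       (auto simp: P_def parked_forests_def)
  finally have "((\<lambda>(_, p). h p) has_sum tree_gf x y 0)
      (Sigma (UNIV \<times> UNIV) (\<lambda>(n, m). parked_forests n m))" .
  then show ?thesis
  proof (rule has_sum_SigmaD)
    fix nm :: "nat \<times> nat"
    obtain n m where nm: "nm = (n, m)" by (cases nm)
    have "((\<lambda>p. h p) has_sum (\<Sum>p\<in>parked_forests n m. h p)) (parked_forests n m)"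
      by (rule has_sum_finite[OF finite_parked_forests])
    also have "(\<Sum>p\<in>parked_forests n m. h p) =
        (\<Sum>p\<in>parked_forests n m. (case p of (a, f) \<Rightarrow> forest_weight f / fact a) * (y ^ m * x ^ n))"
      by (intro sum.cong refl) (auto simp: h_def parked_forests_def)
    also have "\<dots> = parked_weight n m * y ^ m * x ^ n"
      by (simp add: parked_weight_def sum_distrib_right mult.assoc)
    finally show "((\<lambda>p. case (nm, p) of (_, p) \<Rightarrow> h p) has_sum
        (case nm of (n, m) \<Rightarrow> parked_weight n m * y ^ m * x ^ n)) (case nm of (n, m) \<Rightarrow> parked_forests n m)"
      by (simp add: nm)
  qed
qed

lemma parked_series_has_sum: "((\<lambda>m. parked_weight n m * y ^ m) has_sum parked_series y n) UNIV"
proof -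
  have "(\<lambda>m. parked_weight n m * y ^ m * x ^ n) summable_on UNIV"
    using summable_on_SigmaD1[OF has_sum_imp_summable[OF parked_weight_has_sum], of n] by simp
  from summable_on_cmult_left[OF this, of "inverse (x ^ n)"] show ?thesis
    unfolding parked_series_def using x by (intro has_sum_infsum) (simp add: field_simps)
qed

lemma parked_series_sums: "(\<lambda>n. parked_series y n * x ^ n) sums tree_gf x y 0"
proof (rule has_sum_imp_sums)
  show "((\<lambda>n. parked_series y n * x ^ n) has_sum tree_gf x y 0) UNIV"
    by (rule has_sum_SigmaD[OF parked_weight_has_sum])
       (use has_sum_cmult_left[OF parked_series_has_sum] in simp)
qed

end

section \<open>From identities on an interval to formal series, and Lagrange inversion\<close>

text \<open>Zeros accumulating at 0 are impossible for a non-zero expansion. This carries identities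
  between small positive reals over to formal power series.\<close>

lemma has_fps_expansion_zero_on_reals:
  fixes h :: "complex \<Rightarrow> complex"
  assumes "h has_fps_expansion F" "\<epsilon> > 0" "\<And>s. 0 < s \<Longrightarrow> s < \<epsilon> \<Longrightarrow> h (complex_of_real s) = 0"
  shows "F = 0"
proof -
  have "(\<lambda>w. h (0 + w)) has_laurent_expansion fps_to_fls F"
    using has_laurent_expansion_fps[OF assms(1)] by simp
  moreover have "frequently (\<lambda>z. h z = 0) (at 0)"
    unfolding frequently_at
  proof safe
    fix d :: real assume "d > 0"
    then show "\<exists>z\<in>UNIV. z \<noteq> 0 \<and> dist z 0 < d \<and> h z = 0"
      using assms(2) assms(3)[of "min d \<epsilon> / 2"]
      by (intro bexI[of _ "complex_of_real (min d \<epsilon> / 2)"]) (auto simp del: of_real_divide)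
  qed
  ultimately have "fps_to_fls F = 0"
    by (subst (asm) has_laurent_expansion_frequently_zero_iff) auto
  then show ?thesis by simp
qed

lemma fps_compose_mult_nth:
  fixes a b c :: "'a :: comm_ring_1 fps"
  assumes "b $ 0 = 0"
  shows "((a oo b) * c) $ n = (\<Sum>i\<le>n. a $ i * ((b ^ i * c) $ n))"
proof -
  have "((a oo b) * c) $ n = (\<Sum>k=0..n. (\<Sum>i=0..k. a $ i * (b ^ i $ k)) * c $ (n - k))"
    by (simp add: fps_mult_nth fps_compose_nth)
  also have "\<dots> = (\<Sum>k=0..n. (\<Sum>i=0..n. a $ i * (b ^ i $ k)) * c $ (n - k))"
    using assms by (intro sum.cong arg_cong2[where f = "(*)"] refl sum.mono_neutral_left)
      (auto simp: startsby_zero_power_prefix)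
  also have "\<dots> = (\<Sum>i=0..n. \<Sum>k=0..n. a $ i * (b ^ i $ k * c $ (n - k)))"
    by (subst sum.swap) (simp add: sum_distrib_right mult.assoc)
  also have "\<dots> = (\<Sum>i\<le>n. a $ i * ((b ^ i * c) $ n))"
    by (simp add: fps_mult_nth sum_distrib_left atMost_atLeast0)
  finally show ?thesis .
qed

text \<open>The derivative of \<open>G\<close> is
  \<open>(fps_deriv F oo \<psi>) * fps_deriv \<psi>\<close>. After multiplication by
  \<open>\<phi> ^ Suc N\<close>, only the power \<open>\<psi> ^ N\<close> contributes to the
  coefficient at \<open>N\<close>. This form, with \<open>G\<close> known and \<open>F\<close>
  sought, fits the parametrization: the inverse of \<open>\<psi>\<close> under composition is never
  formed.\<close>

lemma fps_lagrange_inversion: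
  fixes F G \<psi> \<phi> :: "'a :: field_char_0 fps"
  assumes comp: "F oo \<psi> = G" and inv: "\<psi> * \<phi> = fps_X" and \<psi>0: "\<psi> $ 0 = 0"
  shows "of_nat (Suc N) * F $ Suc N = (fps_deriv G * \<phi> ^ Suc N) $ N"
proof -
  have der: "fps_deriv \<psi> * \<phi> = 1 - \<psi> * fps_deriv \<phi>"
    using arg_cong[OF inv, of fps_deriv] by (simp add: algebra_simps)
  have coeff: "(\<psi> ^ i * (fps_deriv \<psi> * \<phi> ^ Suc N)) $ N = (if i = N then 1 else 0)" if "i \<le> N" for i
  proof -
    define j where "j = N - i"
    have N: "N = i + j" using that by (simp add: j_def)
    have "\<psi> ^ i * (fps_deriv \<psi> * \<phi> ^ Suc N) = (\<psi> * \<phi>) ^ i * (\<phi> ^ j * (fps_deriv \<psi> * \<phi>))"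
      by (simp add: N power_add power_mult_distrib mult_ac)
    also have "\<dots> = fps_X ^ i * (\<phi> ^ j * (1 - \<psi> * fps_deriv \<phi>))"
      by (simp only: inv der)
    also have "\<dots> = fps_X ^ i * (\<phi> ^ j - \<psi> * fps_deriv \<phi> * \<phi> ^ j)"
      by (simp add: algebra_simps)
    finally have "(\<psi> ^ i * (fps_deriv \<psi> * \<phi> ^ Suc N)) $ N = (\<phi> ^ j - \<psi> * fps_deriv \<phi> * \<phi> ^ j) $ j"
      by (simp add: fps_X_power_mult_nth N)
    also have "\<dots> = (if j = 0 then 1 else 0)"
    proof (cases j)
      case 0
      then show ?thesis by (simp add: fps_mult_nth \<psi>0)
    next
      \<comment> \<open>Here \<open>\<psi> * fps_deriv \<phi> * \<phi> ^ j\<close> is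
        \<open>fps_X * fps_deriv (\<phi> ^ j)\<close> divided by \<open>j\<close>. Its coefficient
        at \<open>j\<close> equals that of \<open>\<phi> ^ j\<close>, so the difference
        vanishes.\<close>
      case (Suc j')
      have "\<psi> * fps_deriv \<phi> * \<phi> ^ j = (\<psi> * \<phi>) * (fps_deriv \<phi> * \<phi> ^ j')"
        by (simp add: Suc mult_ac)
      then have X: "(\<psi> * fps_deriv \<phi> * \<phi> ^ j) $ j = (fps_deriv \<phi> * \<phi> ^ j') $ j'"
        by (simp only: inv Suc fps_X_mult_nth) simp
      have "of_nat j * (fps_deriv \<phi> * \<phi> ^ j') = fps_deriv (\<phi> ^ j)"
        unfolding fps_deriv_power Suc by (simp add: mult_ac fps_of_nat del: of_nat_Suc power_Suc)
      then have "of_nat j * (fps_deriv \<phi> * \<phi> ^ j') $ j' = of_nat j * \<phi> ^ j $ j"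
        using Suc by (metis add.commute fps_deriv_nth fps_mult_of_nat_nth(1) plus_1_eq_Suc)
      then have "(fps_deriv \<phi> * \<phi> ^ j') $ j' = \<phi> ^ j $ j"
        using Suc by (subst (asm) mult_left_cancel) (auto simp del: of_nat_Suc)
      with X show ?thesis using Suc by (simp only: fps_sub_nth) simp
    qed
    finally show ?thesis using N by auto
  qed
  have "fps_deriv G * \<phi> ^ Suc N = (fps_deriv F oo \<psi>) * (fps_deriv \<psi> * \<phi> ^ Suc N)"
    using fps_compose_deriv[OF \<psi>0, of F] by (simp add: comp mult.assoc)
  then have "(fps_deriv G * \<phi> ^ Suc N) $ N =
      (\<Sum>i\<le>N. fps_deriv F $ i * ((\<psi> ^ i * (fps_deriv \<psi> * \<phi> ^ Suc N)) $ N))"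
    by (simp only: fps_compose_mult_nth[OF \<psi>0])
  also have "\<dots> = (\<Sum>i\<le>N. if i = N then fps_deriv F $ i else 0)"
    by (intro sum.cong refl) (simp only: coeff atMost_iff, simp)
  also have "\<dots> = of_nat (Suc N) * F $ Suc N" by simp
  finally show ?thesis ..
qed

text \<open>Polymorphic because it is used for real and for complex arguments.\<close>

definition kernel_Q :: "'a :: comm_ring_1 \<Rightarrow> 'a \<Rightarrow> 'a" where
  "kernel_Q y s = 1 + s + y * s - y * s ^ 2"

text \<open>The zero of the kernel is obtained by a mere existence argument, so nothing yet ties it
  to the parameter from which \<open>x\<close> was computed; strict monotonicity does. The bound
  \<open>1 / 4\<close> on \<open>y\<close> keeps the factor
  \<open>1 - 2 * (y * t) - (y * t)\<^sup>2\<close> of the derivative positive.\<close>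

lemma kernel_psi_inj:
  fixes y s S :: real
  assumes y: "0 \<le> y" "y \<le> 1 / 4" and s: "0 < s" "s < 1" "0 < S" "S < 1"
    and eq: "s * exp (- (y * s)) / (kernel_Q y s)\<^sup>2 = S * exp (- (y * S)) / (kernel_Q y S)\<^sup>2"
  shows "s = S"
proof -
  define \<psi> where "\<psi> = (\<lambda>s. s * exp (- (y * s)) / (kernel_Q y s)\<^sup>2)"
  have Q: "kernel_Q y t > 0" if "0 < t" "t < 1" for t
  proof -
    have "kernel_Q y t = 1 + t + y * t * (1 - t)" by (simp add: kernel_Q_def power2_eq_square algebra_simps)
    moreover have "y * t * (1 - t) \<ge> 0" using that y by simp
    ultimately show ?thesis using that by linarith
  qed
  have deriv: "(\<psi> has_real_derivative
      exp (- (y * t)) * (1 - t) * (1 - 2 * (y * t) - (y * t)\<^sup>2) / kernel_Q y t ^ 3) (at t)"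
    if "0 < t" "t < 1" for t
  proof -
    have Qd: "(kernel_Q y has_real_derivative (1 + y - 2 * y * t)) (at t)"
      unfolding kernel_Q_def by (auto intro!: derivative_eq_intros)
    have "(\<psi> has_real_derivative
      ((exp (- (y * t)) - y * t * exp (- (y * t))) * (kernel_Q y t)\<^sup>2 -
        t * exp (- (y * t)) * (2 * kernel_Q y t * (1 + y - 2 * y * t))) / ((kernel_Q y t)\<^sup>2 * (kernel_Q y t)\<^sup>2)) (at t)"
      unfolding \<psi>_def using Q[OF that]
      by (auto intro!: derivative_eq_intros Qd simp: algebra_simps power2_eq_square)
    also have "((exp (- (y * t)) - y * t * exp (- (y * t))) * (kernel_Q y t)\<^sup>2 -
        t * exp (- (y * t)) * (2 * kernel_Q y t * (1 + y - 2 * y * t))) =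
        exp (- (y * t)) * ((1 - y * t) * kernel_Q y t - 2 * t * (1 + y - 2 * y * t)) * kernel_Q y t"
      by (simp add: algebra_simps power2_eq_square)
    also have "(1 - y * t) * kernel_Q y t - 2 * t * (1 + y - 2 * y * t) = (1 - t) * (1 - 2 * (y * t) - (y * t)\<^sup>2)"
      by (simp add: kernel_Q_def algebra_simps power2_eq_square)
    also have "exp (- (y * t)) * ((1 - t) * (1 - 2 * (y * t) - (y * t)\<^sup>2)) * kernel_Q y t /
        ((kernel_Q y t)\<^sup>2 * (kernel_Q y t)\<^sup>2) =
        exp (- (y * t)) * (1 - t) * (1 - 2 * (y * t) - (y * t)\<^sup>2) / kernel_Q y t ^ 3"
    proof -
      have "e * r * q / (q\<^sup>2 * q\<^sup>2) = e * r / q ^ 3" if "q > 0" for e r q :: real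
        using that by (simp add: power2_eq_square power3_eq_cube)
      from this[OF Q[OF that], of "exp (- (y * t))" "(1 - t) * (1 - 2 * (y * t) - (y * t)\<^sup>2)"]
      show ?thesis by (simp only: mult.assoc)
    qed
    finally show ?thesis .
  qed
  have pos: "exp (- (y * t)) * (1 - t) * (1 - 2 * (y * t) - (y * t)\<^sup>2) / kernel_Q y t ^ 3 > 0"
    if "0 < t" "t < 1" for t
  proof -
    have yt: "0 \<le> y * t" "y * t \<le> 1 / 4" using mult_mono[of y "1 / 4" t 1] y that by auto
    then have "(y * t)\<^sup>2 \<le> (1 / 4)\<^sup>2" by (intro power_mono)
    then have "1 - 2 * (y * t) - (y * t)\<^sup>2 > 0" using yt by (simp add: power2_eq_square)
    then show ?thesis using that Q by simp
  qed
  have mono: "\<psi> a < \<psi> b" if "0 < a" "a < b" "b < 1" for a b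
  proof (rule DERIV_pos_imp_increasing[OF that(2)])
    fix t assume "a \<le> t" "t \<le> b"
    then show "\<exists>d. (\<psi> has_real_derivative d) (at t) \<and> d > 0"
      using deriv[of t] pos[of t] that by force
  qed
  show ?thesis using mono[of s S] mono[of S s] s eq by (fastforce simp: \<psi>_def not_less_iff_gr_or_eq)
qed

section \<open>Lagrange inversion and the coefficient formula\<close>

text \<open>Pure ring identities, stated for variables so that series arithmetic stays out of the
  rewriting. The third one is the source of the factor \<open>1 - 2 u - u\<^sup>2\<close>.\<close>

lemma deriv_rearrange:
  fixes e c I J D Q u X :: "'a :: comm_ring_1"
  shows "e * (c * (I * J) + D * (I\<^sup>2 * J) - c * (I * J\<^sup>2)) * Q\<^sup>2 =
      e * (c * ((I * Q) * Q * J) + D * ((I * Q) * (I * Q) * J) - c * ((I * Q) * Q * J\<^sup>2))"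
    and "e * (c * (Q * (J * (1 - u))) + D * (J * (1 - u)) - c * (Q * J)) = e * J * (D * (1 - u) - c * u * Q)"
    and "(1 + c - 2 * (c * X)) * (1 - c * X) - c * (c * X) * (1 + X + c * X - c * X * X) =
      (1 - 2 * (c * X) - (c * X)\<^sup>2) * (c + (1 - c * X))"
    and "(e * Q\<^sup>2) ^ Suc N = e ^ Suc N * Q ^ (2 * N) * Q\<^sup>2"
    and "e * (c * (X * I) ^ k * Q) * (D * J * u) = c * (X ^ k * (J * (e * D * Q * I ^ k * u)))"
proof -
  show "(e * Q\<^sup>2) ^ Suc N = e ^ Suc N * Q ^ (2 * N) * Q\<^sup>2"
    unfolding power_mult[of Q 2 N] by (simp only: power_mult_distrib power_Suc mult_ac)
qed (simp_all add: algebra_simps power2_eq_square power_mult_distrib)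

section \<open>The parametrization as formal power series\<close>

context
  fixes y :: complex
begin

definition fps_u :: "complex fps" where "fps_u = fps_const y * fps_X"
definition fps_Q :: "complex fps" where "fps_Q = 1 + fps_X + fps_u - fps_u * fps_X"
definition fps_phi :: "complex fps" where "fps_phi = fps_exp y * fps_Q\<^sup>2"
definition fps_psi :: "complex fps" where "fps_psi = fps_X * fps_exp (- y) * inverse (fps_Q\<^sup>2)"
definition fps_G :: "complex fps" where "fps_G = 1 - fps_exp (- y) * inverse (fps_Q * (1 - fps_u))"

lemma fps_u_0: "fps_u $ 0 = 0" by (simp add: fps_u_def)
lemma fps_Q_0: "fps_Q $ 0 = 1" by (simp add: fps_Q_def fps_u_0)

lemma fps_exp_cancel: "fps_exp (- y) * fps_exp y = 1"
  by (simp flip: fps_exp_add_mult)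

lemma fps_psi_phi: "fps_psi * fps_phi = fps_X"
proof -
  have "inverse (fps_Q\<^sup>2) * fps_Q\<^sup>2 = 1"
    by (rule inverse_mult_eq_1) (simp add: fps_Q_0 power2_eq_square)
  moreover have "fps_psi * fps_phi = fps_X * (fps_exp (- y) * fps_exp y) * (inverse (fps_Q\<^sup>2) * fps_Q\<^sup>2)"
    by (simp add: fps_psi_def fps_phi_def mult_ac)
  ultimately show ?thesis by (simp add: fps_exp_cancel)
qed

lemma fps_psi_0: "fps_psi $ 0 = 0" by (simp add: fps_psi_def)

lemma fps_u_expansion: "(\<lambda>z. y * z) has_fps_expansion fps_u"
  unfolding fps_u_def by (intro fps_expansion_intros)

lemma fps_Q_expansion: "kernel_Q y has_fps_expansion fps_Q"
proof -
  have "(\<lambda>z. 1 + z + y * z - (y * z) * z) has_fps_expansion fps_Q"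
    unfolding fps_Q_def
    by (intro has_fps_expansion_add has_fps_expansion_diff has_fps_expansion_mult
        has_fps_expansion_1 has_fps_expansion_fps_X fps_u_expansion)
  moreover have "kernel_Q y = (\<lambda>z. 1 + z + y * z - (y * z) * z)"
    by (simp add: kernel_Q_def power2_eq_square fun_eq_iff)
  ultimately show ?thesis by simp
qed

lemma fps_psi_expansion: "(\<lambda>z. z * exp (- (y * z)) / (kernel_Q y z)\<^sup>2) has_fps_expansion fps_psi"
proof -
  have "(\<lambda>z. z * exp ((- y) * z) * inverse (kernel_Q y z * kernel_Q y z)) has_fps_expansion fps_psi"
    unfolding fps_psi_def power2_eq_square
    by (intro has_fps_expansion_mult has_fps_expansion_inverse has_fps_expansion_fps_X
        has_fps_expansion_exp fps_Q_expansion) (simp add: fps_Q_0)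
  then show ?thesis by (simp add: divide_inverse power2_eq_square)
qed

lemma fps_G_expansion:
  "(\<lambda>z. 1 - exp (- (y * z)) / (kernel_Q y z * (1 - y * z))) has_fps_expansion fps_G"
proof -
  have "(\<lambda>z. 1 - exp ((- y) * z) * inverse (kernel_Q y z * (1 - y * z))) has_fps_expansion fps_G"
    unfolding fps_G_def
    by (intro has_fps_expansion_mult has_fps_expansion_inverse has_fps_expansion_diff
        has_fps_expansion_1 has_fps_expansion_exp fps_Q_expansion fps_u_expansion)
       (simp add: fps_Q_0 fps_u_0)
  then show ?thesis by (simp add: divide_inverse)
qed

text \<open>The derivative of \<open>fps_G\<close> uses up one exponential and two factors
  \<open>fps_Q\<close> of \<open>fps_phi ^ Suc N\<close>, which leaves the exponents
  \<open>N\<close> and \<open>2 * N\<close>.\<close>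

lemma fps_G_deriv_phi:
  "fps_deriv fps_G * fps_phi ^ Suc N = fps_exp (of_nat N * y) * fps_Q ^ (2 * N) *
     ((1 - 2 * fps_u - fps_u\<^sup>2) * (fps_const y + (1 - fps_u)) * inverse ((1 - fps_u)\<^sup>2))"
proof -
  define e where "e = fps_exp (- y)"
  define I where "I = inverse fps_Q"
  define J where "J = inverse (1 - fps_u)"
  have I: "I * fps_Q = 1" unfolding I_def by (rule inverse_mult_eq_1) (simp add: fps_Q_0)
  have J: "J * (1 - fps_u) = 1" unfolding J_def by (rule inverse_mult_eq_1) (simp add: fps_u_0)
  have du: "fps_deriv fps_u = fps_const y" by (simp add: fps_u_def)
  have dI: "fps_deriv I = - fps_deriv fps_Q * I\<^sup>2"
    unfolding I_def by (rule fps_inverse_deriv) (simp add: fps_Q_0)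
  have dJ: "fps_deriv J = fps_const y * J\<^sup>2"
    unfolding J_def using fps_inverse_deriv[of "1 - fps_u"] by (simp add: fps_u_0 du)
  have dQ: "fps_deriv fps_Q = 1 + fps_const y - 2 * fps_u"
    by (simp add: fps_Q_def du) (simp add: fps_u_def algebra_simps)
  have de: "fps_deriv e = - (fps_const y * e)" by (simp add: e_def flip: fps_const_neg)
  have "fps_deriv fps_G = - fps_deriv (e * (I * J))"
    unfolding fps_G_def e_def I_def J_def by (simp add: fps_inverse_mult)
  also have "\<dots> = e * (fps_const y * (I * J) + fps_deriv fps_Q * (I\<^sup>2 * J) - fps_const y * (I * J\<^sup>2))"
    by (simp add: dI dJ de algebra_simps power2_eq_square)
  finally have dG: "fps_deriv fps_G = \<dots>" .
  have "fps_deriv fps_G * fps_Q\<^sup>2 =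
     e * (fps_const y * ((I * fps_Q) * fps_Q * J) + fps_deriv fps_Q * ((I * fps_Q) * (I * fps_Q) * J) -
       fps_const y * ((I * fps_Q) * fps_Q * J\<^sup>2))"
    unfolding dG by (rule deriv_rearrange(1))
  also have "\<dots> = e * (fps_const y * (fps_Q * J) + fps_deriv fps_Q * J - fps_const y * (fps_Q * J\<^sup>2))"
    by (simp only: I mult_1_left)
  \<comment> \<open>All terms are brought to the denominator
    \<open>(1 - fps_u)\<^sup>2\<close>.\<close>
  also have "\<dots> = e * (fps_const y * (fps_Q * (J\<^sup>2 * (1 - fps_u))) + fps_deriv fps_Q * (J\<^sup>2 * (1 - fps_u))
       - fps_const y * (fps_Q * J\<^sup>2))"
  proof -
    have "J\<^sup>2 * (1 - fps_u) = J * (J * (1 - fps_u))" by (simp only: power2_eq_square mult.assoc)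
    then show ?thesis by (simp only: J mult_1_right)
  qed
  also have "\<dots> = e * J\<^sup>2 * (fps_deriv fps_Q * (1 - fps_u) - fps_const y * fps_u * fps_Q)"
    by (rule deriv_rearrange(2))
  also have "fps_deriv fps_Q * (1 - fps_u) - fps_const y * fps_u * fps_Q =
      (1 - 2 * fps_u - fps_u\<^sup>2) * (fps_const y + (1 - fps_u))"
  proof -
    have "fps_deriv fps_Q * (1 - fps_u) - fps_const y * fps_u * fps_Q =
        (1 + fps_const y - 2 * fps_u) * (1 - fps_u) - fps_const y * fps_u * (1 + fps_X + fps_u - fps_u * fps_X)"
      by (simp only: dQ) (simp only: fps_Q_def)
    also have "\<dots> = (1 - 2 * fps_u - fps_u\<^sup>2) * (fps_const y + (1 - fps_u))"
      unfolding fps_u_def by (rule deriv_rearrange(3))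
    finally show ?thesis .
  qed
  finally have 1: "fps_deriv fps_G * fps_Q\<^sup>2 =
      e * J\<^sup>2 * ((1 - 2 * fps_u - fps_u\<^sup>2) * (fps_const y + (1 - fps_u)))" .
  have 2: "fps_exp y ^ Suc N * e = fps_exp (of_nat N * y)"
    unfolding e_def using fps_exp_cancel by (simp add: fps_exp_power_mult mult_ac)
  have "fps_deriv fps_G * fps_phi ^ Suc N = fps_exp y ^ Suc N * fps_Q ^ (2 * N) * (fps_deriv fps_G * fps_Q\<^sup>2)"
    unfolding fps_phi_def deriv_rearrange(4) by (simp only: mult_ac)
  also have "\<dots> = (fps_exp y ^ Suc N * e) * fps_Q ^ (2 * N) *
      ((1 - 2 * fps_u - fps_u\<^sup>2) * (fps_const y + (1 - fps_u)) * J\<^sup>2)"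
    unfolding 1 by (simp only: mult_ac)
  finally show ?thesis unfolding 2 J_def by (simp add: fps_inverse_power)
qed

end

text \<open>What accompanies \<open>fps_X ^ k\<close> in the binomial expansion of
  \<open>fps_Q ^ (2 * N)\<close>, up to the binomial coefficient and the factor
  \<open>y + (1 - u)\<close>. It is a series in \<open>u\<close>, not in the original
  variable.\<close>

definition park_fps :: "nat \<Rightarrow> nat \<Rightarrow> complex fps" where
  "park_fps N k = fps_exp (of_nat N) * (1 - 2 * fps_X - fps_X\<^sup>2) * (1 + fps_X) ^ (2 * N - k) *
     (1 - fps_X) ^ k * inverse ((1 - fps_X)\<^sup>2)"

text \<open>Substituting \<open>u = y * fps_X\<close> multiplies the coefficient at \<open>j\<close>
  by \<open>y ^ j\<close>. Since the summand \<open>k\<close> has spent \<open>k\<close> powers of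
  the variable, it carries a definite power of \<open>y\<close>, and the sum over \<open>k\<close>
  is at once the expansion in \<open>y\<close>. The summand \<open>y\<close> of
  \<open>y + (1 - u)\<close> shifts one part by a further power.\<close>

lemma fps_G_deriv_phi_nth:
  "(fps_deriv (fps_G y) * fps_phi y ^ Suc N) $ N =
    (\<Sum>k\<le>N. of_nat ((2 * N) choose k) *
      (y ^ (Suc N - k) * park_fps N k $ (N - k) + y ^ (N - k) * ((1 - fps_X) * park_fps N k) $ (N - k)))"
proof -
  let ?u = "fps_u y"
  have u0: "?u $ 0 = 0" by (rule fps_u_0)
  have comp: "park_fps N k oo ?u = fps_exp (of_nat N * y) * (1 - 2 * ?u - ?u\<^sup>2) * (1 + ?u) ^ (2 * N - k) *
     (1 - ?u) ^ k * inverse ((1 - ?u)\<^sup>2)" for k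
  proof -
    have "fps_exp (of_nat N) oo ?u = fps_exp (of_nat N * y)"
      unfolding fps_u_def by (simp only: fps_exp_compose_linear) (simp only: mult.commute)
    moreover have "(1 :: complex fps) oo ?u = 1" "(2 :: complex fps) oo ?u = 2" 
      using fps_const_compose[of 1 ?u] fps_const_compose[of 2 ?u]
      by (simp_all add: numeral_fps_const)
    ultimately show ?thesis
      by (simp add: park_fps_def fps_compose_mult_distrib[OF u0] fps_compose_power[OF u0, symmetric]
          fps_inverse_compose[OF u0] fps_compose_add_distrib fps_compose_sub_distrib u0)
  qed
  have comp1: "((1 - fps_X) * park_fps N k) oo ?u = (1 - ?u) * (park_fps N k oo ?u)" for k
  proof -
    have "(1 :: complex fps) oo ?u = 1" using fps_const_compose[of 1 ?u] by simp
    then show ?thesis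
      by (simp add: fps_compose_mult_distrib[OF u0] fps_compose_sub_distrib u0)
  qed
  have nth: "(A oo ?u) $ j = y ^ j * A $ j" for A j
    unfolding fps_u_def by (simp add: fps_compose_linear)
  have "fps_Q y ^ (2 * N) = (fps_X * (1 - ?u) + (1 + ?u)) ^ (2 * N)"
    by (simp add: fps_Q_def algebra_simps)
  also have "\<dots> = (\<Sum>k\<le>2*N. of_nat ((2 * N) choose k) * (fps_X * (1 - ?u)) ^ k * (1 + ?u) ^ (2 * N - k))"
    by (rule binomial_ring)
  finally have Q: "fps_Q y ^ (2 * N) = \<dots>" .
  have "fps_deriv (fps_G y) * fps_phi y ^ Suc N =
    (\<Sum>k\<le>2*N. of_nat ((2 * N) choose k) * (fps_X ^ k * ((fps_const y + (1 - ?u)) * (park_fps N k oo ?u))))"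
    unfolding fps_G_deriv_phi Q comp sum_distrib_left sum_distrib_right
    by (intro sum.cong refl) (rule deriv_rearrange(5))
  also have "\<dots> $ N = (\<Sum>k\<le>2*N. of_nat ((2 * N) choose k) *
      (fps_X ^ k * ((fps_const y + (1 - ?u)) * (park_fps N k oo ?u))) $ N)"
    by (simp add: fps_sum_nth fps_mult_of_nat_nth)
  also have "\<dots> = (\<Sum>k\<le>2*N. if k \<le> N then of_nat ((2 * N) choose k) *
      ((fps_const y + (1 - ?u)) * (park_fps N k oo ?u)) $ (N - k) else 0)"
    by (intro sum.cong refl) (simp add: fps_X_power_mult_nth)
  also have "\<dots> = (\<Sum>k\<le>N. of_nat ((2 * N) choose k) *
      ((fps_const y + (1 - ?u)) * (park_fps N k oo ?u)) $ (N - k))"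
    by (intro sum.mono_neutral_cong_right) auto
  also have "\<dots> = (\<Sum>k\<le>N. of_nat ((2 * N) choose k) *
      (y ^ (Suc N - k) * park_fps N k $ (N - k) + y ^ (N - k) * ((1 - fps_X) * park_fps N k) $ (N - k)))"
    unfolding distrib_right comp1[symmetric] by (intro sum.cong refl) (simp add: nth Suc_diff_le)
  finally show ?thesis .
qed

text \<open>Both sides expand functions that agree at small positive \<open>s\<close>: for the
  \<open>x\<close> computed from \<open>s\<close>, the kernel method returns some \<open>S\<close>,
  and injectivity forces \<open>S = s\<close>.\<close>

lemma parked_series_fps:
  assumes y: "0 \<le> y" "y \<le> 1 / 4"
  shows "Abs_fps (\<lambda>n. complex_of_real (parked_series y n)) oo fps_psi (of_real y) = fps_G (of_real y)"
proof -
  define F where "F = Abs_fps (\<lambda>n. complex_of_real (parked_series y n))"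
  define \<psi> where "\<psi> = (\<lambda>z. z * exp (- (complex_of_real y * z)) / (kernel_Q (of_real y) z)\<^sup>2)"
  define G where "G = (\<lambda>z. 1 - exp (- (complex_of_real y * z)) / (kernel_Q (of_real y) z * (1 - of_real y * z)))"
  have eval: "eval_fps F (of_real x) = of_real (tree_gf x y 0)" if "x > 0" "x * exp y < 1 / 4" for x
  proof -
    have "(\<lambda>n. complex_of_real (parked_series y n * x ^ n)) sums of_real (tree_gf x y 0)"
      using parked_series_sums[OF that(1) y(1) that(2)] by (simp only: sums_of_real_iff)
    then show ?thesis by (simp add: eval_fps_def F_def sums_iff)
  qed
  have "fps_conv_radius F > 0"
  proof -
    \<comment> \<open>A single admissible point, with \<open>x * exp y = 1 / 8\<close>, shows that
      the radius of convergence is positive.\<close>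
    define x where "x = exp (- y) / 8"
    have x: "x > 0" "x * exp y < 1 / 4" by (auto simp: x_def exp_minus)
    have "summable (\<lambda>n. parked_series y n * x ^ n)"
      using parked_series_sums[OF x(1) y(1) x(2)] by (rule sums_summable)
    then have "summable (\<lambda>n. complex_of_real (parked_series y n * x ^ n))" by (simp only: summable_of_real_iff)
    then have "ereal (norm (complex_of_real x)) \<le> fps_conv_radius F"
      unfolding fps_conv_radius_def F_def by (intro conv_radius_geI) simp
    then show ?thesis using x(1) by (metis ereal_less(2) less_le_trans norm_of_real abs_of_pos)
  qed
  then have "(eval_fps F \<circ> \<psi>) has_fps_expansion (F oo fps_psi (of_real y))"
    unfolding \<psi>_def
    by (intro has_fps_expansion_compose eval_fps_has_fps_expansion fps_psi_expansion fps_psi_0)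
  from has_fps_expansion_diff[OF this fps_G_expansion[of "of_real y"]]
  have expansion: "(\<lambda>z. (eval_fps F \<circ> \<psi>) z - G z) has_fps_expansion ((F oo fps_psi (of_real y)) - fps_G (of_real y))"
    unfolding G_def .
  \<comment> \<open>The range of \<open>s\<close> is chosen so that \<open>x \<le> s\<close> already
    gives \<open>x * exp y < 1 / 4\<close>.\<close>
  have zero: "(eval_fps F \<circ> \<psi>) (of_real s) - G (of_real s) = 0" if s: "0 < s" "s < exp (- y) / 4" for s
  proof -
    define x where "x = s * exp (- (y * s)) / (kernel_Q y s)\<^sup>2"
    have "exp (- y) \<le> 1" using y by simp
    then have s1: "s < 1" using s by linarith
    have "y * s * (1 - s) \<ge> 0" using s s1 y by simp
    moreover have "kernel_Q y s = 1 + s + y * s * (1 - s)"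
      by (simp add: kernel_Q_def power2_eq_square algebra_simps)
    ultimately have Q: "kernel_Q y s \<ge> 1" using s by linarith
    have x0: "x > 0" using s Q by (simp add: x_def)
    have "1 \<le> (kernel_Q y s)\<^sup>2" using Q by (rule one_le_power)
    then have "x \<le> s * exp (- (y * s)) / 1"
      unfolding x_def using s by (intro divide_left_mono) auto
    also have "\<dots> \<le> s" using s y by simp
    finally have "x * exp y \<le> s * exp y" by simp
    also have "\<dots> < exp (- y) / 4 * exp y" using s by (intro mult_strict_right_mono) auto
    finally have x1: "x * exp y < 1 / 4" by (simp add: exp_minus)
    obtain S where S: "0 < S" "S < 1" "x = S * exp (- (y * S)) / (kernel_Q y S)\<^sup>2"
      "tree_gf x y 0 = 1 - exp (- (y * S)) / (kernel_Q y S * (1 - y * S))"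
      using tree_gf_parametrization[OF x0 y(1) x1] y unfolding kernel_Q_def by auto
    have "S = s"
      using kernel_psi_inj[OF y s(1) s1 S(1,2)] S(3) by (simp add: x_def)
    then have "tree_gf x y 0 = 1 - exp (- (y * s)) / (kernel_Q y s * (1 - y * s))" using S by simp
    moreover have Qc: "kernel_Q (complex_of_real y) (of_real s) = of_real (kernel_Q y s)"
      by (simp add: kernel_Q_def)
    have Ec: "exp (- (complex_of_real y * complex_of_real s)) = of_real (exp (- (y * s)))"
      by (simp add: exp_of_real[symmetric])
    have "\<psi> (of_real s) = of_real x"
      unfolding \<psi>_def x_def Qc Ec by simp
    moreover have "G (of_real s) = of_real (1 - exp (- (y * s)) / (kernel_Q y s * (1 - y * s)))"
      unfolding G_def Qc Ec by simp
    ultimately show ?thesis using eval[OF x0 x1] by simp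
  qed
  have "(F oo fps_psi (of_real y)) - fps_G (of_real y) = 0"
    by (rule has_fps_expansion_zero_on_reals[OF expansion _ zero, where \<epsilon> = "exp (- y) / 4"]) auto
  then show ?thesis by (simp add: F_def)
qed

lemma parked_series_eq:
  assumes y: "0 \<le> y" "y \<le> 1 / 4"
  shows "of_nat (Suc N) * complex_of_real (parked_series y (Suc N)) =
    (\<Sum>k\<le>N. of_nat ((2 * N) choose k) * (of_real y ^ (Suc N - k) * park_fps N k $ (N - k) +
      of_real y ^ (N - k) * ((1 - fps_X) * park_fps N k) $ (N - k)))"
  using fps_lagrange_inversion[OF parked_series_fps[OF y] fps_psi_phi fps_psi_0, of N]
  unfolding fps_G_deriv_phi_nth by simp

section \<open>Extracting the power of \<open>y\<close>\<close>

text \<open>The right side of \<open>parked_series_eq\<close> is a polynomial in \<open>y\<close>,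
  in which only \<open>k = Suc N - m\<close> and \<open>k = N - m\<close> produce the power
  \<open>m\<close>. For \<open>m = 0\<close> the first index exceeds \<open>N\<close> and is
  missing.\<close>

lemma parked_weight_coeff:
  assumes "m \<le> N"
  shows "of_nat (Suc N) * complex_of_real (parked_weight (Suc N) m) =
    (if m = 0 then 0 else of_nat ((2 * N) choose (Suc N - m)) * park_fps N (Suc N - m) $ (m - 1)) +
    of_nat ((2 * N) choose (N - m)) * ((1 - fps_X) * park_fps N (N - m)) $ m"
proof -
  define A where "A = Abs_fps (\<lambda>m. of_nat (Suc N) * complex_of_real (parked_weight (Suc N) m))"
  define a where "a = (\<lambda>k. of_nat ((2 * N) choose k) * park_fps N k $ (N - k))"
  define b where "b = (\<lambda>k. of_nat ((2 * N) choose k) * ((1 - fps_X) * park_fps N k) $ (N - k))"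
  define B where "B = (\<Sum>k\<le>N. fps_const (a k) * fps_X ^ (Suc N - k) + fps_const (b k) * fps_X ^ (N - k))"
  define Bf where "Bf = (\<lambda>z. \<Sum>k\<le>N. a k * z ^ (Suc N - k) + b k * z ^ (N - k))"
  \<comment> \<open>One value of \<open>x\<close> that is admissible for all
    \<open>y \<le> 1 / 4\<close> at once.\<close>
  have small: "exp (-(1/4)) / 8 > (0::real)" "exp (-(1/4)) / 8 * exp y < (1 / 4 :: real)" if "y \<le> 1 / 4" for y :: real
  proof -
    have "exp (-(1/4)) * exp y \<le> (1 :: real)" using that by (simp flip: exp_add)
    moreover have "exp (-(1/4)) / 8 * exp y = exp (-(1/4)) * exp y / (8 :: real)" by simp
    ultimately show "exp (-(1/4)) / 8 * exp y < (1 / 4 :: real)" by linarith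
  qed simp
  have sums: "(\<lambda>m. A $ m * of_real y ^ m) sums (of_nat (Suc N) * of_real (parked_series y (Suc N)))"
    if "0 \<le> y" "y \<le> 1 / 4" for y :: real
  proof -
    have "(\<lambda>m. parked_weight (Suc N) m * y ^ m) sums parked_series y (Suc N)"
      by (rule has_sum_imp_sums[OF parked_series_has_sum[OF small(1)[OF that(2)] that(1) small(2)[OF that(2)]]])
    then have "(\<lambda>m. complex_of_real (parked_weight (Suc N) m * y ^ m)) sums of_real (parked_series y (Suc N))"
      by (simp only: sums_of_real_iff)
    from sums_mult[OF this, of "of_nat (Suc N)"] show ?thesis by (simp add: A_def mult.assoc)
  qed
  have "ereal (norm (complex_of_real (1 / 4))) \<le> fps_conv_radius A"
    unfolding fps_conv_radius_def using sums_summable[OF sums[of "1 / 4"]] by (intro conv_radius_geI) simp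
  then have "ereal (1 / 4) \<le> fps_conv_radius A" by simp
  then have "fps_conv_radius A > 0" by (rule less_le_trans[rotated]) simp
  moreover have "Bf has_fps_expansion B"
    unfolding Bf_def B_def
    by (intro has_fps_expansion_sum has_fps_expansion_add has_fps_expansion_cmult_left has_fps_expansion_fps_X_power)
  ultimately have "(\<lambda>z. eval_fps A z - Bf z) has_fps_expansion (A - B)"
    by (intro has_fps_expansion_diff eval_fps_has_fps_expansion)
  then have "A - B = 0"
  proof (rule has_fps_expansion_zero_on_reals)
    show "(0::real) < 1 / 4" by simp
    fix s :: real assume s: "0 < s" "s < 1 / 4"
    have "eval_fps A (of_real s) = of_nat (Suc N) * of_real (parked_series s (Suc N))"
      using sums[of s] s by (simp add: eval_fps_def sums_iff)
    also have "\<dots> = Bf (of_real s)"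
      using s by (subst parked_series_eq) (auto simp: Bf_def a_def b_def algebra_simps intro!: sum.cong)
    finally show "eval_fps A (of_real s) - Bf (of_real s) = 0" by simp
  qed
  then have "A $ m = B $ m" by simp
  also have "\<dots> = (\<Sum>k\<le>N. a k * (if m = Suc N - k then 1 else 0) + b k * (if m = N - k then 1 else 0))"
    by (simp add: B_def fps_sum_nth fps_X_power_nth)
  also have "\<dots> = (\<Sum>k\<le>N. (if k = Suc N - m \<and> m \<noteq> 0 then a k else 0) + (if k = N - m then b k else 0))"
    using assms by (intro sum.cong refl) auto
  also have "\<dots> = (if m = 0 then 0 else a (Suc N - m)) + b (N - m)"
    using assms by (auto simp: sum.distrib)
  finally have "A $ m = (if m = 0 then 0 else a (Suc N - m)) + b (N - m)" .
  then show ?thesis using assms by (simp add: A_def a_def b_def del: of_nat_Suc)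
qed

text \<open>Without cars the weights are the Catalan numbers.\<close>

lemma parked_weight_0: "real (Suc N) * parked_weight (Suc N) 0 = real ((2 * N) choose N)"
proof -
  have "((1 - fps_X) * park_fps N N) $ 0 = 1"
    by (simp add: park_fps_def fps_power_zeroth)
  then have "complex_of_real (real (Suc N) * parked_weight (Suc N) 0) = complex_of_real (real ((2 * N) choose N))"
    using parked_weight_coeff[of 0 N] by simp
  then show ?thesis by (simp only: of_real_eq_iff)
qed

text \<open>Both terms of \<open>parked_weight_coeff\<close> as one series. For
  \<open>k \<ge> 2\<close> the power of \<open>1 - fps_X\<close> absorbs the inverse square, so the
  function behind it is entire.\<close>

definition park_poly :: "nat \<Rightarrow> nat \<Rightarrow> complex fps" where
  "park_poly N k = fps_exp (of_nat N) * (1 - 2 * fps_X - fps_X\<^sup>2) * (1 + fps_X) ^ (2 * N - k) *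
     (1 - fps_X) ^ (k - 2) * (of_nat ((2 * N) choose k) * fps_X + of_nat ((2 * N) choose (k - 1)) * (1 + fps_X))"

lemma parked_weight_eq:
  assumes "1 \<le> m" "m < N"
  shows "of_nat (Suc N) * complex_of_real (parked_weight (Suc N) m) = park_poly N (Suc N - m) $ m"
proof -
  define k where "k = Suc N - m"
  have k: "2 \<le> k" "k \<le> N" "Suc N - m = k" "N - m = k - 1" using assms by (auto simp: k_def)
  define p where "p = (1 - fps_X :: complex fps)"
  define q where "q = (1 + fps_X :: complex fps)"
  define T where "T = fps_exp (of_nat N :: complex) * (1 - 2 * fps_X - fps_X\<^sup>2)"
  define R where "R = T * q ^ (2 * N - k) * p ^ (k - 2)"
  have inv: "inverse (p\<^sup>2) * p\<^sup>2 = 1"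
    by (rule inverse_mult_eq_1) (simp add: power2_eq_square p_def)
  obtain j where j: "k = j + 2" using k by (metis add.commute le_Suc_ex)
  have "park_fps N k = R * (inverse (p\<^sup>2) * p\<^sup>2)"
    unfolding park_fps_def R_def T_def[symmetric] p_def[symmetric] q_def[symmetric]
    by (simp add: j power_add power2_eq_square mult_ac)
  then have 1: "park_fps N k = R" by (simp add: inv)
  have j2: "2 * N - (k - 1) = Suc (2 * N - k)" using k by simp
  \<comment> \<open>Lowering the index trades a factor \<open>1 - fps_X\<close> for
    \<open>1 + fps_X\<close>, and the additional factor \<open>p\<close> restores the former. Hence
    both terms share \<open>R\<close>.\<close>
  have "p * park_fps N (k - 1) = R * q * (inverse (p\<^sup>2) * p\<^sup>2)"
    unfolding park_fps_def R_def T_def[symmetric] p_def[symmetric] q_def[symmetric] j2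
    by (simp add: j power2_eq_square mult_ac)
  then have 2: "(1 - fps_X) * park_fps N (k - 1) = R * (1 + fps_X)"
    by (simp only: inv mult_1_right) (simp only: p_def q_def)
  have X: "R $ (m - 1) = (R * fps_X) $ m" using assms by (simp add: fps_X_mult_right_nth)
  have "of_nat (Suc N) * complex_of_real (parked_weight (Suc N) m) =
      of_nat ((2 * N) choose k) * (R * fps_X) $ m + of_nat ((2 * N) choose (k - 1)) * (R * q) $ m"
    unfolding q_def using parked_weight_coeff[of m N] assms k unfolding k(3,4) 1 2 X by simp
  also have "\<dots> = park_poly N k $ m"
    unfolding park_poly_def T_def[symmetric] p_def[symmetric] q_def[symmetric] R_def[symmetric] distrib_left
    by (simp add: mult.left_commute[of R] fps_mult_of_nat_nth distrib_left)
  finally show ?thesis by (simp add: k_def)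
qed

section \<open>Coefficient asymptotics on the unit circle\<close>

lemma fps_coeff_integral:
  fixes h :: "complex \<Rightarrow> complex"
  assumes holo: "h holomorphic_on UNIV" and exp: "h has_fps_expansion F"
  shows "2 * pi * fps_nth F m = integral {0..2 * pi} (\<lambda>t. h (cis t) * cis (- (real m * t)))"
proof -
  have "((\<lambda>u. h u / (u - 0) ^ Suc m) has_contour_integral
      ((2 * pi * \<i>) / fact m * (deriv ^^ m) h 0)) (circlepath 0 1)"
    by (rule Cauchy_has_contour_integral_higher_derivative_circlepath)
       (use holo in \<open>auto intro: holomorphic_on_imp_continuous_on holomorphic_on_subset\<close>)
  then have "((\<lambda>t. h (0 + of_real 1 * cis t) / (0 + of_real 1 * cis t - 0) ^ Suc m * of_real 1 * \<i> * cis t)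
      has_integral ((2 * pi * \<i>) / fact m * (deriv ^^ m) h 0)) {0..2 * pi}"
    unfolding circlepath_def by (subst (asm) has_contour_integral_part_circlepath_iff) auto
  also have "(\<lambda>t. h (0 + of_real 1 * cis t) / (0 + of_real 1 * cis t - 0) ^ Suc m * of_real 1 * \<i> * cis t) =
      (\<lambda>t. \<i> * (h (cis t) * cis (- (real m * t))))"
    by (auto simp: fun_eq_iff Complex.DeMoivre cis_divide cis_mult divide_inverse cis_inverse algebra_simps)
  also have "(2 * pi * \<i>) / fact m * (deriv ^^ m) h 0 = \<i> * (2 * pi * fps_nth F m)"
    by (simp add: fps_nth_fps_expansion[OF exp])
  finally have "((\<lambda>t. \<i> * (h (cis t) * cis (- (real m * t)))) has_integral (\<i> * (2 * pi * fps_nth F m))) {0..2 * pi}" .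
  from has_integral_mult_right[OF this, of "- \<i>"]
  have "((\<lambda>t. h (cis t) * cis (- (real m * t))) has_integral (2 * pi * fps_nth F m)) {0..2 * pi}"
    by (simp add: mult.assoc[symmetric])
  then show ?thesis by (simp add: integral_unique)
qed

text \<open>The interval is centred at angle 0, where the saddle will lie. As
  \<open>cis (pi + t) = - cis t\<close>, the formula for \<open>h (- z)\<close> over
  \<open>{0..2 * pi}\<close> becomes one for \<open>h\<close> over \<open>{- pi..pi}\<close>, with
  the sign \<open>(-1) ^ m\<close> on both sides. The dilation anticipates
  \<open>c = sqrt n\<close>.\<close>

lemma fps_coeff_scaled_integral:
  fixes h :: "complex \<Rightarrow> complex"
  assumes holo: "h holomorphic_on UNIV" and exp: "h has_fps_expansion F" and c: "c > 0"
  shows "2 * pi * (c * fps_nth F m) =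
    (LINT x|lborel. indicator {- pi..pi} (x / c) *\<^sub>R (h (cis (x / c)) * cis (- (real m * (x / c)))))"
proof -
  define w where "w = (\<lambda>t. h (- cis t) * cis (- (real m * t)))"
  have neg: "(\<lambda>z. h (- z)) has_fps_expansion (F oo (- fps_X))"
  proof -
    have "(h \<circ> (\<lambda>z. - z)) has_fps_expansion (F oo (- fps_X))"
      by (rule has_fps_expansion_compose[OF exp has_fps_expansion_minus[OF has_fps_expansion_fps_X]]) simp
    then show ?thesis by (simp add: o_def)
  qed
  have cont: "continuous_on {0..2 * pi} w"
    unfolding w_def
    by (intro continuous_intros continuous_on_compose2[OF holomorphic_on_imp_continuous_on[OF holo]]) auto
  have "(\<lambda>z. h (- z)) holomorphic_on UNIV"
  proof -
    have "(h \<circ> (\<lambda>z. - z)) holomorphic_on UNIV"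
      by (rule holomorphic_on_compose[OF holomorphic_on_minus[OF holomorphic_on_ident] holomorphic_on_subset[OF holo]]) auto
    then show ?thesis by (simp add: o_def)
  qed
  from fps_coeff_integral[OF this neg, of m]
  have "2 * pi * ((-1) ^ m * fps_nth F m) = integral {0..2 * pi} w"
    by (simp add: w_def fps_compose_uminus')
  also have "\<dots> = (LINT t:{0..2 * pi}|lborel. w t)"
    using set_borel_integral_eq_integral(2)[OF borel_integrable_atLeastAtMost'[OF cont]] by simp
  also have "\<dots> = (LINT t|lborel. indicator {0..2 * pi} t *\<^sub>R w t)"
    by (simp add: set_lebesgue_integral_def)
  also have "\<dots> = \<bar>1 / c\<bar> *\<^sub>R (LINT x|lborel. indicator {0..2 * pi} (pi + 1 / c * x) *\<^sub>R w (pi + 1 / c * x))"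
    using c by (intro lborel_integral_real_affine) auto
  also have "(LINT x|lborel. indicator {0..2 * pi} (pi + 1 / c * x) *\<^sub>R w (pi + 1 / c * x)) =
    (LINT x|lborel. (-1) ^ m * (indicator {- pi..pi} (x / c) *\<^sub>R (h (cis (x / c)) * cis (- (real m * (x / c))))))"
  proof (intro Bochner_Integration.integral_cong refl)
    fix x :: real
    have "cis (- (real m * (pi + 1 / c * x))) = cis (- (real m * pi)) * cis (- (real m * (x / c)))"
      by (simp add: cis_mult algebra_simps)
    also have "cis (- (real m * pi)) = (cis (- pi)) ^ m" by (simp add: Complex.DeMoivre)
    also have "cis (- pi) = - 1" by (simp add: complex_eq_iff)
    finally have 1: "cis (- (real m * (pi + 1 / c * x))) = (-1) ^ m * cis (- (real m * (x / c)))" .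
    have 2: "- cis (pi + 1 / c * x) = cis (x / c)"
      by (simp add: cis_mult[symmetric])
    have 3: "(indicator {0..2 * pi} (pi + 1 / c * x) :: real) = indicator {- pi..pi} (x / c)"
      by (auto simp: indicator_def)
    show "indicator {0..2 * pi} (pi + 1 / c * x) *\<^sub>R w (pi + 1 / c * x) =
      (-1) ^ m * (indicator {- pi..pi} (x / c) *\<^sub>R (h (cis (x / c)) * cis (- (real m * (x / c)))))"
      unfolding w_def 1 2 3 by (simp add: scaleR_conv_of_real)
  qed
  also have "\<dots> = (-1) ^ m * (LINT x|lborel. indicator {- pi..pi} (x / c) *\<^sub>R (h (cis (x / c)) * cis (- (real m * (x / c)))))"
    by (rule integral_mult_right_zero)
  finally have "(-1) ^ m * (2 * pi * (c * fps_nth F m)) =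
      (-1) ^ m * (LINT x|lborel. indicator {- pi..pi} (x / c) *\<^sub>R (h (cis (x / c)) * cis (- (real m * (x / c)))))"
    using c by (simp add: scaleR_conv_of_real field_simps)
  then show ?thesis by simp
qed

lemma has_bochner_integral_gaussian:
  assumes "b > 0"
  shows "has_bochner_integral lborel (\<lambda>x. exp (- (b * x\<^sup>2))) (sqrt (pi / b))"
proof -
  define \<sigma> where "\<sigma> = 1 / sqrt (2 * b)"
  have s: "\<sigma> > 0" "\<sigma>\<^sup>2 = 1 / (2 * b)" using assms by (auto simp: \<sigma>_def power_divide)
  have "exp (- (b * x\<^sup>2)) = sqrt (pi / b) * normal_density 0 \<sigma> x" for x
    using assms by (simp add: normal_density_def s)
  moreover have "has_bochner_integral lborel (normal_density 0 \<sigma>) 1"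
    using s integral_normal_density[of \<sigma> 0] by (simp add: has_bochner_integral_iff)
  ultimately show ?thesis
    using has_bochner_integral_mult_right[of "sqrt (pi / b)" lborel "normal_density 0 \<sigma>" 1] by simp
qed

text \<open>Laplace's method on the unit circle, whose only saddle point is at 1.\<close>

lemma fps_coeff_asymptotics:
  fixes h :: "nat \<Rightarrow> complex \<Rightarrow> complex" and g :: complex
  assumes holo: "\<And>n. h n holomorphic_on UNIV" and exp: "\<And>n. h n has_fps_expansion F n"
    and bound: "eventually (\<lambda>n. \<forall>\<theta>. \<bar>\<theta>\<bar> \<le> pi \<longrightarrow> norm (h n (cis \<theta>)) \<le> B * exp (- (a * (real n * \<theta>\<^sup>2)))) sequentially"
    and lim: "\<And>x. (\<lambda>n. h n (cis (x / sqrt n)) * cis (- (real (m n) * (x / sqrt n)))) \<longlonglongrightarrow>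
        g * of_real (exp (- (b * x\<^sup>2)))"
    and a: "a > 0" and b: "b > 0"
  shows "(\<lambda>n. sqrt n * fps_nth (F n) (m n)) \<longlonglongrightarrow> g / of_real (2 * sqrt (pi * b))"
proof -
  define s where "s = (\<lambda>n x. indicator {- pi..pi} (x / sqrt n) *\<^sub>R
      (h n (cis (x / sqrt n)) * cis (- (real (m n) * (x / sqrt n)))))"
  obtain n0 where n0: "n0 \<ge> 1"
    "\<And>n \<theta>. n \<ge> n0 \<Longrightarrow> \<bar>\<theta>\<bar> \<le> pi \<Longrightarrow> norm (h n (cis \<theta>)) \<le> B * exp (- (a * (real n * \<theta>\<^sup>2)))"
  proof -
    obtain n1 where "\<forall>n\<ge>n1. \<forall>\<theta>. \<bar>\<theta>\<bar> \<le> pi \<longrightarrow> norm (h n (cis \<theta>)) \<le> B * exp (- (a * (real n * \<theta>\<^sup>2)))"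
      using bound unfolding eventually_sequentially by blast
    then show ?thesis using that[of "max 1 n1"] by simp
  qed
  have hcont: "continuous_on UNIV (h n)" for n
    using holo by (rule holomorphic_on_imp_continuous_on)
  have meas: "s n \<in> borel_measurable lborel" for n
  proof -
    have "(\<lambda>x. h n (cis (x / sqrt n)) * cis (- (real (m n) * (x / sqrt n)))) \<in> borel_measurable borel"
      unfolding divide_inverse
      by (intro borel_measurable_continuous_onI continuous_intros continuous_on_compose2[OF hcont]) auto
    then show ?thesis unfolding s_def by measurable
  qed
  have gauss: "has_bochner_integral lborel (\<lambda>x. g * of_real (exp (- (b * x\<^sup>2)))) (g * of_real (sqrt (pi / b)))"
    by (intro has_bochner_integral_mult_right has_bochner_integral_of_real has_bochner_integral_gaussian b)
  \<comment> \<open>The bound holds only from \<open>n0\<close> on, hence the shifted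
    sequence.\<close>
  have "(\<lambda>n. integral\<^sup>L lborel (s (n + n0))) \<longlonglongrightarrow> (LINT x|lborel. g * of_real (exp (- (b * x\<^sup>2))))"
  proof (rule integral_dominated_convergence[where w = "\<lambda>x. B * exp (- (a * x\<^sup>2))"])
    show "(\<lambda>x. g * of_real (exp (- (b * x\<^sup>2)))) \<in> borel_measurable lborel" by measurable
    show "s (n + n0) \<in> borel_measurable lborel" for n by (rule meas)
    show "integrable lborel (\<lambda>x. B * exp (- (a * x\<^sup>2)))"
      using has_bochner_integral_gaussian[OF a] by (intro integrable_mult_right) (auto simp: has_bochner_integral_iff)
    show "AE x in lborel. norm (s (n + n0) x) \<le> B * exp (- (a * x\<^sup>2))" for n
    proof (rule AE_I2)
      fix x :: real
      \<comment> \<open>The bound at angle 0 yields \<open>B \<ge> 0\<close>, which is required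
        where the indicator vanishes.\<close>
      have "norm (h n1 (cis 0)) \<le> B" if "n1 \<ge> n0" for n1 using n0(2)[OF that, of 0] by simp
      then have "B \<ge> 0" using norm_ge_zero order_trans by blast
      then show "norm (s (n + n0) x) \<le> B * exp (- (a * x\<^sup>2))"
        using n0(2)[of "n + n0" "x / sqrt (n + n0)"] n0(1)
        by (auto simp: s_def indicator_def norm_mult power_divide abs_le_iff)
    qed
    show "AE x in lborel. (\<lambda>n. s (n + n0) x) \<longlonglongrightarrow> g * of_real (exp (- (b * x\<^sup>2)))"
    proof (rule AE_I2)
      fix x :: real
      have "(\<lambda>n. x / sqrt n) \<longlonglongrightarrow> 0" by real_asymp
      then have "eventually (\<lambda>n. \<bar>x / sqrt n\<bar> < pi) sequentially"
        using order_tendstoD(2)[OF tendsto_rabs_zero, of _ sequentially pi] pi_gt_zero by blast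
      then have "eventually (\<lambda>n. h n (cis (x / sqrt n)) * cis (- (real (m n) * (x / sqrt n))) = s n x) sequentially"
      proof eventually_elim
        case (elim n)
        then have "x / sqrt n \<in> {- pi..pi}" unfolding atLeastAtMost_iff by linarith
        then show ?case by (simp add: s_def)
      qed
      from Lim_transform_eventually[OF lim[of x] this]
      show "(\<lambda>n. s (n + n0) x) \<longlonglongrightarrow> g * of_real (exp (- (b * x\<^sup>2)))"
        by (rule LIMSEQ_ignore_initial_segment)
    qed
  qed
  then have "(\<lambda>n. integral\<^sup>L lborel (s n)) \<longlonglongrightarrow> g * of_real (sqrt (pi / b))"
    unfolding has_bochner_integral_integral_eq[OF gauss] by (rule LIMSEQ_offset)
  moreover have "eventually (\<lambda>n. integral\<^sup>L lborel (s n) = 2 * pi * (sqrt n * fps_nth (F n) (m n))) sequentially"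
    using eventually_gt_at_top[of 0]
  proof eventually_elim
    case (elim n)
    then show ?case using fps_coeff_scaled_integral[OF holo exp, of "sqrt n" n "m n"] by (simp add: s_def)
  qed
  ultimately have "(\<lambda>n. 2 * pi * (sqrt n * fps_nth (F n) (m n))) \<longlonglongrightarrow> g * of_real (sqrt (pi / b))"
    by (rule Lim_transform_eventually)
  from tendsto_divide[OF this tendsto_const[of "of_real (2 * pi)"]]
  have "(\<lambda>n. sqrt n * fps_nth (F n) (m n)) \<longlonglongrightarrow> g * of_real (sqrt (pi / b)) / of_real (2 * pi)" by simp
  also have "g * of_real (sqrt (pi / b)) / of_real (2 * pi) = g * of_real (sqrt (pi / b) / (2 * pi))" by simp
  also have "sqrt (pi / b) / (2 * pi) = 1 / (2 * sqrt (pi * b))"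
    using b by (simp add: real_sqrt_divide real_sqrt_mult field_simps)
  finally show ?thesis by simp
qed

section \<open>Limits of the factors near the saddle\<close>

text \<open>\<open>Ln (1 + z) / z\<close> tends to 1 at 0; filling this removable singularity lets
  indices with \<open>w n = 0\<close> pass.\<close>

lemma power_one_plus_tendsto_exp:
  fixes w :: "nat \<Rightarrow> complex" and e :: "nat \<Rightarrow> nat"
  assumes w: "w \<longlonglongrightarrow> 0" and lim: "(\<lambda>n. of_nat (e n) * w n) \<longlonglongrightarrow> c"
  shows "(\<lambda>n. (1 + w n) ^ e n) \<longlonglongrightarrow> exp c"
proof -
  define L where "L = (\<lambda>z :: complex. if z = 0 then 1 else Ln (1 + z) / z)"
  have "(Ln has_field_derivative 1) (at 1)" using has_field_derivative_Ln[of 1] by simp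
  then have "((\<lambda>h. (Ln (1 + h) - Ln 1) / h) \<longlongrightarrow> 1) (at 0)" by (simp add: DERIV_def)
  then have "(L \<longlongrightarrow> 1) (at 0)"
    by (rule Lim_transform_eventually) (auto simp: L_def eventually_at_filter)
  then have "isCont L 0" by (simp add: isCont_def L_def)
  from isCont_tendsto_compose[OF this w] have "(\<lambda>n. L (w n)) \<longlonglongrightarrow> 1" by (simp add: L_def)
  from tendsto_exp[OF tendsto_mult[OF lim this]]
  have "(\<lambda>n. exp (of_nat (e n) * w n * L (w n))) \<longlonglongrightarrow> exp c" by simp
  moreover have "eventually (\<lambda>n. exp (of_nat (e n) * w n * L (w n)) = (1 + w n) ^ e n) sequentially"
  proof -
    have "eventually (\<lambda>n. norm (w n) < 1) sequentially"
      using order_tendstoD(2)[OF tendsto_norm_zero[OF w], of 1] by simp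
    then show ?thesis
    proof eventually_elim
      case (elim n)
      have nz: "1 + w n \<noteq> 0" using elim by (metis add_eq_0_iff norm_minus_cancel norm_one less_irrefl)
      have *: "of_nat (e n) * w n * L (w n) = of_nat (e n) * Ln (1 + w n)" by (simp add: L_def)
      show ?case unfolding * exp_of_nat_mult using nz by simp
    qed
  qed
  ultimately show ?thesis by (rule Lim_transform_eventually)
qed

lemma has_fps_expansion_quadratic_limit:
  fixes f :: "complex \<Rightarrow> complex"
  assumes "f has_fps_expansion F" "fps_nth F 0 = 0" "fps_nth F 1 = 0"
  shows "((\<lambda>z. f z / z\<^sup>2) \<longlongrightarrow> fps_nth F 2) (at 0)"
proof (cases "F = 0")
  case True
  then have "eventually (\<lambda>z. f z = 0) (at 0)"
    using assms(1) by (auto simp: has_fps_expansion_0_iff eventually_at_filter elim: eventually_mono)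
  then have "eventually (\<lambda>z. 0 = f z / z\<^sup>2) (at 0)" by eventually_elim simp
  then show ?thesis using True by (intro Lim_transform_eventually[OF tendsto_const]) auto
next
  case False
  have "2 \<le> subdegree F"
    using False by (intro subdegree_geI) (use assms less_2_cases in auto)
  from has_fps_expansion_shift[OF assms(1) this refl]
  have "isCont (\<lambda>x. if x = 0 then fps_nth F 2 else f x / x\<^sup>2) 0"
    using has_fps_expansion_imp_continuous by blast
  then have "((\<lambda>x. if x = 0 then fps_nth F 2 else f x / x\<^sup>2) \<longlongrightarrow> fps_nth F 2) (at 0)"
    by (simp add: isCont_def)
  then show ?thesis
    by (rule Lim_transform_eventually) (auto simp: eventually_at_filter)
qed

text \<open>At an argument of order \<open>1 / sqrt n\<close>, an exponent of order \<open>n\<close>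
  retains exactly the quadratic coefficient.\<close>

lemma quadratic_limit_sqrt:
  fixes f :: "complex \<Rightarrow> complex" and e :: "nat \<Rightarrow> nat"
  assumes "f has_fps_expansion F" "fps_nth F 0 = 0" "fps_nth F 1 = 0"
    and e: "(\<lambda>n. real (e n) / real n) \<longlonglongrightarrow> \<mu>"
  shows "(\<lambda>n. f (of_real (x / sqrt n))) \<longlonglongrightarrow> 0"
    and "(\<lambda>n. of_nat (e n) * f (of_real (x / sqrt n))) \<longlonglongrightarrow> of_real (\<mu> * x\<^sup>2) * fps_nth F 2"
proof -
  have "(\<lambda>n. x / sqrt n) \<longlonglongrightarrow> 0" by real_asymp
  from tendsto_of_real[OF this] have t0: "(\<lambda>n. complex_of_real (x / sqrt n)) \<longlonglongrightarrow> 0"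
    by (simp only: of_real_0)
  have f0: "f 0 = 0" using has_fps_expansion_imp_0_eq_fps_nth_0[OF assms(1)] assms(2) by simp
  have "isCont f 0" using has_fps_expansion_imp_continuous[OF assms(1)] by simp
  from isCont_tendsto_compose[OF this t0] f0 show "(\<lambda>n. f (of_real (x / sqrt n))) \<longlonglongrightarrow> 0" by simp
  show "(\<lambda>n. of_nat (e n) * f (of_real (x / sqrt n))) \<longlonglongrightarrow> of_real (\<mu> * x\<^sup>2) * fps_nth F 2"
  proof (cases "x = 0")
    case True
    then show ?thesis by (simp add: f0)
  next
    case False
    have "filterlim (\<lambda>n. complex_of_real (x / sqrt n)) (at 0) sequentially"
      unfolding filterlim_at using t0 False eventually_gt_at_top[of "0::nat"]
      by (auto elim: eventually_mono)
    from filterlim_compose[OF has_fps_expansion_quadratic_limit[OF assms(1-3)] this]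
    have "(\<lambda>n. f (of_real (x / sqrt n)) / (of_real (x / sqrt n))\<^sup>2) \<longlonglongrightarrow> fps_nth F 2" .
    from tendsto_mult[OF tendsto_of_real[OF tendsto_mult[OF e tendsto_const[of "x\<^sup>2"]]] this]
    have "(\<lambda>n. of_real (real (e n) / real n * x\<^sup>2) * (f (of_real (x / sqrt n)) / (of_real (x / sqrt n))\<^sup>2))
        \<longlonglongrightarrow> of_real (\<mu> * x\<^sup>2) * fps_nth F 2" .
    moreover have "eventually (\<lambda>n. of_real (real (e n) / real n * x\<^sup>2) * (f (of_real (x / sqrt n)) / (of_real (x / sqrt n))\<^sup>2) =
        of_nat (e n) * f (of_real (x / sqrt n))) sequentially"
      using eventually_gt_at_top[of "0::nat"]
    proof eventually_elim
      case (elim n)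
      have "(complex_of_real (x / sqrt n))\<^sup>2 = of_real (x\<^sup>2 / n)"
        using elim by (simp add: power_divide flip: of_real_power)
      then show ?case using elim False by (simp add: field_simps)
    qed
    ultimately show ?thesis by (rule Lim_transform_eventually)
  qed
qed

text \<open>The central limit theorem for Bernoulli characteristic functions, but for arbitrary real
  \<open>p\<close>: the argument is the expansion at 0. A negative \<open>p\<close> will represent
  the factor \<open>1 - u\<close>, with a negative variance \<open>p * (1 - p)\<close>.\<close>

lemma bernoulli_power_limit:
  fixes p :: real and e :: "nat \<Rightarrow> nat"
  assumes e: "(\<lambda>n. real (e n) / real n) \<longlonglongrightarrow> \<mu>"
  shows "(\<lambda>n. (of_real (1 - p) + of_real p * cis (x / sqrt n)) ^ e n * cis (- (real (e n) * p * (x / sqrt n))))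
     \<longlonglongrightarrow> of_real (exp (- (\<mu> * p * (1 - p) / 2 * x\<^sup>2)))"
proof -
  \<comment> \<open>Centering at the mean \<open>p\<close> makes the linear coefficient
    vanish.\<close>
  define f where "f = (\<lambda>z. of_real (1 - p) * exp ((- \<i> * p) * z) + of_real p * exp ((\<i> * (1 - p)) * z) - 1)"
  define F where "F = fps_const (of_real (1 - p)) * fps_exp (- \<i> * p) + fps_const (of_real p) * fps_exp (\<i> * (1 - p)) - 1"
  have fF: "f has_fps_expansion F"
    unfolding f_def F_def by (intro fps_expansion_intros)
  have F0: "fps_nth F 0 = 0" "fps_nth F 1 = 0" by (simp_all add: F_def algebra_simps)
  have F2: "fps_nth F 2 = of_real (- (p * (1 - p) / 2))"
    by (simp add: F_def power2_eq_square field_simps)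
  have eq: "(of_real (1 - p) + of_real p * cis t) ^ k * cis (- (real k * p * t)) = (1 + f (of_real t)) ^ k" for t k
  proof -
    have 1: "cis (- (real k * p * t)) = cis (- (p * t)) ^ k" by (simp add: Complex.DeMoivre algebra_simps)
    have 2: "(of_real (1 - p) + of_real p * cis t) * cis (- (p * t)) =
        of_real (1 - p) * cis (- (p * t)) + of_real p * cis ((1 - p) * t)"
      by (simp add: distrib_right mult.assoc cis_mult algebra_simps)
    have 3: "1 + f (of_real t) = of_real (1 - p) * cis (- (p * t)) + of_real p * cis ((1 - p) * t)"
      by (simp add: f_def cis_conv_exp algebra_simps)
    show ?thesis by (simp only: 1 2 3 power_mult_distrib[symmetric])
  qed
  show ?thesis
    unfolding eq using power_one_plus_tendsto_exp[OF quadratic_limit_sqrt[OF fF F0 e]]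
    by (simp add: F2 exp_of_real[symmetric] algebra_simps)
qed

lemma poisson_power_limit:
  fixes \<alpha> :: real and e :: "nat \<Rightarrow> nat"
  assumes e: "(\<lambda>n. real (e n) / real n) \<longlonglongrightarrow> \<mu>"
  shows "(\<lambda>n. exp (of_real (real (e n) * \<alpha>) * (cis (x / sqrt n) - 1)) * cis (- (real (e n) * \<alpha> * (x / sqrt n))))
     \<longlonglongrightarrow> of_real (exp (- (\<mu> * \<alpha> / 2 * x\<^sup>2)))"
proof -
  define f where "f = (\<lambda>z. of_real \<alpha> * (exp (\<i> * z) - 1 - \<i> * z))"
  define F where "F = fps_const (of_real \<alpha>) * (fps_exp \<i> - 1 - fps_const \<i> * fps_X)"
  have fF: "f has_fps_expansion F"
    unfolding f_def F_def by (intro fps_expansion_intros)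
  have F0: "fps_nth F 0 = 0" "fps_nth F 1 = 0" by (simp_all add: F_def)
  have F2: "fps_nth F 2 = of_real (- (\<alpha> / 2))"
    by (simp add: F_def power2_eq_square field_simps)
  have eq: "exp (of_real (real k * \<alpha>) * (cis t - 1)) * cis (- (real k * \<alpha> * t)) = exp (of_nat k * f (of_real t))" for t k
    by (simp add: f_def cis_conv_exp exp_add[symmetric] algebra_simps)
  show ?thesis
    unfolding eq using tendsto_exp[OF quadratic_limit_sqrt(2)[OF fF F0 e]]
    by (simp add: F2 exp_of_real[symmetric] algebra_simps)
qed

section \<open>Bounds away from the saddle\<close>

text \<open>The squared modulus is \<open>1 - 2 p (1 - p) (1 - cos t)\<close>, and
  \<open>1 + z \<le> exp z\<close> for every real \<open>z\<close>. Negative \<open>p\<close> is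
  thus covered as well, with a bound that is at least 1.\<close>

lemma norm_bernoulli_le:
  "norm (of_real (1 - p) + of_real p * cis t) ^ k \<le> exp (- (real k * (p * (1 - p)) * (1 - cos t)))"
proof -
  have "(norm (of_real (1 - p) + of_real p * cis t))\<^sup>2 = (1 - p + p * cos t)\<^sup>2 + (p * sin t)\<^sup>2"
    by (simp add: cmod_power2)
  also have "\<dots> = 1 + - (2 * (p * (1 - p)) * (1 - cos t))"
  proof -
    have "(1 - p + p * c)\<^sup>2 + (p * s)\<^sup>2 = (1 - p)\<^sup>2 + 2 * (1 - p) * p * c + p\<^sup>2 * (s\<^sup>2 + c\<^sup>2)"
      for c s :: real
      by (simp add: power2_eq_square algebra_simps)
    then have "(1 - p + p * cos t)\<^sup>2 + (p * sin t)\<^sup>2 =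
        (1 - p)\<^sup>2 + 2 * (1 - p) * p * cos t + p\<^sup>2 * ((sin t)\<^sup>2 + (cos t)\<^sup>2)" .
    also have "\<dots> = 1 + - (2 * (p * (1 - p)) * (1 - cos t))"
      unfolding sin_cos_squared_add by (simp add: power2_eq_square algebra_simps)
    finally show ?thesis .
  qed
  also have "\<dots> \<le> exp (- (2 * (p * (1 - p)) * (1 - cos t)))" by (rule exp_ge_add_one_self)
  also have "\<dots> = (exp (- ((p * (1 - p)) * (1 - cos t))))\<^sup>2"
    by (simp add: exp_double[symmetric] algebra_simps)
  finally have "norm (of_real (1 - p) + of_real p * cis t) \<le> exp (- ((p * (1 - p)) * (1 - cos t)))"
    by (rule power2_le_imp_le) simp
  then have "norm (of_real (1 - p) + of_real p * cis t) ^ k \<le> exp (- ((p * (1 - p)) * (1 - cos t))) ^ k"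
    by (rule power_mono) simp
  then show ?thesis by (simp add: exp_of_nat_mult[symmetric] algebra_simps)
qed

lemma norm_poisson:
  "norm (exp (of_real c * (cis t - 1))) = exp (- (c * (1 - cos t)))"
  by (simp add: algebra_simps)

text \<open>By the half-angle formula it suffices that \<open>sin x \<ge> x / 2\<close> for
  \<open>x\<close> up to \<open>8 / 5 > pi / 2\<close>. There \<open>x\<^sup>2 \<le> 3\<close>, so
  the cubic Taylor bound is enough.\<close>

lemma one_minus_cos_ge:
  assumes "\<bar>t\<bar> \<le> pi"
  shows "1 - cos t \<ge> t\<^sup>2 / 8"
proof -
  define x where "x = \<bar>t\<bar> / 2"
  have x: "0 \<le> x" "x \<le> 8 / 5" using assms pi_less_4 pi_approx by (auto simp: x_def)
  have "\<bar>sin x - (\<Sum>m<3. sin_coeff m * x ^ m)\<bar> \<le> inverse (fact 3) * \<bar>x\<bar> ^ 3"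
    by (rule Maclaurin_sin_bound)
  also have "(\<Sum>m<3. sin_coeff m * x ^ m) = x"
    by (simp add: eval_nat_numeral sin_coeff_def)
  finally have "\<bar>sin x - x\<bar> \<le> x ^ 3 / 6" using x by (simp add: fact_numeral)
  then have "sin x \<ge> x - x ^ 3 / 6" by linarith
  also have "x ^ 3 = x * x\<^sup>2" by (simp add: power3_eq_cube power2_eq_square)
  finally have "sin x \<ge> x - x * x\<^sup>2 / 6" .
  moreover have "x\<^sup>2 \<le> (8 / 5)\<^sup>2" using x by (intro power_mono) auto
  then have "x * x\<^sup>2 \<le> x * 3" using x by (intro mult_left_mono) (auto simp: power2_eq_square)
  ultimately have "sin x \<ge> x / 2" by linarith
  then have "(x / 2)\<^sup>2 \<le> (sin x)\<^sup>2" using x by (intro power_mono) auto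
  moreover have "cos t = 1 - 2 * (sin x)\<^sup>2"
    using cos_double_sin[of x] by (simp add: x_def abs_if split: if_splits)
  moreover have "t\<^sup>2 = 4 * x\<^sup>2" by (simp add: x_def power_divide)
  ultimately show ?thesis by (simp add: power_divide)
qed

text \<open>Disposes of the bounded gap between an integer index and the real mean at which the
  phase is centred.\<close>

lemma cis_bounded_over_sqrt:
  fixes \<delta> :: "nat \<Rightarrow> real"
  assumes "\<And>n. n \<ge> n0 \<Longrightarrow> \<bar>\<delta> n\<bar> \<le> C"
  shows "(\<lambda>n. cis (\<delta> n * (x / sqrt n))) \<longlonglongrightarrow> 1"
proof -
  have "(\<lambda>n. \<delta> n * (x / sqrt n)) \<longlonglongrightarrow> 0"
  proof (rule Lim_null_comparison)
    show "(\<lambda>n. C * \<bar>x / sqrt n\<bar>) \<longlonglongrightarrow> 0"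
    proof (rule tendsto_mult_right_zero, rule tendsto_rabs_zero)
      show "(\<lambda>n. x / sqrt n) \<longlonglongrightarrow> 0" by real_asymp
    qed
    show "eventually (\<lambda>n. norm (\<delta> n * (x / sqrt n)) \<le> C * \<bar>x / sqrt n\<bar>) sequentially"
      using eventually_ge_at_top[of n0]
      by eventually_elim (use assms in \<open>simp only: real_norm_def abs_mult, intro mult_right_mono, auto\<close>)
  qed
  note lim = this
  have cont: "isCont (\<lambda>t. exp (\<i> * complex_of_real t)) 0" by (intro continuous_intros)
  show ?thesis
    using isCont_tendsto_compose[OF cont lim] by (simp only: cis_conv_exp[symmetric] cis_zero)
qed

lemma cis_phase_cancel: "A * cis (- (c * t)) * cis ((c - k) * t) = A * cis (- (k * t))"
  by (simp add: mult.assoc cis_mult algebra_simps)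

lemma fps_linear_power_nth:
  "((fps_const q + fps_const p * fps_X) ^ M) $ k = of_nat (M choose k) * p ^ k * q ^ (M - k)" for p q :: complex
proof -
  have "(fps_const q + fps_const p * fps_X) ^ M = (\<Sum>j\<le>M. fps_const (of_nat (M choose j) * p ^ j * q ^ (M - j)) * fps_X ^ j)"
    by (subst add.commute, subst binomial_ring)
       (intro sum.cong refl, simp add: power_mult_distrib fps_of_nat[symmetric] mult_ac)
  then have "((fps_const q + fps_const p * fps_X) ^ M) $ k =
      (\<Sum>j\<le>M. if j = k then of_nat (M choose j) * p ^ j * q ^ (M - j) else 0)"
    by (simp add: fps_sum_nth fps_X_power_nth if_distrib cong: if_cong)
  then show ?thesis by (auto simp: binomial_eq_0)
qed

lemma exp_power2_bound:
  assumes "\<bar>\<theta>\<bar> \<le> pi" "d * real n \<le> E" "d \<ge> 0"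
  shows "exp (- (E * (1 - cos \<theta>))) \<le> exp (- (d / 8 * (real n * \<theta>\<^sup>2)))"
proof -
  have "(d * real n) * (\<theta>\<^sup>2 / 8) \<le> E * (1 - cos \<theta>)"
  proof (rule mult_mono)
    have "0 \<le> d * real n" using assms(3) by simp
    then show "0 \<le> E" using assms(2) by linarith
  qed (use assms(2) one_minus_cos_ge[OF assms(1)] in auto)
  then show ?thesis by simp
qed

section \<open>Local limit theorems in place of Stirling's formula\<close>

text \<open>De Moivre-Laplace at the mean: the weighted binomial coefficient is the coefficient of
  \<open>z ^ k n\<close> in \<open>((1 - p) + p z) ^ M n\<close>.\<close>

lemma binomial_asymptotics:
  fixes p :: real and M k :: "nat \<Rightarrow> nat"
  assumes p: "0 < p" "p < 1" and \<mu>: "\<mu> > 0" and M: "(\<lambda>n. real (M n) / real n) \<longlonglongrightarrow> \<mu>"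
    and k: "\<And>n. n \<ge> n0 \<Longrightarrow> \<bar>real (M n) * p - real (k n)\<bar> \<le> C"
  shows "(\<lambda>n. sqrt n * (real (M n choose k n) * p ^ k n * (1 - p) ^ (M n - k n)))
    \<longlonglongrightarrow> 1 / sqrt (2 * pi * \<mu> * p * (1 - p))"
proof -
  define h where "h = (\<lambda>n (z :: complex). (of_real (1 - p) + of_real p * z) ^ M n)"
  define F where "F = (\<lambda>n. (fps_const (complex_of_real (1 - p)) + fps_const (of_real p) * fps_X) ^ M n)"
  define b where "b = \<mu> * p * (1 - p) / 2"
  \<comment> \<open>Half of the limiting variance leaves room for the convergence of
    \<open>M n / n\<close>.\<close>
  define d where "d = \<mu> / 2 * (p * (1 - p))"
  have pp: "p * (1 - p) > 0" using p by simp
  have "(\<lambda>n. sqrt n * (F n $ k n)) \<longlonglongrightarrow> 1 / of_real (2 * sqrt (pi * b))"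
  proof (rule fps_coeff_asymptotics[of h])
    show "h n holomorphic_on UNIV" for n unfolding h_def by (intro holomorphic_intros)
    show "h n has_fps_expansion F n" for n
      unfolding h_def F_def
      by (intro fps_expansion_intros)
    have "eventually (\<lambda>n. real (M n) / real n > \<mu> / 2) sequentially"
      using order_tendstoD(1)[OF M, of "\<mu> / 2"] \<mu> by simp
    then show "eventually (\<lambda>n. \<forall>\<theta>. \<bar>\<theta>\<bar> \<le> pi \<longrightarrow>
        norm (h n (cis \<theta>)) \<le> 1 * exp (- (d / 8 * (real n * \<theta>\<^sup>2)))) sequentially"
      using eventually_gt_at_top[of 0]
    proof eventually_elim
      case (elim n)
      then have "\<mu> / 2 * real n \<le> real (M n)" by (simp add: field_simps)
      then have "\<mu> / 2 * real n * (p * (1 - p)) \<le> real (M n) * (p * (1 - p))"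
        using pp by (intro mult_right_mono) auto
      then have "d * real n \<le> real (M n) * (p * (1 - p))" by (simp add: d_def mult_ac)
      moreover have "d \<ge> 0" using \<mu> pp by (simp add: d_def)
      ultimately show ?case
        unfolding h_def norm_power mult_1
        by (intro allI impI order_trans[OF norm_bernoulli_le exp_power2_bound])
    qed
    fix x :: real
    have "(\<lambda>n. (of_real (1 - p) + of_real p * cis (x / sqrt n)) ^ M n * cis (- (real (M n) * p * (x / sqrt n))) *
        cis ((real (M n) * p - real (k n)) * (x / sqrt n))) \<longlonglongrightarrow> of_real (exp (- (\<mu> * p * (1 - p) / 2 * x\<^sup>2))) * 1"
      by (intro tendsto_mult bernoulli_power_limit M cis_bounded_over_sqrt[OF k])
    then show "(\<lambda>n. h n (cis (x / sqrt n)) * cis (- (real (k n) * (x / sqrt n)))) \<longlonglongrightarrow>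
        1 * of_real (exp (- (b * x\<^sup>2)))"
      unfolding cis_phase_cancel by (simp add: h_def b_def mult.assoc)
  qed (use \<mu> p in \<open>auto simp: b_def d_def\<close>)
  moreover have "F n $ k n = of_real (real (M n choose k n) * p ^ k n * (1 - p) ^ (M n - k n))" for n
    by (simp add: F_def fps_linear_power_nth del: fps_const_add fps_const_sub)
  ultimately have "(\<lambda>n. complex_of_real (sqrt n * (real (M n choose k n) * p ^ k n * (1 - p) ^ (M n - k n))))
      \<longlonglongrightarrow> of_real (1 / (2 * sqrt (pi * b)))" by simp
  then have "(\<lambda>n. sqrt n * (real (M n choose k n) * p ^ k n * (1 - p) ^ (M n - k n))) \<longlonglongrightarrow> 1 / (2 * sqrt (pi * b))"
    by (simp only: tendsto_of_real_iff)
  also have "2 * sqrt (pi * b) = sqrt (2 * pi * \<mu> * p * (1 - p))"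
  proof -
    have "2 * sqrt (pi * b) = sqrt (4 * (pi * b))" by (simp add: real_sqrt_mult)
    also have "4 * (pi * b) = 2 * pi * \<mu> * p * (1 - p)" by (simp add: b_def)
    finally show ?thesis .
  qed
  finally show ?thesis .
qed

text \<open>The analogue for the exponential series; it supplies the asymptotics of
  \<open>fact (m n)\<close>.\<close>

lemma poisson_asymptotics:
  fixes \<alpha> :: real and m :: "nat \<Rightarrow> nat"
  assumes \<alpha>: "\<alpha> > 0" and m: "\<And>n. n \<ge> n0 \<Longrightarrow> \<bar>real n * \<alpha> - real (m n)\<bar> \<le> C"
  shows "(\<lambda>n. sqrt n * (exp (- (real n * \<alpha>)) * (real n * \<alpha>) ^ m n / fact (m n))) \<longlonglongrightarrow> 1 / sqrt (2 * pi * \<alpha>)"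
proof -
  define h where "h = (\<lambda>n (z :: complex). exp (of_real (real n * \<alpha>) * (z - 1)))"
  define F where "F = (\<lambda>n. fps_const (exp (- complex_of_real (real n * \<alpha>))) * fps_exp (complex_of_real (real n * \<alpha>)))"
  have "(\<lambda>n. sqrt n * (F n $ m n)) \<longlonglongrightarrow> 1 / of_real (2 * sqrt (pi * (\<alpha> / 2)))"
  proof (rule fps_coeff_asymptotics[of h])
    show "h n holomorphic_on UNIV" for n unfolding h_def by (intro holomorphic_intros)
    show "h n has_fps_expansion F n" for n
    proof -
      have "(\<lambda>z. exp (- complex_of_real (real n * \<alpha>)) * exp (of_real (real n * \<alpha>) * z)) has_fps_expansion F n"
        unfolding F_def by (intro fps_expansion_intros)
      then show ?thesis by (simp add: h_def exp_add[symmetric] algebra_simps)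
    qed
    show "eventually (\<lambda>n. \<forall>\<theta>. \<bar>\<theta>\<bar> \<le> pi \<longrightarrow>
        norm (h n (cis \<theta>)) \<le> 1 * exp (- (\<alpha> / 8 * (real n * \<theta>\<^sup>2)))) sequentially"
      unfolding h_def norm_poisson mult_1
      by (intro always_eventually allI impI exp_power2_bound) (use \<alpha> in auto)
    fix x :: real
    have "(\<lambda>n. real n / real n) \<longlonglongrightarrow> 1" by real_asymp
    then have "(\<lambda>n. exp (of_real (real n * \<alpha>) * (cis (x / sqrt n) - 1)) * cis (- (real n * \<alpha> * (x / sqrt n))) *
        cis ((real n * \<alpha> - real (m n)) * (x / sqrt n))) \<longlonglongrightarrow> of_real (exp (- (1 * \<alpha> / 2 * x\<^sup>2))) * 1"
      by (intro tendsto_mult poisson_power_limit cis_bounded_over_sqrt[OF m])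
    then show "(\<lambda>n. h n (cis (x / sqrt n)) * cis (- (real (m n) * (x / sqrt n)))) \<longlonglongrightarrow>
        1 * of_real (exp (- (\<alpha> / 2 * x\<^sup>2)))"
      unfolding cis_phase_cancel by (simp add: h_def)
  qed (use \<alpha> in auto)
  moreover have "F n $ m n = of_real (exp (- (real n * \<alpha>)) * (real n * \<alpha>) ^ m n / fact (m n))" for n
    by (simp add: F_def exp_of_real[symmetric])
  ultimately have "(\<lambda>n. complex_of_real (sqrt n * (exp (- (real n * \<alpha>)) * (real n * \<alpha>) ^ m n / fact (m n))))
      \<longlonglongrightarrow> of_real (1 / (2 * sqrt (pi * (\<alpha> / 2))))" by simp
  then have "(\<lambda>n. sqrt n * (exp (- (real n * \<alpha>)) * (real n * \<alpha>) ^ m n / fact (m n))) \<longlonglongrightarrow> 1 / (2 * sqrt (pi * (\<alpha> / 2)))"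
    by (simp only: tendsto_of_real_iff)
  also have "2 * sqrt (pi * (\<alpha> / 2)) = sqrt (2 * pi * \<alpha>)"
  proof -
    have "2 * sqrt (pi * (\<alpha> / 2)) = sqrt (4 * (pi * (\<alpha> / 2)))" by (subst real_sqrt_mult[of 4]) simp
    then show ?thesis by (simp add: mult_ac)
  qed
  finally show ?thesis .
qed

section \<open>The limit of the parking probability\<close>

lemma park_poly_expansion:
  "(\<lambda>u. exp (of_nat N * u) * (1 - 2 * u - u\<^sup>2) * (1 + u) ^ (2 * N - k) * (1 - u) ^ (k - 2) *
     (of_nat ((2 * N) choose k) * u + of_nat ((2 * N) choose (k - 1)) * (1 + u))) has_fps_expansion park_poly N k"
proof -
  have n: "(\<lambda>u :: complex. of_nat j) has_fps_expansion of_nat j" for j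
    using has_fps_expansion_const[of "of_nat j :: complex"] by (simp add: fps_of_nat)
  show ?thesis
    unfolding park_poly_def power2_eq_square
    by (intro has_fps_expansion_mult has_fps_expansion_add has_fps_expansion_diff has_fps_expansion_power n
        has_fps_expansion_exp has_fps_expansion_fps_X has_fps_expansion_1 has_fps_expansion_numeral)
qed

section \<open>The saddle point at \<open>u = \<alpha>\<close>\<close>

text \<open>With \<open>n = Suc N\<close> this is the index \<open>Suc N - m\<close> of
  \<open>park_poly\<close> in \<open>parked_weight_eq\<close>.\<close>

definition free_spots :: "(nat \<Rightarrow> nat) \<Rightarrow> nat \<Rightarrow> nat" where
  "free_spots m n = n - m n"

definition plus_exponent :: "(nat \<Rightarrow> nat) \<Rightarrow> nat \<Rightarrow> nat" where
  "plus_exponent m n = 2 * (n - 1) - free_spots m n"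

definition minus_exponent :: "(nat \<Rightarrow> nat) \<Rightarrow> nat \<Rightarrow> nat" where
  "minus_exponent m n = free_spots m n - 2"

text \<open>The growing factors of \<open>park_poly\<close> at \<open>u = \<alpha>\<close>. Division
  by them leaves a function whose value at \<open>z = 1\<close> is a bounded amplitude.\<close>

definition saddle_scale :: "real \<Rightarrow> (nat \<Rightarrow> nat) \<Rightarrow> nat \<Rightarrow> real" where
  "saddle_scale \<alpha> m n = real ((2 * (n - 1)) choose free_spots m n) * exp (real (n - 1) * \<alpha>) *
     (1 + \<alpha>) ^ plus_exponent m n * (1 - \<alpha>) ^ minus_exponent m n"

context
  fixes \<alpha> :: real and m :: "nat \<Rightarrow> nat"
  assumes \<alpha>: "0 < \<alpha>" "\<alpha> < sqrt 2 - 1"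
    and m: "\<And>n. \<bar>real n * \<alpha> - real (m n)\<bar> \<le> 1"
begin

lemma subcritical_bounds: "\<alpha> < 1" "1 - 2 * \<alpha> - \<alpha>\<^sup>2 > 0"
proof -
  have "sqrt 2 < 2" by (rule real_less_lsqrt) auto
  then show "\<alpha> < 1" using \<alpha> by linarith
  have "(\<alpha> + 1)\<^sup>2 < (sqrt 2)\<^sup>2" using \<alpha> by (intro power_strict_mono) auto
  then show "1 - 2 * \<alpha> - \<alpha>\<^sup>2 > 0" by (simp add: power2_eq_square algebra_simps)
qed

lemma cars_ratio: "(\<lambda>n. real (m n) / real n) \<longlonglongrightarrow> \<alpha>"
proof (rule tendsto_sandwich)
  have 1: "\<alpha> - 1 / real n = (real n * \<alpha> - 1) / real n" "\<alpha> + 1 / real n = (real n * \<alpha> + 1) / real n"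
    if "n > 0" for n using that by (simp_all add: field_simps)
  have 2: "real n * \<alpha> - 1 \<le> real (m n)" "real (m n) \<le> real n * \<alpha> + 1" for n
    using m[of n] by linarith+
  show "eventually (\<lambda>n. \<alpha> - 1 / real n \<le> real (m n) / real n) sequentially"
    using eventually_gt_at_top[of 0] by eventually_elim (simp only: 1, intro divide_right_mono 2, simp)
  show "eventually (\<lambda>n. real (m n) / real n \<le> \<alpha> + 1 / real n) sequentially"
    using eventually_gt_at_top[of 0] by eventually_elim (simp only: 1, intro divide_right_mono 2, simp)
qed real_asymp+

lemma eventually_cars_small: "eventually (\<lambda>n. 1 \<le> m n \<and> m n + 5 \<le> n) sequentially"
proof -
  have "eventually (\<lambda>n. real n * \<alpha> \<ge> 2) sequentially" using \<alpha> by real_asymp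
  moreover have "eventually (\<lambda>n. real n * \<alpha> + 6 \<le> real n) sequentially"
    using subcritical_bounds(1) by real_asymp
  ultimately show ?thesis
  proof eventually_elim
    case (elim n)
    have "1 \<le> real (m n)" "real (m n) + 5 \<le> real n" using m[of n] elim by linarith+
    then show ?case by linarith
  qed
qed

lemma index_eqs:
  "eventually (\<lambda>n. real (free_spots m n) = real n - real (m n) \<and> real (plus_exponent m n) = real n + real (m n) - 2 \<and>
    real (minus_exponent m n) = real n - real (m n) - 2 \<and> real (n - 1) = real n - 1 \<and> 2 \<le> free_spots m n \<and> free_spots m n \<le> n - 1) sequentially"
  using eventually_cars_small by eventually_elim (auto simp: free_spots_def plus_exponent_def minus_exponent_def)

lemma index_ratios:
  "(\<lambda>n. real (n - 1) / real n) \<longlonglongrightarrow> 1" "(\<lambda>n. real (free_spots m n) / real n) \<longlonglongrightarrow> 1 - \<alpha>"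
  "(\<lambda>n. real (plus_exponent m n) / real n) \<longlonglongrightarrow> 1 + \<alpha>" "(\<lambda>n. real (minus_exponent m n) / real n) \<longlonglongrightarrow> 1 - \<alpha>"
proof -
  have c: "(\<lambda>n. c / real n) \<longlonglongrightarrow> 0" for c :: real by real_asymp
  have "(\<lambda>n. 1 - 1 / real n) \<longlonglongrightarrow> 1" using tendsto_diff[OF tendsto_const c] by simp
  then show "(\<lambda>n. real (n - 1) / real n) \<longlonglongrightarrow> 1"
  proof (rule Lim_transform_eventually)
    show "eventually (\<lambda>n. 1 - 1 / real n = real (n - 1) / real n) sequentially"
      using index_eqs eventually_gt_at_top[of 0] by eventually_elim (simp add: add_divide_distrib diff_divide_distrib)
  qed
  have "(\<lambda>n. 1 - real (m n) / real n) \<longlonglongrightarrow> 1 - \<alpha>" by (intro tendsto_intros cars_ratio)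
  then show "(\<lambda>n. real (free_spots m n) / real n) \<longlonglongrightarrow> 1 - \<alpha>"
  proof (rule Lim_transform_eventually)
    show "eventually (\<lambda>n. 1 - real (m n) / real n = real (free_spots m n) / real n) sequentially"
      using index_eqs eventually_gt_at_top[of 0] by eventually_elim (simp add: add_divide_distrib diff_divide_distrib)
  qed
  have "(\<lambda>n. 1 + real (m n) / real n - 2 / real n) \<longlonglongrightarrow> 1 + \<alpha>"
    using tendsto_diff[OF tendsto_add[OF tendsto_const cars_ratio] c] by simp
  then show "(\<lambda>n. real (plus_exponent m n) / real n) \<longlonglongrightarrow> 1 + \<alpha>"
  proof (rule Lim_transform_eventually)
    show "eventually (\<lambda>n. 1 + real (m n) / real n - 2 / real n = real (plus_exponent m n) / real n) sequentially"
      using index_eqs eventually_gt_at_top[of 0] by eventually_elim (simp add: add_divide_distrib diff_divide_distrib)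
  qed
  have "(\<lambda>n. 1 - real (m n) / real n - 2 / real n) \<longlonglongrightarrow> 1 - \<alpha>"
    using tendsto_diff[OF tendsto_diff[OF tendsto_const cars_ratio] c] by simp
  then show "(\<lambda>n. real (minus_exponent m n) / real n) \<longlonglongrightarrow> 1 - \<alpha>"
  proof (rule Lim_transform_eventually)
    show "eventually (\<lambda>n. 1 - real (m n) / real n - 2 / real n = real (minus_exponent m n) / real n) sequentially"
      using index_eqs eventually_gt_at_top[of 0] by eventually_elim (simp add: add_divide_distrib diff_divide_distrib)
  qed
qed

text \<open>With \<open>u = \<alpha> z\<close> the exponential and the powers of
  \<open>1 + u\<close> and \<open>1 - u\<close> become one Poisson and two Bernoulli factors. Their
  means per vertex, \<alpha>, \<alpha> and -\<alpha>, add up to \<alpha>, which matches the index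
  \<open>m n\<close>: this is the saddle point equation.\<close>

lemma park_poly_asymptotics:
  "(\<lambda>n. of_real (sqrt n) * (of_real (\<alpha> ^ m n / saddle_scale \<alpha> m n) * park_poly (n - 1) (free_spots m n) $ m n)) \<longlonglongrightarrow>
    complex_of_real (sqrt ((1 - 2 * \<alpha> - \<alpha>\<^sup>2) * (1 - \<alpha>\<^sup>2) / (2 * pi * \<alpha>)))"
proof -
  \<comment> \<open>Chosen so that \<open>1 + \<alpha> z = (1 + \<alpha>) ((1 - p1) + p1 z)\<close>
    and \<open>1 - \<alpha> z = (1 - \<alpha>) ((1 - p2) + p2 z)\<close>; in particular
    \<open>p2\<close> is negative.\<close>
  define p1 where "p1 = \<alpha> / (1 + \<alpha>)"
  define p2 where "p2 = - \<alpha> / (1 - \<alpha>)"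
  define P where "P = (\<lambda>n u. exp (of_nat (n - 1) * u) * (1 - 2 * u - u\<^sup>2) * (1 + u) ^ plus_exponent m n * (1 - u) ^ minus_exponent m n *
     (of_nat ((2 * (n - 1)) choose free_spots m n) * u + of_nat ((2 * (n - 1)) choose (free_spots m n - 1)) * (1 + u :: complex)))"
  define h where "h = (\<lambda>n z. of_real (1 / saddle_scale \<alpha> m n) * P n (of_real \<alpha> * z))"
  define F where "F = (\<lambda>n. fps_const (complex_of_real (1 / saddle_scale \<alpha> m n)) * (park_poly (n - 1) (free_spots m n) oo (fps_const (of_real \<alpha>) * fps_X)))"
  \<comment> \<open>The quotient of the two adjacent binomial coefficients in
    \<open>park_poly\<close>.\<close>
  define \<kappa> where "\<kappa> = (\<lambda>n. real (free_spots m n) / (real (plus_exponent m n) + 1))"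
  define A where "A = (\<lambda>n z. (1 - 2 * (of_real \<alpha> * z) - (of_real \<alpha> * z)\<^sup>2) *
     (of_real \<alpha> * z + of_real (\<kappa> n) * (1 + of_real \<alpha> * z :: complex)))"
  \<comment> \<open>The total variance; \<epsilon> will be its limit per vertex, and the negative
    share of \<open>p2\<close> is outweighed because
    \<open>1 - 2 * \<alpha> - \<alpha>\<^sup>2 > 0\<close>.\<close>
  define E where "E = (\<lambda>n. real (n - 1) * \<alpha> + real (plus_exponent m n) * (p1 * (1 - p1)) + real (minus_exponent m n) * (p2 * (1 - p2)))"
  define \<epsilon> where "\<epsilon> = \<alpha> * (1 - 2 * \<alpha> - \<alpha>\<^sup>2) / (1 - \<alpha>\<^sup>2)"
  have a2: "1 - \<alpha>\<^sup>2 > 0" using \<alpha>(1) subcritical_bounds by (simp add: power_less_one_iff abs_square_less_1)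
  have \<epsilon>: "\<epsilon> > 0" using \<alpha>(1) subcritical_bounds a2 by (simp add: \<epsilon>_def)
  have p1: "p1 * (1 - p1) = \<alpha> / (1 + \<alpha>)\<^sup>2"
    using \<alpha>(1) by (simp add: p1_def field_simps power2_eq_square)
  have p2: "p2 * (1 - p2) = - \<alpha> / (1 - \<alpha>)\<^sup>2"
    using subcritical_bounds by (simp add: p2_def field_simps power2_eq_square)
  have sum_\<epsilon>: "\<alpha> + (1 + \<alpha>) * (p1 * (1 - p1)) + (1 - \<alpha>) * (p2 * (1 - p2)) = \<epsilon>"
  proof -
    have "(1 + \<alpha>) * (p1 * (1 - p1)) = \<alpha> / (1 + \<alpha>)" "(1 - \<alpha>) * (p2 * (1 - p2)) = - \<alpha> / (1 - \<alpha>)"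
      unfolding p1 p2 using \<alpha>(1) subcritical_bounds by (simp_all add: power2_eq_square)
    moreover have "\<alpha> + \<alpha> / (1 + \<alpha>) + - \<alpha> / (1 - \<alpha>) = \<epsilon>"
    proof -
      have "1 - \<alpha>\<^sup>2 = (1 + \<alpha>) * (1 - \<alpha>)" by (simp add: power2_eq_square algebra_simps)
      then show ?thesis unfolding \<epsilon>_def using \<alpha>(1) subcritical_bounds
        by (simp add: field_simps) (simp add: power2_eq_square algebra_simps)?
    qed
    ultimately show ?thesis by simp
  qed
  have h_eq: "eventually (\<lambda>n. \<forall>z. h n z = exp (of_real (real (n - 1) * \<alpha>) * (z - 1)) *
      (of_real (1 - p1) + of_real p1 * z) ^ plus_exponent m n * (of_real (1 - p2) + of_real p2 * z) ^ minus_exponent m n * A n z) sequentially"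
    using index_eqs
  proof eventually_elim
    case (elim n)
    show ?case
    proof
      fix z :: complex
      let ?u = "of_real \<alpha> * z"
      define C where "C = real ((2 * (n - 1)) choose free_spots m n)"
      have C: "C > 0" using elim by (simp add: C_def)
      have "Suc (free_spots m n - 1) * ((2 * (n - 1)) choose Suc (free_spots m n - 1)) = (2 * (n - 1) - (free_spots m n - 1)) * ((2 * (n - 1)) choose (free_spots m n - 1))"
        by (simp only: binomial_absorption binomial_absorb_comp)
      moreover have "Suc (free_spots m n - 1) = free_spots m n" "2 * (n - 1) - (free_spots m n - 1) = plus_exponent m n + 1"
        using elim by (auto simp: plus_exponent_def)
      ultimately have "free_spots m n * ((2 * (n - 1)) choose free_spots m n) = (plus_exponent m n + 1) * ((2 * (n - 1)) choose (free_spots m n - 1))"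
        by metis
      from arg_cong[OF this, of real]
      have "real (free_spots m n) * C = (real (plus_exponent m n) + 1) * real ((2 * (n - 1)) choose (free_spots m n - 1))"
        unfolding C_def by (simp only: of_nat_mult of_nat_add of_nat_1)
      then have C': "real ((2 * (n - 1)) choose (free_spots m n - 1)) = C * \<kappa> n"
        by (simp add: \<kappa>_def field_simps)
      have c1: "complex_of_nat ((2 * (n - 1)) choose free_spots m n) = of_real C" by (simp add: C_def)
      have c2: "complex_of_nat ((2 * (n - 1)) choose (free_spots m n - 1)) = of_real (C * \<kappa> n)"
        unfolding C'[symmetric] by simp
      have e: "exp (of_nat (n - 1) * ?u) = of_real (exp (real (n - 1) * \<alpha>)) * exp (of_real (real (n - 1) * \<alpha>) * (z - 1))"
        by (simp add: exp_of_real[symmetric] exp_add[symmetric] algebra_simps)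
      have b: "1 + ?u = of_real (1 + \<alpha>) * (of_real (1 - p1) + of_real p1 * z)"
      proof -
        have "(1 + \<alpha>) * (1 - p1) = 1" "(1 + \<alpha>) * p1 = \<alpha>" using \<alpha>(1) by (simp_all add: p1_def field_simps)
        then show ?thesis by (metis (no_types) distrib_left mult.assoc of_real_1 of_real_mult)
      qed
      have c: "1 - ?u = of_real (1 - \<alpha>) * (of_real (1 - p2) + of_real p2 * z)"
      proof -
        have "(1 - \<alpha>) * (1 - p2) = 1" "(1 - \<alpha>) * p2 = - \<alpha>" using subcritical_bounds by (simp_all add: p2_def field_simps)
        then have "of_real (1 - \<alpha>) * (of_real (1 - p2) + of_real p2 * z) = 1 + of_real (- \<alpha>) * z"
          by (metis (no_types) distrib_left mult.assoc of_real_1 of_real_mult)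
        then show ?thesis by simp
      qed
      have amp: "of_real C * ?u + of_real (C * \<kappa> n) * (1 + ?u) = of_real C * (?u + of_real (\<kappa> n) * (1 + ?u))"
        by (simp add: algebra_simps)
      have "P n ?u = of_real C * of_real (exp (real (n - 1) * \<alpha>)) * of_real (1 + \<alpha>) ^ plus_exponent m n * of_real (1 - \<alpha>) ^ minus_exponent m n *
         (exp (of_real (real (n - 1) * \<alpha>) * (z - 1)) *
         (of_real (1 - p1) + of_real p1 * z) ^ plus_exponent m n * (of_real (1 - p2) + of_real p2 * z) ^ minus_exponent m n * A n z)"
        unfolding P_def c1 c2 A_def amp
        unfolding e b c power_mult_distrib by (simp only: mult_ac)
      also have "of_real C * of_real (exp (real (n - 1) * \<alpha>)) * of_real (1 + \<alpha>) ^ plus_exponent m n * of_real (1 - \<alpha>) ^ minus_exponent m n = complex_of_real (saddle_scale \<alpha> m n)"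
        by (simp add: saddle_scale_def C_def)
      finally have "P n ?u = of_real (saddle_scale \<alpha> m n) * (exp (of_real (real (n - 1) * \<alpha>) * (z - 1)) *
         (of_real (1 - p1) + of_real p1 * z) ^ plus_exponent m n * (of_real (1 - p2) + of_real p2 * z) ^ minus_exponent m n * A n z)" .
      moreover have "saddle_scale \<alpha> m n > 0" using C \<alpha>(1) subcritical_bounds unfolding saddle_scale_def C_def[symmetric] by simp
      ultimately show "h n z = exp (of_real (real (n - 1) * \<alpha>) * (z - 1)) *
      (of_real (1 - p1) + of_real p1 * z) ^ plus_exponent m n * (of_real (1 - p2) + of_real p2 * z) ^ minus_exponent m n * A n z"
        by (simp add: h_def)
    qed
  qed
  have \<kappa>_lim: "\<kappa> \<longlonglongrightarrow> (1 - \<alpha>) / (1 + \<alpha>)"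
  proof -
    have "(\<lambda>n. (real (free_spots m n) / real n) / (real (plus_exponent m n) / real n + 1 / real n)) \<longlonglongrightarrow> (1 - \<alpha>) / (1 + \<alpha> + 0)"
      using \<alpha>(1) by (intro tendsto_divide index_ratios tendsto_add) (real_asymp | simp)+
    then have "(\<lambda>n. (real (free_spots m n) / real n) / (real (plus_exponent m n) / real n + 1 / real n)) \<longlonglongrightarrow> (1 - \<alpha>) / (1 + \<alpha>)" by simp
    then show ?thesis
    proof (rule Lim_transform_eventually)
      show "eventually (\<lambda>n. (real (free_spots m n) / real n) / (real (plus_exponent m n) / real n + 1 / real n) = \<kappa> n) sequentially"
        using eventually_gt_at_top[of 0]
        by eventually_elim (simp add: \<kappa>_def add_divide_distrib[symmetric])
    qed
  qed
  have \<kappa>1: "eventually (\<lambda>n. \<kappa> n < 1) sequentially"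
    using order_tendstoD(2)[OF \<kappa>_lim, of 1] \<alpha>(1) by simp
  have E_lim: "(\<lambda>n. E n / real n) \<longlonglongrightarrow> \<epsilon>"
  proof -
    have "(\<lambda>n. real (n - 1) / real n * \<alpha> + real (plus_exponent m n) / real n * (p1 * (1 - p1)) + real (minus_exponent m n) / real n * (p2 * (1 - p2)))
      \<longlonglongrightarrow> 1 * \<alpha> + (1 + \<alpha>) * (p1 * (1 - p1)) + (1 - \<alpha>) * (p2 * (1 - p2))"
      by (intro tendsto_intros index_ratios)
    then show ?thesis by (simp add: sum_\<epsilon> E_def add_divide_distrib)
  qed
  have "(\<lambda>n. of_real (sqrt n) * (F n $ m n)) \<longlonglongrightarrow> of_real (1 - 2 * \<alpha> - \<alpha>\<^sup>2) / of_real (2 * sqrt (pi * (\<epsilon> / 2)))"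
  proof (rule fps_coeff_asymptotics[of h])
    show "h n holomorphic_on UNIV" for n
      unfolding h_def P_def by (intro holomorphic_intros)
    show "h n has_fps_expansion F n" for n
    proof -
      have "P n has_fps_expansion park_poly (n - 1) (free_spots m n)"
        unfolding P_def plus_exponent_def minus_exponent_def by (rule park_poly_expansion)
      from has_fps_expansion_compose[OF this has_fps_expansion_cmult_left[OF has_fps_expansion_fps_X], of "of_real \<alpha>"]
      have "(\<lambda>z. P n (of_real \<alpha> * z)) has_fps_expansion (park_poly (n - 1) (free_spots m n) oo (fps_const (of_real \<alpha>) * fps_X))"
        by (simp add: o_def)
      then show ?thesis unfolding h_def F_def by (rule has_fps_expansion_cmult_left)
    qed
    have E: "eventually (\<lambda>n. E n / real n > \<epsilon> / 2) sequentially"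
      using order_tendstoD(1)[OF E_lim, of "\<epsilon> / 2"] \<epsilon> by simp
    \<comment> \<open>The constant 12 bounds the amplitude: its factors are at most 4 and 3 when
      \<open>u\<close> and \<kappa> have modulus at most 1.\<close>
    show "eventually (\<lambda>n. \<forall>\<theta>. \<bar>\<theta>\<bar> \<le> pi \<longrightarrow>
        norm (h n (cis \<theta>)) \<le> 12 * exp (- (\<epsilon> / 2 / 8 * (real n * \<theta>\<^sup>2)))) sequentially"
      using E h_eq \<kappa>1 eventually_gt_at_top[of 0]
    proof eventually_elim
      case (elim n)
      show ?case
      proof (intro allI impI)
        fix \<theta> :: real assume \<theta>: "\<bar>\<theta>\<bar> \<le> pi"
        have \<alpha>1: "\<bar>\<alpha>\<bar> \<le> 1" using \<alpha>(1) subcritical_bounds by simp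
        have u: "norm (of_real \<alpha> * cis \<theta>) \<le> 1" using \<alpha>1 by (simp add: norm_mult)
        have "norm (1 - 2 * (of_real \<alpha> * cis \<theta>) - (of_real \<alpha> * cis \<theta>)\<^sup>2) \<le> 1 + 2 * norm (of_real \<alpha> * cis \<theta>) + norm (of_real \<alpha> * cis \<theta>) ^ 2"
          by (intro order_trans[OF norm_triangle_ineq4] add_mono) (simp_all add: norm_mult norm_power)
        also have "\<dots> \<le> 1 + 2 * 1 + 1 ^ 2" using u by (intro add_mono mult_left_mono power_mono) auto
        finally have A1: "norm (1 - 2 * (of_real \<alpha> * cis \<theta>) - (of_real \<alpha> * cis \<theta>)\<^sup>2) \<le> 4" by simp
        have \<kappa>0: "\<bar>\<kappa> n\<bar> \<le> 1" using elim by (simp add: \<kappa>_def)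
        have "norm (of_real \<alpha> * cis \<theta> + of_real (\<kappa> n) * (1 + of_real \<alpha> * cis \<theta>)) \<le>
            norm (of_real \<alpha> * cis \<theta>) + \<bar>\<kappa> n\<bar> * (norm (1 :: complex) + norm (of_real \<alpha> * cis \<theta>))"
          by (intro order_trans[OF norm_triangle_ineq] add_mono order_refl)
             (simp add: norm_mult del: norm_cis, intro mult_left_mono order_trans[OF norm_triangle_ineq], simp_all add: norm_mult)
        also have "\<dots> \<le> 1 + 1 * (1 + 1)" using u \<kappa>0 by (intro add_mono mult_mono) auto
        finally have A2: "norm (of_real \<alpha> * cis \<theta> + of_real (\<kappa> n) * (1 + of_real \<alpha> * cis \<theta>)) \<le> 3" by simp
        have "norm (A n (cis \<theta>)) \<le> 4 * 3"
          unfolding A_def norm_mult[of "1 - 2 * (of_real \<alpha> * cis \<theta>) - (of_real \<alpha> * cis \<theta>)\<^sup>2"]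
          by (intro mult_mono A1 A2) auto
        then have A: "norm (A n (cis \<theta>)) \<le> 12" by simp
        have "norm (h n (cis \<theta>)) = exp (- (real (n - 1) * \<alpha> * (1 - cos \<theta>))) *
            norm (of_real (1 - p1) + of_real p1 * cis \<theta>) ^ plus_exponent m n *
            norm (of_real (1 - p2) + of_real p2 * cis \<theta>) ^ minus_exponent m n * norm (A n (cis \<theta>))"
          using elim(2) by (simp only: norm_mult norm_poisson norm_power)
        also have "\<dots> \<le> exp (- (real (n - 1) * \<alpha> * (1 - cos \<theta>))) *
            exp (- (real (plus_exponent m n) * (p1 * (1 - p1)) * (1 - cos \<theta>))) *
            exp (- (real (minus_exponent m n) * (p2 * (1 - p2)) * (1 - cos \<theta>))) * 12"
          by (intro mult_mono norm_bernoulli_le A order_refl) auto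
        \<comment> \<open>The bound for the factor of \<open>p2\<close> grows with \<theta>. This is
          harmless, as all three exponents are multiples of \<open>1 - cos \<theta>\<close> and only
          their sum matters.\<close>
        also have "\<dots> = 12 * exp (- (E n * (1 - cos \<theta>)))"
          by (simp add: E_def exp_add[symmetric] algebra_simps)
        also have "\<dots> \<le> 12 * exp (- (\<epsilon> / 2 / 8 * (real n * \<theta>\<^sup>2)))"
          using elim \<epsilon> by (intro mult_left_mono exp_power2_bound[OF \<theta>]) (auto simp: field_simps)
        finally show "norm (h n (cis \<theta>)) \<le> 12 * exp (- (\<epsilon> / 2 / 8 * (real n * \<theta>\<^sup>2)))" .
      qed
    qed
    fix x :: real
    \<comment> \<open>The gap between the total mean and \<open>m n\<close>. The leading terms
      cancel by the choice of \<open>p1\<close> and \<open>p2\<close>, so only rounding and the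
      shifts of the exponents remain.\<close>
    define \<delta> where "\<delta> = (\<lambda>n. real (n - 1) * \<alpha> + real (plus_exponent m n) * p1 + real (minus_exponent m n) * p2 - real (m n))"
    obtain n0 where n0: "\<And>n. n \<ge> n0 \<Longrightarrow> real (free_spots m n) = real n - real (m n) \<and> real (plus_exponent m n) = real n + real (m n) - 2 \<and>
      real (minus_exponent m n) = real n - real (m n) - 2 \<and> real (n - 1) = real n - 1 \<and> 2 \<le> free_spots m n \<and> free_spots m n \<le> n - 1"
      using index_eqs unfolding eventually_sequentially by blast
    have phase: "\<bar>\<delta> n\<bar> \<le> \<bar>\<alpha>\<bar> + 3 * \<bar>p1\<bar> + 3 * \<bar>p2\<bar> + 1" if "n \<ge> n0" for n
    proof -
      define d where "d = real n * \<alpha> - real (m n)"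
      have d: "\<bar>d\<bar> \<le> 1" using m by (simp add: d_def)
      have p: "(1 + \<alpha>) * p1 = \<alpha>" "(1 - \<alpha>) * p2 = - \<alpha>"
        using \<alpha>(1) subcritical_bounds by (simp_all add: p1_def p2_def)
      have "\<delta> n = - \<alpha> + (real n * ((1 + \<alpha>) * p1) - (d + 2) * p1) + (real n * ((1 - \<alpha>) * p2) + (d - 2) * p2) + (real n * \<alpha> - real (m n))"
      proof -
        have idx: "real (plus_exponent m n) = real n + real (m n) - 2" "real (minus_exponent m n) = real n - real (m n) - 2"
          "real (n - 1) = real n - 1" using n0[OF that] by blast+
        show ?thesis unfolding \<delta>_def d_def idx by (simp add: algebra_simps)
      qed
      also have "\<dots> = - \<alpha> - (d + 2) * p1 + (d - 2) * p2 + d"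
        unfolding p by (simp add: d_def)
      also have "\<bar>\<dots>\<bar> \<le> \<bar>\<alpha>\<bar> + \<bar>(d + 2) * p1\<bar> + \<bar>(d - 2) * p2\<bar> + \<bar>d\<bar>" by linarith
      also have "\<bar>(d + 2) * p1\<bar> \<le> 3 * \<bar>p1\<bar>" unfolding abs_mult using d by (intro mult_right_mono) auto
      also have "\<bar>(d - 2) * p2\<bar> \<le> 3 * \<bar>p2\<bar>" unfolding abs_mult using d by (intro mult_right_mono) auto
      finally show ?thesis using d by linarith
    qed
    have A_lim: "(\<lambda>n. A n (cis (x / sqrt n))) \<longlonglongrightarrow> of_real (1 - 2 * \<alpha> - \<alpha>\<^sup>2)"
    proof -
      have c: "(\<lambda>n. cis (x / sqrt n)) \<longlonglongrightarrow> 1"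
        using cis_bounded_over_sqrt[of 0 "\<lambda>_. 1" 1 x] by simp
      have "(\<lambda>n. A n (cis (x / sqrt n))) \<longlonglongrightarrow> (1 - 2 * (of_real \<alpha> * 1) - (of_real \<alpha> * 1)\<^sup>2) *
        (of_real \<alpha> * 1 + of_real ((1 - \<alpha>) / (1 + \<alpha>)) * (1 + of_real \<alpha> * 1))"
        unfolding A_def by (intro tendsto_intros c \<kappa>_lim)
      also have "of_real \<alpha> * 1 + of_real ((1 - \<alpha>) / (1 + \<alpha>)) * (1 + of_real \<alpha> * 1) = complex_of_real (\<alpha> + (1 - \<alpha>) / (1 + \<alpha>) * (1 + \<alpha>))"
        by (simp only: of_real_add of_real_mult of_real_1 mult_1_right)
      \<comment> \<open>With the limit of \<kappa>, the second factor of the amplitude tends to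
        exactly 1.\<close>
      also have "\<alpha> + (1 - \<alpha>) / (1 + \<alpha>) * (1 + \<alpha>) = 1" using \<alpha>(1) by simp
      finally show ?thesis by simp
    qed
    have "(\<lambda>n. (exp (of_real (real (n - 1) * \<alpha>) * (cis (x / sqrt n) - 1)) * cis (- (real (n - 1) * \<alpha> * (x / sqrt n)))) *
        ((of_real (1 - p1) + of_real p1 * cis (x / sqrt n)) ^ plus_exponent m n * cis (- (real (plus_exponent m n) * p1 * (x / sqrt n)))) *
        ((of_real (1 - p2) + of_real p2 * cis (x / sqrt n)) ^ minus_exponent m n * cis (- (real (minus_exponent m n) * p2 * (x / sqrt n)))) *
        A n (cis (x / sqrt n)) * cis (\<delta> n * (x / sqrt n))) \<longlonglongrightarrow>
        of_real (exp (- (1 * \<alpha> / 2 * x\<^sup>2))) * of_real (exp (- ((1 + \<alpha>) * p1 * (1 - p1) / 2 * x\<^sup>2))) *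
        of_real (exp (- ((1 - \<alpha>) * p2 * (1 - p2) / 2 * x\<^sup>2))) * of_real (1 - 2 * \<alpha> - \<alpha>\<^sup>2) * 1"
      by (intro tendsto_mult poisson_power_limit bernoulli_power_limit index_ratios A_lim cis_bounded_over_sqrt[OF phase])
    also have "of_real (exp (- (1 * \<alpha> / 2 * x\<^sup>2))) * of_real (exp (- ((1 + \<alpha>) * p1 * (1 - p1) / 2 * x\<^sup>2))) *
        of_real (exp (- ((1 - \<alpha>) * p2 * (1 - p2) / 2 * x\<^sup>2))) * of_real (1 - 2 * \<alpha> - \<alpha>\<^sup>2) * 1 =
        of_real (1 - 2 * \<alpha> - \<alpha>\<^sup>2) * complex_of_real (exp (- (\<epsilon> / 2 * x\<^sup>2)))"
    proof -
      have "exp (- (1 * \<alpha> / 2 * x\<^sup>2)) * exp (- ((1 + \<alpha>) * p1 * (1 - p1) / 2 * x\<^sup>2)) * exp (- ((1 - \<alpha>) * p2 * (1 - p2) / 2 * x\<^sup>2)) =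
          exp (- ((\<alpha> + (1 + \<alpha>) * (p1 * (1 - p1)) + (1 - \<alpha>) * (p2 * (1 - p2))) / 2 * x\<^sup>2))"
        by (simp add: exp_add[symmetric] field_simps)
      then show ?thesis unfolding sum_\<epsilon> by (metis (no_types) mult.commute mult.right_neutral of_real_mult)
    qed
    finally show "(\<lambda>n. h n (cis (x / sqrt n)) * cis (- (real (m n) * (x / sqrt n)))) \<longlonglongrightarrow>
        of_real (1 - 2 * \<alpha> - \<alpha>\<^sup>2) * of_real (exp (- (\<epsilon> / 2 * x\<^sup>2)))"
    proof (rule Lim_transform_eventually)
      show "eventually (\<lambda>n. (exp (of_real (real (n - 1) * \<alpha>) * (cis (x / sqrt n) - 1)) * cis (- (real (n - 1) * \<alpha> * (x / sqrt n)))) *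
        ((of_real (1 - p1) + of_real p1 * cis (x / sqrt n)) ^ plus_exponent m n * cis (- (real (plus_exponent m n) * p1 * (x / sqrt n)))) *
        ((of_real (1 - p2) + of_real p2 * cis (x / sqrt n)) ^ minus_exponent m n * cis (- (real (minus_exponent m n) * p2 * (x / sqrt n)))) *
        A n (cis (x / sqrt n)) * cis (\<delta> n * (x / sqrt n)) =
        h n (cis (x / sqrt n)) * cis (- (real (m n) * (x / sqrt n)))) sequentially"
        using h_eq
      proof eventually_elim
        case (elim n)
        define t where "t = x / sqrt n"
        have "cis (- (real (n - 1) * \<alpha> * t)) * cis (- (real (plus_exponent m n) * p1 * t)) * cis (- (real (minus_exponent m n) * p2 * t)) * cis (\<delta> n * t) =
            cis (- (real (m n) * t))"
          by (simp add: cis_mult \<delta>_def algebra_simps)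
        moreover have "(a * x1) * (b * x2) * (c * x3) * d * x4 = a * b * c * d * (x1 * x2 * x3 * x4)"
          for a b c d x1 x2 x3 x4 :: complex by (simp only: mult_ac)
        ultimately show ?case unfolding t_def[symmetric] elim[rule_format, of "cis t"]
          by (simp only:)
      qed
    qed
  qed (use \<epsilon> in auto)
  moreover have "F n $ m n = of_real (\<alpha> ^ m n / saddle_scale \<alpha> m n) * park_poly (n - 1) (free_spots m n) $ m n" for n
    by (simp add: F_def fps_compose_linear)
  moreover have "(1 - 2 * \<alpha> - \<alpha>\<^sup>2) / (2 * sqrt (pi * (\<epsilon> / 2))) = sqrt ((1 - 2 * \<alpha> - \<alpha>\<^sup>2) * (1 - \<alpha>\<^sup>2) / (2 * pi * \<alpha>))"
  proof -
    define D where "D = 1 - 2 * \<alpha> - \<alpha>\<^sup>2"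
    have D: "D > 0" using subcritical_bounds by (simp add: D_def)
    have "2 * sqrt (pi * (\<epsilon> / 2)) = sqrt (4 * (pi * (\<epsilon> / 2)))" by (subst real_sqrt_mult[of 4]) simp
    then have "D / (2 * sqrt (pi * (\<epsilon> / 2))) = sqrt (D\<^sup>2) / sqrt (4 * (pi * (\<epsilon> / 2)))" using D by simp
    also have "\<dots> = sqrt (D\<^sup>2 / (4 * (pi * (\<epsilon> / 2))))" by (simp only: real_sqrt_divide)
    also have "D\<^sup>2 / (4 * (pi * (\<epsilon> / 2))) = D * (1 - \<alpha>\<^sup>2) / (2 * pi * \<alpha>)"
    proof -
      have "D\<^sup>2 / (4 * (pi * (a * D / q / 2))) = D * q / (2 * pi * a)" if "q > 0" "a > 0" for a q :: real
        using that D by (simp add: power2_eq_square field_simps)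
      from this[OF a2 \<alpha>(1)] show ?thesis unfolding \<epsilon>_def D_def[symmetric] .
    qed
    finally show ?thesis by (simp add: D_def)
  qed
  ultimately show ?thesis by (simp only: of_real_divide[symmetric])
qed

end

section \<open>Assembling the limit\<close>

text \<open>The coefficient of \<open>park_poly\<close>, \<open>binomial_asymptotics\<close> for its
  scale, the Poisson estimate of \<open>fact (m n)\<close> and the central binomial coefficient each
  carry one \<open>sqrt n\<close>, so these cancel in \<open>X1 * X2 / (X3 * X4)\<close>. The
  correction \<open>exp (- \<alpha>)\<close> stems from \<open>n - 1\<close> against
  \<open>n\<close> in the exponentials, and \<open>(1 - \<alpha>)\<^sup>2\<close> from the
  difference 2 between \<open>free_spots\<close> and \<open>minus_exponent\<close>.\<close>

lemma park_prob_limit_subcritical: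
  fixes \<alpha> :: real and m :: "nat \<Rightarrow> nat"
  assumes \<alpha>: "0 < \<alpha>" "\<alpha> < sqrt 2 - 1"
    and m: "\<And>n. \<bar>real n * \<alpha> - real (m n)\<bar> \<le> 1"
  shows "(\<lambda>n. park_prob n (m n)) \<longlonglongrightarrow> sqrt (1 - 2 * \<alpha> - \<alpha>\<^sup>2) / ((1 - \<alpha>)\<^sup>2 * exp \<alpha>)"
proof -
  note idx = index_eqs[OF \<alpha> m]
  note bounds = subcritical_bounds[OF \<alpha> m]
  let ?k = "free_spots m" and ?b = "plus_exponent m" and ?c = "minus_exponent m" and ?q = "saddle_scale \<alpha> m"
  \<comment> \<open>About \<open>(1 - \<alpha>) n\<close> of \<open>2 n\<close> elements are chosen,
    so this \<open>p\<close> puts the mean of the binomial distribution at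
    \<open>free_spots m n\<close>.\<close>
  define p where "p = (1 - \<alpha>) / 2"
  have p: "0 < p" "p < 1" "1 - p = (1 + \<alpha>) / 2" using \<alpha> bounds by (auto simp: p_def field_simps)
  define X1 where "X1 = (\<lambda>n. sqrt n * (\<alpha> ^ m n / ?q n * Re (park_poly (n - 1) (?k n) $ m n)))"
  define X2 where "X2 = (\<lambda>n. sqrt n * (real ((2 * (n - 1)) choose ?k n) * p ^ ?k n * (1 - p) ^ (2 * (n - 1) - ?k n)))"
  define X3 where "X3 = (\<lambda>n. sqrt n * (exp (- (real n * \<alpha>)) * (real n * \<alpha>) ^ m n / fact (m n)))"
  define X4 where "X4 = (\<lambda>n. sqrt n * (real ((2 * (n - 1)) choose (n - 1)) * (1 / 2) ^ (n - 1) * (1 - 1 / 2) ^ (2 * (n - 1) - (n - 1))))"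
  define D where "D = 1 - 2 * \<alpha> - \<alpha>\<^sup>2"
  have D: "D > 0" using bounds by (simp add: D_def)
  have a2: "1 - \<alpha>\<^sup>2 > 0" using \<alpha>(1) bounds by (simp add: power_less_one_iff abs_square_less_1)
  have X1: "X1 \<longlonglongrightarrow> sqrt (D * (1 - \<alpha>\<^sup>2) / (2 * pi * \<alpha>))"
    using tendsto_Re[OF park_poly_asymptotics[OF \<alpha> m]] by (simp add: X1_def D_def mult.assoc)
  have M: "(\<lambda>n. real (2 * (n - 1)) / real n) \<longlonglongrightarrow> 2"
    using tendsto_mult[OF tendsto_const[of 2] index_ratios(1)[OF \<alpha> m]] by simp
  obtain n0 where n0: "\<And>n. n \<ge> n0 \<Longrightarrow> real (?k n) = real n - real (m n) \<and> real (n - 1) = real n - 1"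
    using idx unfolding eventually_sequentially by blast
  have "X2 \<longlonglongrightarrow> 1 / sqrt (2 * pi * 2 * p * (1 - p))"
    unfolding X2_def
  proof (rule binomial_asymptotics[OF p(1,2) _ M])
    fix n assume n: "n \<ge> n0"
    have k: "real (?k n) = real n - real (m n)" "real (n - 1) = real n - 1" using n0[OF n] by auto
    have "real (2 * (n - 1)) * p - real (?k n) = - (real n * \<alpha> - real (m n)) - (1 - \<alpha>)"
      unfolding k of_nat_mult p_def by (simp add: field_simps)
    then show "\<bar>real (2 * (n - 1)) * p - real (?k n)\<bar> \<le> 2" using m[of n] \<alpha> bounds by linarith
  qed simp
  also have "2 * pi * 2 * p * (1 - p) = pi * (1 - \<alpha>\<^sup>2)"
    unfolding p(3) p_def by (simp add: field_simps power2_eq_square)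
  finally have X2: "X2 \<longlonglongrightarrow> 1 / sqrt (pi * (1 - \<alpha>\<^sup>2))" .
  have X3: "X3 \<longlonglongrightarrow> 1 / sqrt (2 * pi * \<alpha>)"
    unfolding X3_def by (rule poisson_asymptotics[OF \<alpha>(1) m])
  have "X4 \<longlonglongrightarrow> 1 / sqrt (2 * pi * 2 * (1 / 2) * (1 - 1 / 2))"
    unfolding X4_def by (rule binomial_asymptotics[OF _ _ _ M, where C = 0 and ?n0.0 = 0]) auto
  then have X4: "X4 \<longlonglongrightarrow> 1 / sqrt pi" by simp
  have "(\<lambda>n. X1 n * X2 n / (X3 n * X4 n) * (exp (- \<alpha>) / (1 - \<alpha>)\<^sup>2)) \<longlonglongrightarrow>
      sqrt (D * (1 - \<alpha>\<^sup>2) / (2 * pi * \<alpha>)) * (1 / sqrt (pi * (1 - \<alpha>\<^sup>2))) / (1 / sqrt (2 * pi * \<alpha>) * (1 / sqrt pi)) *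
      (exp (- \<alpha>) / (1 - \<alpha>)\<^sup>2)"
    using \<alpha>(1) by (intro tendsto_intros X1 X2 X3 X4) auto
  also have "sqrt (D * (1 - \<alpha>\<^sup>2) / (2 * pi * \<alpha>)) * (1 / sqrt (pi * (1 - \<alpha>\<^sup>2))) / (1 / sqrt (2 * pi * \<alpha>) * (1 / sqrt pi)) = sqrt D"
  proof -
    have "sqrt (2 * pi * \<alpha>) > 0" "sqrt (1 - \<alpha>\<^sup>2) > 0" "sqrt pi > 0" using \<alpha>(1) a2 by simp_all
    moreover have "sqrt (D * (1 - \<alpha>\<^sup>2) / (2 * pi * \<alpha>)) = sqrt D * sqrt (1 - \<alpha>\<^sup>2) / sqrt (2 * pi * \<alpha>)"
      by (simp only: real_sqrt_divide real_sqrt_mult)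
    moreover have "sqrt (pi * (1 - \<alpha>\<^sup>2)) = sqrt pi * sqrt (1 - \<alpha>\<^sup>2)" by (simp only: real_sqrt_mult)
    moreover have "D' * a / t * (1 / (q * a)) / (1 / t * (1 / q)) = D'" if "t > 0" "a > 0" "q > 0" for D' a t q :: real
      using that by (simp add: field_simps)
    ultimately show ?thesis by (simp only:)
  qed
  also have "sqrt D * (exp (- \<alpha>) / (1 - \<alpha>)\<^sup>2) = sqrt (1 - 2 * \<alpha> - \<alpha>\<^sup>2) / ((1 - \<alpha>)\<^sup>2 * exp \<alpha>)"
    by (simp add: D_def exp_minus field_simps)
  finally have "(\<lambda>n. X1 n * X2 n / (X3 n * X4 n) * (exp (- \<alpha>) / (1 - \<alpha>)\<^sup>2)) \<longlonglongrightarrow>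
      sqrt (1 - 2 * \<alpha> - \<alpha>\<^sup>2) / ((1 - \<alpha>)\<^sup>2 * exp \<alpha>)" .
  then show ?thesis
  proof (rule Lim_transform_eventually)
    show "eventually (\<lambda>n. X1 n * X2 n / (X3 n * X4 n) * (exp (- \<alpha>) / (1 - \<alpha>)\<^sup>2) = park_prob n (m n)) sequentially"
      using idx eventually_cars_small[OF \<alpha> m] eventually_gt_at_top[of 0]
    proof eventually_elim
      case (elim n)
      define N where "N = n - 1"
      define C where "C = real ((2 * N) choose ?k n)"
      define B where "B = real ((2 * N) choose N)"
      define W where "W = Re (park_poly N (?k n) $ m n)"
      have n: "n = Suc N" using elim by (simp add: N_def)
      have k: "?k n = Suc N - m n" "m n < N" "1 \<le> m n" "2 \<le> ?k n" "?k n \<le> N"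
        using elim by (auto simp: N_def free_spots_def)
      have C: "C > 0" using k by (simp add: C_def)
      have B: "B > 0" by (simp add: B_def)
      have "of_nat (Suc N) * complex_of_real (parked_weight (Suc N) (m n)) = park_poly N (Suc N - m n) $ m n"
        by (rule parked_weight_eq[OF k(3,2)])
      from arg_cong[OF this, of Re] have W: "real n * parked_weight n (m n) = W"
        unfolding W_def k(1) n[symmetric] by simp
      have P0: "real n * parked_weight n 0 = B" using parked_weight_0[of N] by (simp add: B_def n del: of_nat_Suc)
      have "park_prob n (m n) = fact (m n) * parked_weight n (m n) / (parked_weight n 0 * real n ^ m n)"
        using n by (intro park_prob_eq) simp
      also have "\<dots> = fact (m n) * (real n * parked_weight n (m n)) / ((real n * parked_weight n 0) * real n ^ m n)"
        using n by simp
      also have "\<dots> = fact (m n) * W / (B * real n ^ m n)" unfolding W P0 ..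
      finally have prob: "park_prob n (m n) = fact (m n) * W / (B * real n ^ m n)" .
      have kc: "?k n = ?c n + 2" using k(4) by (simp add: minus_exponent_def)
      have "2 * N - ?k n = ?b n" by (simp add: plus_exponent_def N_def)
      have sum: "?c n + 2 + ?b n = 2 * N"
        using k(5) unfolding kc[symmetric] by (simp add: plus_exponent_def N_def)
      have e: "exp (- (real n * \<alpha>)) = 1 / (exp (real N * \<alpha>) * exp \<alpha>)"
        by (simp add: n exp_minus field_simps exp_add[symmetric])
      have pw: "p ^ ?k n * (1 - p) ^ ?b n = (1 - \<alpha>) ^ ?c n * (1 - \<alpha>)\<^sup>2 * (1 + \<alpha>) ^ ?b n * (1 / 2) ^ (2 * N)"
      proof -
        have "(a / 2) ^ (i + 2) * (b / 2) ^ j = a ^ i * a\<^sup>2 * b ^ j * (1 / 2) ^ (i + 2 + j)"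
          for a b :: real and i j
          by (simp add: power_divide power_add power2_eq_square mult_ac)
        then show ?thesis unfolding p(3) unfolding p_def kc sum[symmetric] .
      qed
      have X2': "X2 n = sqrt n * (C * ((1 - \<alpha>) ^ ?c n * (1 - \<alpha>)\<^sup>2 * (1 + \<alpha>) ^ ?b n * (1 / 2) ^ (2 * N)))"
        unfolding X2_def N_def[symmetric] C_def[symmetric] \<open>2 * N - ?k n = ?b n\<close> pw[symmetric] by (simp only: mult.assoc)
      have X4': "X4 n = sqrt n * (B * (1 / 2) ^ (2 * N))"
      proof -
        have "(1 / 2 :: real) ^ N * (1 - 1 / 2) ^ (2 * N - N) = (1 / 2) ^ (2 * N)"
          by (simp add: mult_2 power_add)
        then show ?thesis unfolding X4_def N_def[symmetric] B_def[symmetric] by (simp only: mult.assoc)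
      qed
      have X1': "X1 n = sqrt n * (\<alpha> ^ m n / (C * exp (real N * \<alpha>) * (1 + \<alpha>) ^ ?b n * (1 - \<alpha>) ^ ?c n) * W)"
        by (simp add: X1_def saddle_scale_def N_def C_def W_def)
      have X3': "X3 n = sqrt n * (1 / (exp (real N * \<alpha>) * exp \<alpha>) * (real n ^ m n * \<alpha> ^ m n) / fact (m n))"
        by (simp add: X3_def e power_mult_distrib)
      \<comment> \<open>The cancellation is carried out for arbitrary positive reals, with powers
        and exponentials as opaque quantities.\<close>
      have alg: "(s * (am / (C * E * bb * cc) * W)) * (s * (C * (cc * a2 * bb * h))) /
          ((s * (1 / (E * ea) * (nm * am) / f)) * (s * (B * h))) * (1 / ea / a2) = f * W / (B * nm)"
        if "s > 0" "am > 0" "C > 0" "E > 0" "bb > 0" "cc > 0" "a2 > 0" "h > 0" "ea > 0" "nm > 0" "f > 0" "B > 0"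
        for s am C E bb cc W a2 h ea nm f B :: real
        using that by (simp add: field_simps)
      have pos: "sqrt n > 0" "\<alpha> ^ m n > 0" "exp (real N * \<alpha>) > 0" "(1 + \<alpha>) ^ ?b n > 0" "(1 - \<alpha>) ^ ?c n > 0"
        "(1 - \<alpha>)\<^sup>2 > 0" "(1 / 2 :: real) ^ (2 * N) > 0" "exp \<alpha> > 0" "real n ^ m n > 0" "(fact (m n) :: real) > 0"
        using \<alpha>(1) bounds n by simp_all
      have "exp (- \<alpha>) / (1 - \<alpha>)\<^sup>2 = 1 / exp \<alpha> / (1 - \<alpha>)\<^sup>2" by (simp add: exp_minus divide_inverse)
      then show ?case
        unfolding X1' X2' X3' X4' prob
        using alg[OF pos(1,2) C pos(3,4,5,6,7,8,9,10) B, of W] by (simp only:)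
    qed
  qed
qed

lemma park_prob_nonneg: "park_prob n m \<ge> 0"
  by (simp add: park_prob_def)

lemma park_prob_limit_supercritical:
  fixes \<alpha> :: real
  assumes "\<alpha> \<ge> sqrt 2 - 1"
  shows "(\<lambda>n. park_prob n (nat \<lfloor>\<alpha> * real n\<rfloor>)) \<longlonglongrightarrow> 0"
proof (rule LIMSEQ_I)
  fix r :: real assume r: "r > 0"
  define L where "L = (\<lambda>\<beta> :: real. sqrt (1 - 2 * \<beta> - \<beta>\<^sup>2) / ((1 - \<beta>)\<^sup>2 * exp \<beta>))"
  define c :: real where "c = sqrt 2 - 1"
  have c: "0 < c" "c < 1"
  proof -
    show "0 < c" by (simp add: c_def)
    have "sqrt 2 < 2" by (rule real_less_lsqrt) auto
    then show "c < 1" by (simp add: c_def)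
  qed
  have "1 - 2 * c - c\<^sup>2 = 0" by (simp add: c_def power2_eq_square algebra_simps)
  then have "L c = 0" by (simp add: L_def)
  moreover have "isCont L c" unfolding L_def using c by (intro continuous_intros) auto
  ultimately have "(L \<longlongrightarrow> 0) (at_left c)"
    unfolding isCont_def by (metis at_le tendsto_mono top_greatest)
  then have "eventually (\<lambda>\<beta>. L \<beta> < r) (at_left c)" using r by (rule order_tendstoD(2))
  moreover have "eventually (\<lambda>\<beta>. \<beta> \<in> {0<..<c}) (at_left c)"
    using eventually_at_left_real[OF c(1)] .
  \<comment> \<open>Both requirements hold in a left neighbourhood of the critical density, so a
    single comparison density \<beta> can be fixed for the given \<open>r\<close>.\<close>
  ultimately have "eventually (\<lambda>\<beta>. L \<beta> < r \<and> \<beta> \<in> {0<..<c}) (at_left c)" by eventually_elim simp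
  then obtain \<beta> where \<beta>: "L \<beta> < r" "0 < \<beta>" "\<beta> < c"
    using eventually_happens trivial_limit_at_left_real by fastforce
  have "(\<lambda>n. park_prob n (nat \<lfloor>\<beta> * real n\<rfloor>)) \<longlonglongrightarrow> L \<beta>"
    unfolding L_def
  proof (rule park_prob_limit_subcritical)
    fix n :: nat
    have "\<lfloor>\<beta> * real n\<rfloor> \<ge> 0" using \<beta> by simp
    then have "real (nat \<lfloor>\<beta> * real n\<rfloor>) = of_int \<lfloor>\<beta> * real n\<rfloor>" by simp
    then show "\<bar>real n * \<beta> - real (nat \<lfloor>\<beta> * real n\<rfloor>)\<bar> \<le> 1" unfolding mult.commute[of "real n"] by linarith
  qed (use \<beta> c_def in auto)
  then have "eventually (\<lambda>n. park_prob n (nat \<lfloor>\<beta> * real n\<rfloor>) < r) sequentially" using \<beta>(1) by (rule order_tendstoD(2))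
  then obtain n0 where n0: "\<And>n. n \<ge> n0 \<Longrightarrow> park_prob n (nat \<lfloor>\<beta> * real n\<rfloor>) < r"
    unfolding eventually_sequentially by blast
  show "\<exists>n0. \<forall>n\<ge>n0. norm (park_prob n (nat \<lfloor>\<alpha> * real n\<rfloor>) - 0) < r"
  proof (intro exI allI impI)
    fix n assume n: "n \<ge> max n0 1"
    have "\<beta> * real n \<le> \<alpha> * real n" using \<beta> assms by (intro mult_right_mono) (auto simp: c_def)
    then have "nat \<lfloor>\<beta> * real n\<rfloor> \<le> nat \<lfloor>\<alpha> * real n\<rfloor>" by (intro nat_mono floor_mono)
    then have "park_prob n (nat \<lfloor>\<alpha> * real n\<rfloor>) \<le> park_prob n (nat \<lfloor>\<beta> * real n\<rfloor>)"
      using n by (intro park_prob_antimono) auto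
    also have "\<dots> < r" using n0 n by simp
    finally show "norm (park_prob n (nat \<lfloor>\<alpha> * real n\<rfloor>) - 0) < r" using park_prob_nonneg by simp
  qed
qed

theorem theorem1p1:
  fixes \<alpha> :: real
  assumes "\<alpha> \<ge> 0"
  shows "(\<lambda>n. measure_pmf.prob (parking_pmf n (nat \<lfloor>\<alpha> * real n\<rfloor>))
                 {(t, cars). all_cars_park cars})
         \<longlonglongrightarrow> (if \<alpha> \<le> sqrt 2 - 1
             then sqrt (1 - 2 * \<alpha> - \<alpha>\<^sup>2) / ((1 - \<alpha>)\<^sup>2 * exp \<alpha>)
             else 0)"
proof -
  consider "\<alpha> = 0" | "0 < \<alpha>" "\<alpha> < sqrt 2 - 1" | "\<alpha> \<ge> sqrt 2 - 1" using assms by linarith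
  then have "(\<lambda>n. park_prob n (nat \<lfloor>\<alpha> * real n\<rfloor>)) \<longlonglongrightarrow> (if \<alpha> \<le> sqrt 2 - 1
             then sqrt (1 - 2 * \<alpha> - \<alpha>\<^sup>2) / ((1 - \<alpha>)\<^sup>2 * exp \<alpha>) else 0)"
  proof cases
    \<comment> \<open>The saddle point degenerates at \<alpha> = 0, but without cars the probability
      is 1 for every \<open>n \<ge> 1\<close>.\<close>
    case 1
    have "eventually (\<lambda>n. 1 = park_prob n (nat \<lfloor>\<alpha> * real n\<rfloor>)) sequentially"
      using eventually_ge_at_top[of 1]
    proof eventually_elim
      case (elim n)
      then have "parked_weight n 0 \<noteq> 0" using parked_weight_0[of "n - 1"] by (auto simp: binomial_eq_0_iff)
      then show ?case using 1 elim by (simp add: park_prob_eq)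
    qed
    then have "(\<lambda>n. park_prob n (nat \<lfloor>\<alpha> * real n\<rfloor>)) \<longlonglongrightarrow> 1"
      by (rule Lim_transform_eventually[OF tendsto_const])
    then show ?thesis using 1 by simp
  next
    case 2
    have "(\<lambda>n. park_prob n (nat \<lfloor>\<alpha> * real n\<rfloor>)) \<longlonglongrightarrow> sqrt (1 - 2 * \<alpha> - \<alpha>\<^sup>2) / ((1 - \<alpha>)\<^sup>2 * exp \<alpha>)"
    proof (rule park_prob_limit_subcritical[OF 2])
      fix n :: nat
      have "\<lfloor>\<alpha> * real n\<rfloor> \<ge> 0" using 2 by simp
      then have "real (nat \<lfloor>\<alpha> * real n\<rfloor>) = of_int \<lfloor>\<alpha> * real n\<rfloor>" by simp
      then show "\<bar>real n * \<alpha> - real (nat \<lfloor>\<alpha> * real n\<rfloor>)\<bar> \<le> 1" unfolding mult.commute[of "real n"] by linarith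
    qed
    then show ?thesis using 2 by simp
  next
    \<comment> \<open>At the critical density itself the square root vanishes, so both branches of
      the formula are 0.\<close>
    case 3
    have "1 - 2 * \<alpha> - \<alpha>\<^sup>2 = 0" if "\<alpha> \<le> sqrt 2 - 1"
    proof -
      have \<alpha>: "\<alpha> = sqrt 2 - 1" using that 3 by simp
      show ?thesis unfolding \<alpha> by (simp add: power2_eq_square algebra_simps)
    qed
    then show ?thesis using park_prob_limit_supercritical[OF 3] by (auto split: if_splits)
  qed
  then show ?thesis by (simp only: park_prob_def)
qed

end
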